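(* Let $\alpha>0$. A discrete set $\Gamma\subset\mathbb{C}$ is a set of interpolation for $F_\alpha^2$ if and only if $\Gamma$ is uniformly discrete and $D^+(\Gamma)<\alpha/\pi$.
   Context: For $\alpha>0$ let $d\mu_\alpha(z)=(\alpha/\pi)e^{-\alpha|z|^2}\,dx\,dy$, $z=x+iy$. The Bargmann-Fock space $F_\alpha^2$ is the space of entire functions $f$ with $\int_{\mathbb{C}}|f(z)|^2\,d\mu_\alpha(z)<\infty$. A discrete set $\Gamma=\{z_j\}\subset\mathbb{C}$ (distinct points) is a set of interpolation for $F_\alpha^2$ if for every $l^2$-sequence $\{a_j\}$ of complex numbers there exists $f\in F_\alpha^2$ such that $e^{-\alpha|z_j|^2/2}f(z_j)=a_j$ for all $j$. A set $\Gamma=\{z_j\}\subset\mathbb{C}$ (distinct points) is uniformly discrete if $q=\inf_{j\ne k}|z_j-z_k|>0$. Upper uniform density: fix a compact set $I\subset\mathbb{C}$ of (Lebesgue) measure $1$ whose boundary has measure $0$. For a uniformly discrete set $\Gamma$ and $r>0$, let $n^+(r)$ be the largest number of points of $\Gamma$ to be found in a translate of $rI$. Then $D^+(\Gamma)=\limsup_{r\to\infty} n^+(r)/r^2$. (This value is independent of the choice of $I$, by a result of Landau.) *)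

theory Defs
  imports "HOL-Analysis.Analysis"
begin

definition fock_measure :: "real \<Rightarrow> complex measure" where
  "fock_measure \<alpha> = density lborel (\<lambda>z. ennreal (\<alpha> / pi * exp (- \<alpha> * (cmod z)\<^sup>2)))"

definition fock_space :: "real \<Rightarrow> (complex \<Rightarrow> complex) set" where
  "fock_space \<alpha> = {f. f holomorphic_on UNIV \<and> integrable (fock_measure \<alpha>) (\<lambda>z. (cmod (f z))\<^sup>2)}"

(* The points of a discrete set are distinct, so square-summable sequences indexed by the points
   are given as functions on the set itself; sums of nonnegative terms do not depend on an
   enumeration. *)
definition interpolation_set :: "real \<Rightarrow> complex set \<Rightarrow> bool" where
  "interpolation_set \<alpha> \<Gamma> \<longleftrightarrow>
     (\<forall>a :: complex \<Rightarrow> complex. (\<lambda>z. (cmod (a z))\<^sup>2) summable_on \<Gamma> \<longrightarrow>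
        (\<exists>f\<in>fock_space \<alpha>. \<forall>z\<in>\<Gamma>. complex_of_real (exp (- \<alpha> * (cmod z)\<^sup>2 / 2)) * f z = a z))"

(* Meaningful only for uniformly discrete sets and bounded I, where the set of cardinalities
   is finite. *)
definition max_points :: "complex set \<Rightarrow> complex set \<Rightarrow> real \<Rightarrow> nat" where
  "max_points I \<Gamma> r = Max (range (\<lambda>w. card (\<Gamma> \<inter> (\<lambda>z. w + complex_of_real r * z) ` I)))"

definition upper_uniform_density :: "complex set \<Rightarrow> complex set \<Rightarrow> ereal" where
  "upper_uniform_density I \<Gamma> = Limsup at_top (\<lambda>r::real. ereal (real (max_points I \<Gamma> r) / r\<^sup>2))"

end

theory Submission
  imports Defs "HOL-Complex_Analysis.Complex_Analysis"
begin

text \<open>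
  Both directions compare the points of \<open>\<Gamma>\<close> with the zeros of entire functions.

  \<^bold>\<open>Necessity.\<close> By Baire's theorem, an interpolation set has for each point \<open>w\<close> a function whose weighted
  value at \<open>w\<close> is \<open>1\<close>, which vanishes at the other points, and has energy at most a constant \<open>M\<close> independent of \<open>w\<close>
  (\<open>interpolation_uniform_bound\<close>). Translate \<open>w\<close> to the origin. Removing the other zeros by Blaschke
  factors on each circle turns the bound on the energy into
  \<open>\<integral> (\<Prod>\<^bsub>\<gamma>\<noteq>w\<^esub> max 1 (|z|\<^sup>2 / |\<gamma> - w|\<^sup>2)) exp (- \<alpha> |z|\<^sup>2) dA(z) \<le> M\<close>, a form of Jensen's inequality (\<open>interpolation_local_energy\<close>). For two points this already bounds their
  distance from below. For the density, consider a finite part \<open>P\<close> of \<open>\<Gamma>\<close> and the \<open>n\<close> scales \<open>|z|\<^sup>2 \<sim> 2 ^ k\<close>.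
  They share the energy \<open>M\<close>, so at a typical scale only \<open>M / n\<close> is left, and convexity of the exponential
  gives an upper bound for the logarithmic energy \<open>\<Sum>\<^bsub>w\<noteq>\<gamma>\<^esub> log\<^sup>+ (|z| / |w - \<gamma>|)\<close> averaged over \<open>z\<close> that is
  better by \<open>ln n\<close> per point than what the density \<open>\<alpha> / \<pi>\<close> would allow. The averaged kernel dominates a superposition
  of Gaussians in \<open>w - \<gamma>\<close>, and these are positive definite; hence Cauchy's inequality bounds the energy, diagonal
  included, from below by \<open>(card P)\<^sup>2\<close> divided by the area occupied. The diagonal terms cost \<open>ln (2 ^ k)\<close> at
  scale \<open>k\<close>, which is exactly what the weight \<open>|z|\<^sup>2\<close> contributes, so the gain \<open>ln n\<close> survives and makes the
  inequality for the density strict (\<open>interpolation_count_bound\<close>).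

  \<^bold>\<open>Sufficiency.\<close> A square of large side \<open>s\<close> contains at most \<open>N\<close> points of \<open>\<Gamma>\<close>, where \<open>\<pi> N / s\<^sup>2 < \<alpha>\<close>
  (\<open>density_imp_cell_count\<close>). Split the points into \<open>N\<close> classes with at most one point in each cell of the
  lattice \<open>s \<int>[\<i>]\<close>. For one class (and \<open>s = 1\<close>) take a function that vanishes on \<open>\<int>[\<i>]\<close> and grows like
  \<open>exp (\<pi> |z|\<^sup>2 / 2)\<close>, and move each zero from the lattice point to the point of \<open>\<Gamma>\<close> in its cell. With the usual
  convergence factors this changes the growth by \<open>exp (O (|z| powr (3 / 2)))\<close> only
  (\<open>entire_with_one_zero_per_cell\<close>). The product over the classes, translated, is for each \<open>w \<in> \<Gamma>\<close> a function
  with weighted value \<open>1\<close> at \<open>w\<close>, which vanishes at the other points and whose weighted modulus is at most \<open>C exp (- \<epsilon> |z - w|\<^sup>2)\<close>.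
  Sums of these functions solve every finite interpolation problem with a uniform bound (\<open>finite_interpolation\<close>), and a
  limit by Montel's theorem solves the infinite one.
\<close>

section \<open>Lebesgue measure on the complex plane\<close>

lemma lborel_complex_eq_distr:
  "(lborel :: complex measure) = distr (lborel \<Otimes>\<^sub>M lborel) borel (\<lambda>(x,y). Complex x y)"
proof (rule lborel_eqI)
  fix l u :: complex
  assume le: "\<And>b. b \<in> Basis \<Longrightarrow> l \<bullet> b \<le> u \<bullet> b"
  have lu: "Re l \<le> Re u" "Im l \<le> Im u"
    using le[of 1] le[of \<i>] by (auto simp: Basis_complex_def)
  have m: "(\<lambda>(x,y). Complex x y) \<in> borel_measurable (lborel \<Otimes>\<^sub>M lborel)"
    unfolding Complex_eq split_def by measurable
  have eq: "(\<lambda>(x,y). Complex x y) -` box l u \<inter> space (lborel \<Otimes>\<^sub>M lborel) = {Re l<..<Re u} \<times> {Im l<..<Im u}"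
    by (auto simp: box_def Basis_complex_def space_pair_measure)
  show "emeasure (distr (lborel \<Otimes>\<^sub>M lborel) borel (\<lambda>(x,y). Complex x y)) (box l u) = (\<Prod>b\<in>Basis. (u - l) \<bullet> b)"
    using lu m
    by (simp add: emeasure_distr eq lborel.emeasure_pair_measure_Times Basis_complex_def ennreal_mult'')
qed simp

lemma nn_integral_complex:
  fixes f :: "complex \<Rightarrow> ennreal"
  assumes [measurable]: "f \<in> borel_measurable borel"
  shows "(\<integral>\<^sup>+z. f z \<partial>lborel) = (\<integral>\<^sup>+x. \<integral>\<^sup>+y. f (Complex x y) \<partial>lborel \<partial>lborel)"
    and "(\<integral>\<^sup>+z. f z \<partial>lborel) = (\<integral>\<^sup>+y. \<integral>\<^sup>+x. f (Complex x y) \<partial>lborel \<partial>lborel)"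
proof -
  have m[measurable]: "(\<lambda>p. Complex (fst p) (snd p)) \<in> borel_measurable (lborel \<Otimes>\<^sub>M lborel)"
    unfolding Complex_eq by measurable
  have "(\<integral>\<^sup>+z. f z \<partial>lborel) = (\<integral>\<^sup>+p. f (Complex (fst p) (snd p)) \<partial>(lborel \<Otimes>\<^sub>M lborel))"
    by (subst lborel_complex_eq_distr, subst nn_integral_distr) (simp_all add: split_def)
  also have "\<dots> = (\<integral>\<^sup>+x. \<integral>\<^sup>+y. f (Complex x y) \<partial>lborel \<partial>lborel)"
    by (subst lborel.nn_integral_fst[symmetric]) simp_all
  finally show 1: "(\<integral>\<^sup>+z. f z \<partial>lborel) = (\<integral>\<^sup>+x. \<integral>\<^sup>+y. f (Complex x y) \<partial>lborel \<partial>lborel)" .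
  have "(\<lambda>(x,y). f (Complex x y)) \<in> borel_measurable (lborel \<Otimes>\<^sub>M lborel)"
    by (simp add: split_def)
  from lborel_pair.Fubini'[OF this] show "(\<integral>\<^sup>+z. f z \<partial>lborel) = (\<integral>\<^sup>+y. \<integral>\<^sup>+x. f (Complex x y) \<partial>lborel \<partial>lborel)"
    using 1 by simp
qed

lemma nn_integral_lborel_translate:
  fixes f :: "'a::euclidean_space \<Rightarrow> ennreal"
  assumes [measurable]: "f \<in> borel_measurable borel"
  shows "(\<integral>\<^sup>+z. f (a + z) \<partial>lborel) = (\<integral>\<^sup>+z. f z \<partial>lborel)"
proof -
  have "(\<integral>\<^sup>+z. f z \<partial>lborel) = (\<integral>\<^sup>+z. f z \<partial>distr lborel borel ((+) a))"
    by (simp add: lborel_distr_plus)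
  also have "\<dots> = (\<integral>\<^sup>+z. f (a + z) \<partial>lborel)"
    by (subst nn_integral_distr) simp_all
  finally show ?thesis by simp
qed

lemma nn_integral_shear:
  fixes f :: "complex \<Rightarrow> ennreal"
  assumes [measurable]: "f \<in> borel_measurable borel"
  shows "(\<integral>\<^sup>+z. f (z + of_real (t * Im z)) \<partial>lborel) = (\<integral>\<^sup>+z. f z \<partial>lborel)"
    and "(\<integral>\<^sup>+z. f (z + \<i> * of_real (t * Re z)) \<partial>lborel) = (\<integral>\<^sup>+z. f z \<partial>lborel)"
proof -
  have m[measurable]: "(\<lambda>x. Complex x y) \<in> borel_measurable borel"
       "(\<lambda>x. Complex y x) \<in> borel_measurable borel" for y
    unfolding Complex_eq by measurable
  have "(\<integral>\<^sup>+z. f (z + of_real (t * Im z)) \<partial>lborel) = (\<integral>\<^sup>+y. \<integral>\<^sup>+x. f (Complex (t * y + x) y) \<partial>lborel \<partial>lborel)"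
    by (subst nn_integral_complex(2)) (simp_all add: Complex_eq algebra_simps)
  also have "\<dots> = (\<integral>\<^sup>+y. \<integral>\<^sup>+x. f (Complex x y) \<partial>lborel \<partial>lborel)"
    by (subst nn_integral_lborel_translate[of "\<lambda>x. f (Complex x _)"]) simp_all
  finally show "(\<integral>\<^sup>+z. f (z + of_real (t * Im z)) \<partial>lborel) = (\<integral>\<^sup>+z. f z \<partial>lborel)"
    by (simp add: nn_integral_complex(2)[symmetric])
  have "(\<integral>\<^sup>+z. f (z + \<i> * of_real (t * Re z)) \<partial>lborel) = (\<integral>\<^sup>+y. \<integral>\<^sup>+x. f (Complex y (t * y + x)) \<partial>lborel \<partial>lborel)"
    by (subst nn_integral_complex(1)) (simp_all add: Complex_eq algebra_simps)
  also have "\<dots> = (\<integral>\<^sup>+y. \<integral>\<^sup>+x. f (Complex y x) \<partial>lborel \<partial>lborel)"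
    by (subst nn_integral_lborel_translate[of "\<lambda>x. f (Complex _ x)"]) simp_all
  finally show "(\<integral>\<^sup>+z. f (z + \<i> * of_real (t * Re z)) \<partial>lborel) = (\<integral>\<^sup>+z. f z \<partial>lborel)"
    by (simp add: nn_integral_complex(1)[symmetric])
qed

text \<open>A rotation other than \<open>\<plusminus> 1\<close> is a product of three shears, and a shear preserves area because each of its
  slices is a translation.\<close>
lemma nn_integral_rotate:
  fixes f :: "complex \<Rightarrow> ennreal"
  assumes [measurable]: "f \<in> borel_measurable borel" and c: "cmod c = 1"
  shows "(\<integral>\<^sup>+z. f (c * z) \<partial>lborel) = (\<integral>\<^sup>+z. f z \<partial>lborel)"
proof (cases "Im c = 0")
  case True
  then have "c = of_real (Re c)" "\<bar>Re c\<bar> = 1"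
    using c by (auto simp: complex_eq_iff cmod_eq_Re)
  then have "c = 1 \<or> c = -1" by (metis abs_1 abs_eq_iff of_real_1 of_real_minus)
  moreover have "(\<integral>\<^sup>+z. f (- z) \<partial>lborel) = (\<integral>\<^sup>+z. f z \<partial>lborel)"
  proof -
    have "(lborel :: complex measure) = distr lborel borel (\<lambda>x. - x)"
      using lborel_affine[of "-1" "0::complex"] by (simp add: density_1)
    then have "(\<integral>\<^sup>+z. f z \<partial>lborel) = (\<integral>\<^sup>+z. f z \<partial>distr lborel borel (\<lambda>x. - x))"
      by simp
    also have "\<dots> = (\<integral>\<^sup>+z. f (- z) \<partial>lborel)"
      by (subst nn_integral_distr) simp_all
    finally show ?thesis by simp
  qed
  ultimately show ?thesis by auto
next
  case False
  define a b where "a = Re c" and "b = Im c"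
  \<comment> \<open>Minus the tangent of half the angle of rotation.\<close>
  define t where "t = (a - 1) / b"
  have b: "b \<noteq> 0" and ab: "a\<^sup>2 + b\<^sup>2 = 1"
    using False c by (simp_all add: b_def a_def cmod_power2[symmetric])
  define S where "S = (\<lambda>z::complex. z + of_real (t * Im z))"
  define R where "R = (\<lambda>z::complex. z + \<i> * of_real (b * Re z))"
  have [measurable]: "S \<in> borel_measurable borel" "R \<in> borel_measurable borel"
    unfolding S_def R_def by measurable
  have 1: "1 + t * b = a" using b by (simp add: t_def)
  have 2: "t + (a) * t = - b"
  proof -
    have "(t + a * t) * b = (1 + a) * (t * b)" by (simp add: algebra_simps)
    also have "t * b = a - 1" using 1 by simp
    also have "(1 + a) * (a - 1) = (- b) * b"
      using ab by (simp add: power2_eq_square algebra_simps)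
    finally have "(t + a * t) * b = (- b) * b" .
    then show ?thesis using b by (metis mult_cancel_right)
  qed
  have "c * z = S (R (S z))" for z
  proof (rule complex_eqI)
    have "Re (S (R (S z))) = Re z * (1 + t * b) + Im z * (t + (1 + t * b) * t)"
      by (simp add: S_def R_def algebra_simps)
    also have "\<dots> = Re z * a + Im z * (-b)"
      unfolding 1 2 ..
    finally show "Re (c * z) = Re (S (R (S z)))" by (simp add: a_def b_def)
    have "Im (S (R (S z))) = Im z * (1 + t * b) + b * Re z"
      by (simp add: S_def R_def algebra_simps)
    then show "Im (c * z) = Im (S (R (S z)))" unfolding 1 by (simp add: a_def b_def)
  qed
  then have "(\<integral>\<^sup>+z. f (c * z) \<partial>lborel) = (\<integral>\<^sup>+z. f (S (R (S z))) \<partial>lborel)" by simp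
  also have "\<dots> = (\<integral>\<^sup>+z. f (S (R z)) \<partial>lborel)"
    using nn_integral_shear(1)[of "\<lambda>z. f (S (R z))" t] by (simp add: S_def)
  also have "\<dots> = (\<integral>\<^sup>+z. f (S z) \<partial>lborel)"
    using nn_integral_shear(2)[of "\<lambda>z. f (S z)" b] by (simp add: R_def)
  also have "\<dots> = (\<integral>\<^sup>+z. f z \<partial>lborel)"
    using nn_integral_shear(1)[of f t] by (simp add: S_def)
  finally show ?thesis .
qed

text \<open>Both measures give \<open>{..x}\<close> the area \<open>\<pi> x\<close> of the disc of radius \<open>sqrt x\<close>.\<close>
lemma distr_norm_square_lborel:
  "distr (lborel :: complex measure) borel (\<lambda>z. (cmod z)\<^sup>2) =
    density lborel (\<lambda>x. ennreal pi * indicator {0..} x)" (is "?M = ?N")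
proof (rule measure_eqI_generator_eq[where E="range (atMost :: real \<Rightarrow> _)" and \<Omega>=UNIV and A="\<lambda>i. {.. real i}"])
  show "Int_stable (range (atMost :: real \<Rightarrow> _))"
    by (auto simp: Int_stable_def intro: image_eqI[where x="min _ _"] simp: min_def)
  show "range atMost \<subseteq> Pow (UNIV::real set)" by auto
  show "sets ?M = sigma_sets UNIV (range atMost)" "sets ?N = sigma_sets UNIV (range atMost)"
    by (simp_all add: borel_eq_atMost)
  show "range (\<lambda>i. {..real i}) \<subseteq> range atMost" by auto
  show "(\<Union>i. {..real i}) = UNIV" by (auto intro: real_arch_simple)
  have A: "emeasure ?M {..x} = ennreal (pi * max 0 x)" for x :: real
  proof -
    have "(cmod z)\<^sup>2 \<le> x \<longleftrightarrow> cmod z \<le> sqrt x" if "x \<ge> 0" for z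
      using that by (metis norm_ge_zero power_mono real_le_rsqrt real_sqrt_pow2)
    moreover have "\<not> (cmod z)\<^sup>2 \<le> x" if "x < 0" for z
      using that by (meson le_less_trans not_le zero_le_power2)
    ultimately have "(\<lambda>z. (cmod z)\<^sup>2) -` {..x} = (if x < 0 then {} else cball 0 (sqrt x))"
      by (auto simp: not_less)
    then show ?thesis
      by (simp add: emeasure_distr emeasure_cball unit_ball_vol_2)
  qed
  show "emeasure ?M {..real i} \<noteq> \<infinity>" for i by (simp add: A)
  show "emeasure ?M X = emeasure ?N X" if "X \<in> range atMost" for X
  proof -
    from that obtain x where X: "X = {..x}" by auto
    have "emeasure ?N X = (\<integral>\<^sup>+y. ennreal pi * indicator {0..x} y \<partial>lborel)"
      unfolding X by (subst emeasure_density) (auto intro!: nn_integral_cong simp: indicator_def)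
    also have "\<dots> = ennreal (pi * max 0 x)"
      by (subst nn_integral_cmult) (auto simp: ennreal_mult'' max_def)
    finally show ?thesis by (simp add: A X)
  qed
qed

lemma nn_integral_radial:
  fixes \<phi> :: "real \<Rightarrow> ennreal"
  assumes [measurable]: "\<phi> \<in> borel_measurable borel"
  shows "(\<integral>\<^sup>+z. \<phi> ((cmod z)\<^sup>2) \<partial>lborel) = ennreal pi * (\<integral>\<^sup>+x\<in>{0..}. \<phi> x \<partial>lborel)"
proof -
  have "(\<integral>\<^sup>+z. \<phi> ((cmod z)\<^sup>2) \<partial>lborel) = (\<integral>\<^sup>+x. \<phi> x \<partial>distr lborel borel (\<lambda>z::complex. (cmod z)\<^sup>2))"
    by (subst nn_integral_distr) simp_all
  also have "\<dots> = (\<integral>\<^sup>+x. ennreal pi * (\<phi> x * indicator {0..} x) \<partial>lborel)"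
    unfolding distr_norm_square_lborel
    by (subst nn_integral_density) (auto intro!: nn_integral_cong simp: mult_ac)
  also have "\<dots> = ennreal pi * (\<integral>\<^sup>+x\<in>{0..}. \<phi> x \<partial>lborel)"
    by (subst nn_integral_cmult) auto
  finally show ?thesis .
qed

lemma nn_integral_exp_scale:
  assumes "c > 0"
  shows "(\<integral>\<^sup>+x\<in>{0..}. ennreal (exp (- c * x)) \<partial>lborel) = ennreal (1 / c)"
proof -
  have "((\<lambda>x. - exp (- c * x) / c) \<longlongrightarrow> 0) at_top"
    using assms by real_asymp
  then have "(\<integral>\<^sup>+x. ennreal (exp (- c * x)) * indicator {0..} x \<partial>lborel) = ennreal (0 - (- exp (- c * 0) / c))"
    using assms by (intro nn_integral_FTC_atLeast) (auto intro!: derivative_eq_intros)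
  then show ?thesis by simp
qed

lemma nn_integral_gauss:
  assumes c: "c > 0"
  shows "(\<integral>\<^sup>+z. ennreal (exp (- c * (cmod (z - a))\<^sup>2)) \<partial>lborel) = ennreal (pi / c)"
proof -
  have "(\<integral>\<^sup>+z. ennreal (exp (- c * (cmod (z - a))\<^sup>2)) \<partial>lborel) = (\<integral>\<^sup>+z. ennreal (exp (- c * (cmod z)\<^sup>2)) \<partial>lborel)"
    using nn_integral_lborel_translate[of "\<lambda>z. ennreal (exp (- c * (cmod z)\<^sup>2))" "-a"] by simp
  also have "\<dots> = ennreal (pi / c)"
    using c by (subst nn_integral_radial[of "\<lambda>x. ennreal (exp (- c * x))"])
      (simp_all add: nn_integral_exp_scale[simplified] ennreal_mult''[symmetric])
  finally show ?thesis .
qed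

lemma nn_integral_gauss_tail:
  assumes c: "c > 0" and R: "R \<ge> 0"
  shows "(\<integral>\<^sup>+z\<in>- ball a R. ennreal (exp (- c * (cmod (z - a))\<^sup>2)) \<partial>lborel) = ennreal (pi / c * exp (- c * R\<^sup>2))"
proof -
  have "((\<lambda>x. - exp (- c * x) / c) \<longlongrightarrow> 0) at_top"
    using assms by real_asymp
  then have *: "(\<integral>\<^sup>+x. ennreal (exp (- c * x)) * indicator {R\<^sup>2..} x \<partial>lborel) = ennreal (0 - (- exp (- c * R\<^sup>2) / c))"
    using assms by (intro nn_integral_FTC_atLeast) (auto intro!: derivative_eq_intros)
  have "(\<integral>\<^sup>+z\<in>- ball a R. ennreal (exp (- c * (cmod (z - a))\<^sup>2)) \<partial>lborel) =
     (\<integral>\<^sup>+z. ennreal (exp (- c * (cmod (-a + z))\<^sup>2)) * indicator {R\<^sup>2..} ((cmod (-a+z))\<^sup>2) \<partial>lborel)"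
    using R by (intro nn_integral_cong) (auto simp: indicator_def dist_norm norm_minus_commute power2_le_iff_abs_le abs_le_square_iff[symmetric])
  also have "\<dots> = (\<integral>\<^sup>+z. ennreal (exp (- c * (cmod z)\<^sup>2)) * indicator {R\<^sup>2..} ((cmod z)\<^sup>2) \<partial>lborel)"
    by (subst nn_integral_lborel_translate[of "\<lambda>z. ennreal (exp (- c * (cmod z)\<^sup>2)) * indicator {R\<^sup>2..} ((cmod z)\<^sup>2)" "-a"]) simp_all
  also have "\<dots> = ennreal pi * (\<integral>\<^sup>+x\<in>{0..}. ennreal (exp (- c * x)) * indicator {R\<^sup>2..} x \<partial>lborel)"
    by (subst nn_integral_radial[of "\<lambda>x. ennreal (exp (- c * x)) * indicator {R\<^sup>2..} x"]) simp_all
  also have "(\<integral>\<^sup>+x\<in>{0..}. ennreal (exp (- c * x)) * indicator {R\<^sup>2..} x \<partial>lborel) = (\<integral>\<^sup>+x. ennreal (exp (- c * x)) * indicator {R\<^sup>2..} x \<partial>lborel)"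
    by (intro nn_integral_cong) (auto simp: indicator_def intro: order_trans[OF zero_le_power2])
  finally show ?thesis
    using c by (simp only: *) (simp add: ennreal_mult''[symmetric])
qed

lemma emeasure_affine_image:
  fixes S :: "complex set"
  assumes r: "r \<noteq> 0" and S: "S \<in> sets borel"
  shows "(\<lambda>z. w + of_real r * z) ` S \<in> sets borel"
    and "emeasure lborel ((\<lambda>z. w + of_real r * z) ` S) = ennreal (r\<^sup>2) * emeasure lborel S"
proof -
  define T where "T = (\<lambda>z::complex. w + r *\<^sub>R z)"
  have T: "(\<lambda>z. w + of_real r * z) ` S = T ` S" by (simp add: T_def scaleR_conv_of_real)
  have img: "T ` S = (\<lambda>z. (z - w) /\<^sub>R r) -` S"
  proof (intro equalityI subsetI)
    fix z assume "z \<in> (\<lambda>z. (z - w) /\<^sub>R r) -` S"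
    then have "(z - w) /\<^sub>R r \<in> S" by simp
    moreover have "z = T ((z - w) /\<^sub>R r)" using r by (simp add: T_def)
    ultimately show "z \<in> T ` S" by blast
  qed (use r in \<open>auto simp: T_def\<close>)
  have "(\<lambda>z. (z - w) /\<^sub>R r) \<in> borel_measurable borel" by measurable
  then have b: "T ` S \<in> sets borel" unfolding img using S by (metis measurable_sets_borel)
  then show "(\<lambda>z. w + of_real r * z) ` S \<in> sets borel" by (simp add: T)
  have "inj T" using r by (auto simp: T_def inj_def)
  have "emeasure lborel (T ` S) = emeasure (density (distr lborel borel T) (\<lambda>_. \<bar>r\<bar>^DIM(complex))) (T ` S)"
    using r unfolding T_def by (subst lborel_affine[of r w]) auto
  also have "\<dots> = ennreal (r\<^sup>2) * emeasure (distr lborel borel T) (T ` S)"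
    using r b by (subst emeasure_density) (auto simp: nn_integral_cmult_indicator)
  also have "emeasure (distr lborel borel T) (T ` S) = emeasure lborel S"
    using b inj_vimage_image_eq[OF \<open>inj T\<close>] by (subst emeasure_distr) (auto simp: T_def)
  finally show "emeasure lborel ((\<lambda>z. w + of_real r * z) ` S) = ennreal (r\<^sup>2) * emeasure lborel S"
    by (simp add: T)
qed

section \<open>The Fock energy of an entire function\<close>

lemma entire_compose:
  assumes "f holomorphic_on UNIV" "g holomorphic_on UNIV"
  shows "(\<lambda>z. f (g z)) holomorphic_on (UNIV :: complex set)"
  using holomorphic_on_compose_gen[OF assms(2,1)] by (simp add: o_def)

lemma entire_factor_finite_zeros:
  assumes "finite Q" "g holomorphic_on UNIV" "\<And>q. q \<in> Q \<Longrightarrow> g q = 0"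
  shows "\<exists>h. h holomorphic_on UNIV \<and> (\<forall>z. g z = h z * (\<Prod>q\<in>Q. z - q))"
  using assms
proof (induction Q rule: finite_induct)
  case empty
  then show ?case by auto
next
  case (insert a Q)
  then obtain h where h: "h holomorphic_on UNIV" "\<And>z. g z = h z * (\<Prod>q\<in>Q. z - q)" by auto
  have "g a = 0" using insert.prems by auto
  moreover have "(\<Prod>q\<in>Q. a - q) \<noteq> 0" using insert.hyps by auto
  ultimately have ha: "h a = 0" using h(2)[of a] by auto
  define k where "k = (\<lambda>z. if z = a then deriv h a else (h z - h a) / (z - a))"
  have "k holomorphic_on UNIV" unfolding k_def using h(1) by (intro pole_lemma) auto
  moreover have "g z = k z * (\<Prod>q\<in>insert a Q. z - q)" for z
    using insert.hyps ha h(2)[of z] by (auto simp: k_def)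
  ultimately show ?case by blast
qed

text \<open>The mean value property of \<open>F\<^sup>2\<close> on the circle through \<open>z\<close>.\<close>
lemma mean_square_ge_center:
  assumes "F holomorphic_on UNIV"
  shows "ennreal ((cmod (F 0))\<^sup>2) \<le> (\<integral>\<^sup>+t\<in>{0..1}. ennreal ((cmod (F (exp (2 * of_real pi * \<i> * of_real t) * z)))\<^sup>2) \<partial>lborel)"
proof -
  define G where "G = (\<lambda>w. (F (w * z))\<^sup>2)"
  define e where "e = (\<lambda>t::real. exp (2 * of_real pi * \<i> * of_real t) :: complex)"
  have hol: "G holomorphic_on UNIV"
    unfolding G_def by (intro holomorphic_intros entire_compose[OF assms])
  then have "((\<lambda>u. G u / (u - 0)) has_contour_integral (2 * of_real pi * \<i> * G 0)) (circlepath 0 1)"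
    by (intro Cauchy_integral_circlepath_simple) (auto intro: holomorphic_on_subset)
  then have "((\<lambda>x. G (e x) / e x * (2 * pi * \<i> * e x)) has_integral (2 * of_real pi * \<i> * G 0)) {0..1}"
    unfolding has_contour_integral_def
    by (rule has_integral_eq[rotated]) (simp add: vector_derivative_circlepath01, simp add: circlepath e_def)
  then have "((\<lambda>x. inverse (2 * of_real pi * \<i>) * (G (e x) / e x * (2 * pi * \<i> * e x))) has_integral inverse (2 * of_real pi * \<i>) * (2 * of_real pi * \<i> * G 0)) {0..1}"
    by (rule has_integral_mult_right)
  then have I: "((\<lambda>x. G (e x)) has_integral G 0) {0..1}"
    by (simp add: e_def field_simps)
  have contG: "continuous_on UNIV G" using hol by (rule holomorphic_on_imp_continuous_on)
  have cont: "continuous_on {0..1} (\<lambda>x. G (e x))"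
    unfolding e_def by (rule continuous_on_compose2[OF contG]) (auto intro!: continuous_intros)
  have si: "set_integrable lborel {0..1} (\<lambda>x. G (e x))"
    using cont by (rule borel_integrable_compact[OF compact_Icc, unfolded set_integrable_def[symmetric]])
  then have "(LBINT x:{0..1}. G (e x)) = G 0"
    using set_borel_integral_eq_integral(2)[OF si] I by (simp add: integral_unique)
  then have "ennreal (cmod (G 0)) = ennreal (cmod (\<integral>x. indicator {0..1} x *\<^sub>R G (e x) \<partial>lborel))"
    by (simp add: set_lebesgue_integral_def)
  also have "\<dots> \<le> (\<integral>\<^sup>+x. ennreal (cmod (indicator {0..1} x *\<^sub>R G (e x))) \<partial>lborel)"
    using si unfolding set_integrable_def by (rule integral_norm_bound_ennreal)
  also have "\<dots> = (\<integral>\<^sup>+x\<in>{0..1}. ennreal (cmod (G (e x))) \<partial>lborel)"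
    by (intro nn_integral_cong) (auto simp: indicator_def)
  finally show ?thesis by (simp add: G_def e_def norm_power)
qed

text \<open>Jensen's inequality without logarithms. Dividing \<open>g\<close> by the Blaschke factors of its zeros inside the
  circle through \<open>z\<close> does not change the modulus on that circle and multiplies the value at the centre by
  \<open>\<Prod> |z| / |q|\<close>; the mean value property of the quotient gives the claim.\<close>
lemma mean_square_ge_Blaschke:
  assumes g: "g holomorphic_on UNIV" and Q: "finite Q" "0 \<notin> Q" and zero: "\<And>q. q \<in> Q \<Longrightarrow> g q = 0"
  shows "ennreal ((cmod (g 0))\<^sup>2 * (\<Prod>q\<in>Q. max 1 ((cmod z)\<^sup>2 / (cmod q)\<^sup>2)))
    \<le> (\<integral>\<^sup>+t\<in>{0..1}. ennreal ((cmod (g (exp (2 * of_real pi * \<i> * of_real t) * z)))\<^sup>2) \<partial>lborel)"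
proof (cases "z = 0")
  case True
  then show ?thesis using mean_square_ge_center[OF g, of 0] by (simp add: max_def)
next
  case False
  define r where "r = cmod z"
  have r: "r > 0" using False by (simp add: r_def)
  define Q' where "Q' = {q\<in>Q. cmod q < r}"
  have Q': "finite Q'" "Q' \<subseteq> Q" using Q by (auto simp: Q'_def)
  obtain h where h: "h holomorphic_on UNIV" "\<And>z. g z = h z * (\<Prod>q\<in>Q'. z - q)"
    using entire_factor_finite_zeros[OF Q'(1) g] zero Q'(2) by (metis subsetD)
  \<comment> \<open>\<open>F\<close> is the quotient by the Blaschke factors; it is written with \<open>h\<close> so that it is entire.\<close>
  define F where "F = (\<lambda>w. h w * (\<Prod>q\<in>Q'. (of_real (r\<^sup>2) - cnj q * w) / of_real r))"
  have F: "F holomorphic_on UNIV" unfolding F_def using h(1) r by (intro holomorphic_intros) auto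
  have eq: "cmod (F w) = cmod (g w)" if w: "cmod w = r" for w
  proof -
    have "cmod ((of_real (r\<^sup>2) - cnj q * w) / of_real r) = cmod (w - q)" for q
    proof -
      have "of_real (r\<^sup>2) - cnj q * w = w * cnj (w - q)"
        using w complex_norm_square[of w] by (simp add: algebra_simps)
      then show ?thesis using r w by (simp add: norm_mult norm_divide flip: complex_cnj_diff)
    qed
    then show ?thesis unfolding F_def h(2) by (simp add: norm_mult prod_norm[symmetric])
  qed
  have "(cmod (F 0))\<^sup>2 = (cmod (g 0))\<^sup>2 * (\<Prod>q\<in>Q. max 1 ((cmod z)\<^sup>2 / (cmod q)\<^sup>2))"
  proof -
    have "(\<Prod>q\<in>Q. max 1 ((cmod z)\<^sup>2 / (cmod q)\<^sup>2)) = (\<Prod>q\<in>Q'. (cmod z)\<^sup>2 / (cmod q)\<^sup>2)"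
    proof (rule prod.mono_neutral_cong_right[OF Q(1) Q'(2)])
      show "\<forall>q\<in>Q - Q'. max 1 ((cmod z)\<^sup>2 / (cmod q)\<^sup>2) = 1"
      proof
        fix q assume "q \<in> Q - Q'"
        then have "cmod z \<le> cmod q" by (auto simp: Q'_def r_def)
        then show "max 1 ((cmod z)\<^sup>2 / (cmod q)\<^sup>2) = 1"
          by (intro max_absorb1) (simp add: divide_le_eq_1 power_mono)
      qed
      fix q assume q: "q \<in> Q'"
      then have "q \<noteq> 0" "cmod q \<le> cmod z" using Q by (auto simp: Q'_def r_def)
      then have "(cmod q)\<^sup>2 > 0" "(cmod q)\<^sup>2 \<le> (cmod z)\<^sup>2" by auto
      then show "max 1 ((cmod z)\<^sup>2 / (cmod q)\<^sup>2) = (cmod z)\<^sup>2 / (cmod q)\<^sup>2"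
        by (simp add: max_def le_divide_eq_1)
    qed
    also have "(cmod (g 0))\<^sup>2 * \<dots> = (cmod (h 0))\<^sup>2 * (\<Prod>q\<in>Q'. (cmod q)\<^sup>2 * ((cmod z)\<^sup>2 / (cmod q)\<^sup>2))"
      unfolding h(2) prod.distrib by (simp add: norm_mult prod_norm[symmetric] power_mult_distrib prod_power_distrib)
    also have "(\<Prod>q\<in>Q'. (cmod q)\<^sup>2 * ((cmod z)\<^sup>2 / (cmod q)\<^sup>2)) = (\<Prod>q\<in>Q'. r\<^sup>2)"
      using Q by (intro prod.cong) (auto simp: Q'_def r_def)
    also have "(cmod (h 0))\<^sup>2 * (\<Prod>q\<in>Q'. r\<^sup>2) = (cmod (F 0))\<^sup>2"
      unfolding F_def using r by (simp add: norm_mult prod_norm[symmetric] power_mult_distrib norm_divide norm_power power2_eq_square)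
    finally show ?thesis by simp
  qed
  moreover have "cmod (F (exp (2 * of_real pi * \<i> * of_real t) * z)) = cmod (g (exp (2 * of_real pi * \<i> * of_real t) * z))" for t
    by (rule eq) (simp add: norm_mult r_def)
  ultimately show ?thesis using mean_square_ge_center[OF F, of z] by simp
qed

text \<open>The squared Fock norm without the factor \<open>\<alpha> / \<pi>\<close>. It takes extended values, so that estimates need no
  integrability beforehand.\<close>
definition fock_energy :: "real \<Rightarrow> (complex \<Rightarrow> complex) \<Rightarrow> ennreal" where
  "fock_energy \<alpha> f = (\<integral>\<^sup>+z. ennreal ((cmod (f z))\<^sup>2 * exp (- \<alpha> * (cmod z)\<^sup>2)) \<partial>lborel)"

lemma borel_measurable_entire:
  "f holomorphic_on UNIV \<Longrightarrow> f \<in> borel_measurable borel"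
  by (intro borel_measurable_continuous_onI holomorphic_on_imp_continuous_on)

text \<open>The average of the previous inequality over all \<open>z\<close>. The mean over circles disappears because the weight
  and Lebesgue measure are invariant under rotations.\<close>
lemma fock_energy_ge_zeros:
  assumes g: "g holomorphic_on UNIV" and Q: "finite Q" "0 \<notin> Q" and zero: "\<And>q. q \<in> Q \<Longrightarrow> g q = 0"
  shows "(\<integral>\<^sup>+z. ennreal ((cmod (g 0))\<^sup>2 * (\<Prod>q\<in>Q. max 1 ((cmod z)\<^sup>2 / (cmod q)\<^sup>2)) * exp (- \<alpha> * (cmod z)\<^sup>2)) \<partial>lborel)
     \<le> fock_energy \<alpha> g"
proof -
  define e where "e = (\<lambda>t::real. exp (2 * of_real pi * \<i> * of_real t) :: complex)"
  have e1: "cmod (e t) = 1" for t by (simp add: e_def)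
  have [measurable]: "g \<in> borel_measurable borel" using g by (rule borel_measurable_entire)
  have [measurable]: "e \<in> borel_measurable borel" unfolding e_def by measurable
  define W where "W = (\<lambda>z. ennreal (exp (- \<alpha> * (cmod z)\<^sup>2)))"
  have [measurable]: "W \<in> borel_measurable borel" unfolding W_def by measurable
  have "(\<integral>\<^sup>+z. ennreal ((cmod (g 0))\<^sup>2 * (\<Prod>q\<in>Q. max 1 ((cmod z)\<^sup>2 / (cmod q)\<^sup>2)) * exp (- \<alpha> * (cmod z)\<^sup>2)) \<partial>lborel)
     = (\<integral>\<^sup>+z. ennreal ((cmod (g 0))\<^sup>2 * (\<Prod>q\<in>Q. max 1 ((cmod z)\<^sup>2 / (cmod q)\<^sup>2))) * W z \<partial>lborel)"
    by (intro nn_integral_cong) (simp add: W_def ennreal_mult'')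
  also have "\<dots> \<le> (\<integral>\<^sup>+z. (\<integral>\<^sup>+t\<in>{0..1}. ennreal ((cmod (g (e t * z)))\<^sup>2) \<partial>lborel) * W z \<partial>lborel)"
    unfolding e_def
    by (intro nn_integral_mono mult_right_mono mean_square_ge_Blaschke[OF g Q zero]) auto
  also have "\<dots> = (\<integral>\<^sup>+z. (\<integral>\<^sup>+t. ennreal ((cmod (g (e t * z)))\<^sup>2) * W z * indicator {0..1} t \<partial>lborel) \<partial>lborel)"
    by (subst nn_integral_multc[symmetric]) (auto simp: mult_ac)
  also have "\<dots> = (\<integral>\<^sup>+t. (\<integral>\<^sup>+z. ennreal ((cmod (g (e t * z)))\<^sup>2) * W z * indicator {0..1} t \<partial>lborel) \<partial>lborel)"
    by (rule lborel_pair.Fubini') measurable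
  also have "\<dots> = (\<integral>\<^sup>+t. (\<integral>\<^sup>+z. ennreal ((cmod (g (e t * z)))\<^sup>2) * W (e t * z) \<partial>lborel) * indicator {0..1} t \<partial>lborel)"
    by (simp add: nn_integral_multc W_def norm_mult e1)
  also have "\<dots> = (\<integral>\<^sup>+(t::real). (\<integral>\<^sup>+z. ennreal ((cmod (g z))\<^sup>2) * W z \<partial>lborel) * indicator {0..1} t \<partial>lborel)"
    by (subst nn_integral_rotate[of "\<lambda>z. ennreal ((cmod (g z))\<^sup>2) * W z"]) (simp_all add: e1)
  also have "\<dots> = (\<integral>\<^sup>+z. ennreal ((cmod (g z))\<^sup>2) * W z \<partial>lborel)"
    by (subst nn_integral_cmult) auto
  also have "\<dots> = fock_energy \<alpha> g"
    unfolding fock_energy_def by (intro nn_integral_cong) (simp add: W_def ennreal_mult'')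
  finally show ?thesis .
qed

lemma fock_space_iff:
  assumes \<alpha>: "\<alpha> > 0"
  shows "f \<in> fock_space \<alpha> \<longleftrightarrow> f holomorphic_on UNIV \<and> fock_energy \<alpha> f < \<infinity>"
proof (cases "f holomorphic_on UNIV")
  case True
  then have [measurable]: "f \<in> borel_measurable borel" by (rule borel_measurable_entire)
  have "(\<integral>\<^sup>+z. ennreal (norm ((cmod (f z))\<^sup>2)) \<partial>fock_measure \<alpha>) =
      (\<integral>\<^sup>+z. ennreal (\<alpha>/pi) * ennreal ((cmod (f z))\<^sup>2 * exp (- \<alpha> * (cmod z)\<^sup>2)) \<partial>lborel)"
    unfolding fock_measure_def using \<alpha>
    by (subst nn_integral_density) (auto intro!: nn_integral_cong simp flip: ennreal_mult'' simp: mult_ac)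
  also have "\<dots> = ennreal (\<alpha>/pi) * fock_energy \<alpha> f"
    unfolding fock_energy_def by (subst nn_integral_cmult) auto
  finally have *: "(\<integral>\<^sup>+z. ennreal (norm ((cmod (f z))\<^sup>2)) \<partial>fock_measure \<alpha>) = ennreal (\<alpha>/pi) * fock_energy \<alpha> f" .
  have "ennreal (\<alpha>/pi) * fock_energy \<alpha> f < \<infinity> \<longleftrightarrow> fock_energy \<alpha> f < \<infinity>"
    using \<alpha> by (auto simp: ennreal_mult_less_top)
  moreover have "(\<lambda>z. (cmod (f z))\<^sup>2) \<in> borel_measurable (fock_measure \<alpha>)"
    unfolding fock_measure_def by simp
  ultimately show ?thesis
    unfolding fock_space_def by (simp only: mem_Collect_eq True integrable_iff_bounded *) simp
qed (auto simp: fock_space_def)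

text \<open>The isometry of the Fock space that moves \<open>w\<close> to the origin.\<close>
definition fock_shift :: "real \<Rightarrow> complex \<Rightarrow> (complex \<Rightarrow> complex) \<Rightarrow> complex \<Rightarrow> complex" where
  "fock_shift \<alpha> w f z = f (w + z) * exp (- of_real \<alpha> * (z * cnj w) - of_real (\<alpha> * (cmod w)\<^sup>2 / 2))"

lemma holomorphic_fock_shift:
  assumes "f holomorphic_on UNIV" shows "fock_shift \<alpha> w f holomorphic_on UNIV"
proof -
  have "(\<lambda>z. f (w + z)) holomorphic_on UNIV"
    by (intro holomorphic_intros entire_compose[OF assms])
  then show ?thesis unfolding fock_shift_def[abs_def]
    by (intro holomorphic_intros)
qed

lemma cmod_fock_shift:
  "cmod (fock_shift \<alpha> w f z) * exp (- \<alpha> * (cmod z)\<^sup>2 / 2) = cmod (f (w + z)) * exp (- \<alpha> * (cmod (w + z))\<^sup>2 / 2)"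
proof -
  have "(cmod (w + z))\<^sup>2 = (cmod w)\<^sup>2 + (cmod z)\<^sup>2 + 2 * Re (z * cnj w)"
    unfolding cmod_power2 by (simp add: power2_eq_square algebra_simps)
  then have "- \<alpha> * (cmod (w + z))\<^sup>2 / 2 = - \<alpha> * Re (z * cnj w) - \<alpha> * (cmod w)\<^sup>2 / 2 + - \<alpha> * (cmod z)\<^sup>2 / 2"
    by (simp only:) (simp add: field_simps del: times_complex.sel)
  then have "exp (- \<alpha> * (cmod (w + z))\<^sup>2 / 2) = exp (- \<alpha> * Re (z * cnj w) - \<alpha> * (cmod w)\<^sup>2 / 2) * exp (- \<alpha> * (cmod z)\<^sup>2 / 2)"
    by (simp only: exp_add)
  then show ?thesis
    by (simp add: fock_shift_def norm_mult)
qed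

lemma fock_energy_shift:
  assumes "f holomorphic_on UNIV" shows "fock_energy \<alpha> (fock_shift \<alpha> w f) = fock_energy \<alpha> f"
proof -
  have [measurable]: "f \<in> borel_measurable borel" using assms by (rule borel_measurable_entire)
  have *: "(a::real)\<^sup>2 * exp (- \<alpha> * b) = (a * exp (- \<alpha> * b / 2))\<^sup>2" for a b
    by (simp add: power_mult_distrib flip: exp_of_nat_mult)
  have "fock_energy \<alpha> (fock_shift \<alpha> w f) =
     (\<integral>\<^sup>+z. ennreal ((cmod (f (w+z)))\<^sup>2 * exp (- \<alpha> * (cmod (w+z))\<^sup>2)) \<partial>lborel)"
    unfolding fock_energy_def * cmod_fock_shift ..
  also have "\<dots> = fock_energy \<alpha> f"
    unfolding fock_energy_def by (rule nn_integral_lborel_translate) measurable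
  finally show ?thesis .
qed

text \<open>At the origin this is the case without zeros of the inequality above; the isometries carry it to every point.\<close>
lemma fock_pointwise_bound:
  assumes \<alpha>: "\<alpha> > 0" and f: "f holomorphic_on UNIV"
  shows "ennreal (pi / \<alpha> * ((cmod (f w))\<^sup>2 * exp (- \<alpha> * (cmod w)\<^sup>2))) \<le> fock_energy \<alpha> f"
proof -
  define g where "g = fock_shift \<alpha> w f"
  have g0: "(cmod (g 0))\<^sup>2 = (cmod (f w))\<^sup>2 * exp (- \<alpha> * (cmod w)\<^sup>2)"
    using cmod_fock_shift[of \<alpha> w f 0] by (simp add: g_def power_mult_distrib flip: exp_of_nat_mult)
  have "ennreal (pi / \<alpha> * (cmod (g 0))\<^sup>2) = ennreal ((cmod (g 0))\<^sup>2) * ennreal (pi / \<alpha>)"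
    using \<alpha> by (simp flip: ennreal_mult'' add: mult_ac)
  also have "\<dots> = ennreal ((cmod (g 0))\<^sup>2) * (\<integral>\<^sup>+z. ennreal (exp (- \<alpha> * (cmod z)\<^sup>2)) \<partial>lborel)"
    using nn_integral_gauss[OF \<alpha>, of 0] by simp
  also have "\<dots> = (\<integral>\<^sup>+z. ennreal ((cmod (g 0))\<^sup>2 * exp (- \<alpha> * (cmod z)\<^sup>2)) \<partial>lborel)"
    by (subst nn_integral_cmult[symmetric]) (auto intro!: nn_integral_cong simp: ennreal_mult'')
  also have "\<dots> \<le> fock_energy \<alpha> g"
    using fock_energy_ge_zeros[of g "{}" \<alpha>] f by (simp add: g_def holomorphic_fock_shift)
  also have "\<dots> = fock_energy \<alpha> f" unfolding g_def using f by (rule fock_energy_shift)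
  finally show ?thesis unfolding g0 .
qed

section \<open>Limits, and a uniform bound for interpolation\<close>

text \<open>The pointwise bound makes the sequence locally bounded, so Montel's theorem gives a convergent subsequence,
  and Fatou's lemma keeps the energy bound.\<close>
lemma fock_limit:
  assumes \<alpha>: "\<alpha> > 0" and f: "\<And>n. f n holomorphic_on UNIV" and E: "\<And>n::nat. fock_energy \<alpha> (f n) \<le> ennreal M"
  obtains g r where "g holomorphic_on UNIV" "strict_mono (r :: nat \<Rightarrow> nat)"
    "\<And>z. (\<lambda>n. f (r n) z) \<longlonglongrightarrow> g z" "fock_energy \<alpha> g \<le> ennreal M"
proof -
  define M' where "M' = max M 0"
  have ptw: "cmod (f n z) \<le> sqrt (M' * \<alpha> / pi * exp (\<alpha> * R\<^sup>2))" if "cmod z \<le> R" for n z R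
  proof -
    have "ennreal (pi / \<alpha> * ((cmod (f n z))\<^sup>2 * exp (- \<alpha> * (cmod z)\<^sup>2))) \<le> ennreal M'"
    proof -
      have "fock_energy \<alpha> (f n) \<le> ennreal M'"
        by (rule order_trans[OF E[of n]]) (simp add: M'_def ennreal_leI)
      then show ?thesis using fock_pointwise_bound[OF \<alpha> f[of n], of z] by (rule order_trans[rotated])
    qed
    then have "pi / \<alpha> * ((cmod (f n z))\<^sup>2 * exp (- \<alpha> * (cmod z)\<^sup>2)) \<le> M'"
      by (subst (asm) ennreal_le_iff) (simp_all add: M'_def)
    then have "(cmod (f n z))\<^sup>2 \<le> M' * \<alpha> / pi * exp (\<alpha> * (cmod z)\<^sup>2)"
      using \<alpha> by (simp add: exp_minus field_simps)
    also have "\<dots> \<le> M' * \<alpha> / pi * exp (\<alpha> * R\<^sup>2)"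
      using \<alpha> that by (intro mult_left_mono) (auto simp: M'_def power_mono)
    finally show ?thesis by (rule real_le_rsqrt)
  qed
  obtain g r where g: "g holomorphic_on UNIV" "strict_mono (r :: nat \<Rightarrow> nat)"
    "\<And>z. z \<in> UNIV \<Longrightarrow> (\<lambda>n. f (r n) z) \<longlonglongrightarrow> g z"
  proof (rule Montel[of UNIV "range f" f])
    fix K :: "complex set" assume "compact K"
    then obtain R where R: "\<And>z. z \<in> K \<Longrightarrow> cmod z \<le> R"
      using compact_imp_bounded bounded_iff by metis
    have "\<forall>h\<in>range f. \<forall>z\<in>K. cmod (h z) \<le> sqrt (M' * \<alpha> / pi * exp (\<alpha> * R\<^sup>2))"
    proof (intro ballI)
      fix h z assume h: "h \<in> range f" and z: "z \<in> K"
      from h obtain n where "h = f n" by auto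
      then show "cmod (h z) \<le> sqrt (M' * \<alpha> / pi * exp (\<alpha> * R\<^sup>2))" using ptw[OF R[OF z]] by simp
    qed
    then show "\<exists>B. \<forall>h\<in>range f. \<forall>z\<in>K. cmod (h z) \<le> B" by (rule exI)
  qed (use f in auto)
  have [measurable]: "g \<in> borel_measurable borel" "f n \<in> borel_measurable borel" for n
    using g(1) f by (auto intro: borel_measurable_entire)
  have "fock_energy \<alpha> g = (\<integral>\<^sup>+z. liminf (\<lambda>n. ennreal ((cmod (f (r n) z))\<^sup>2 * exp (- \<alpha> * (cmod z)\<^sup>2))) \<partial>lborel)"
    unfolding fock_energy_def
  proof (rule nn_integral_cong)
    fix z
    have "(\<lambda>n. ennreal ((cmod (f (r n) z))\<^sup>2 * exp (- \<alpha> * (cmod z)\<^sup>2))) \<longlonglongrightarrow> ennreal ((cmod (g z))\<^sup>2 * exp (- \<alpha> * (cmod z)\<^sup>2))"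
      using g(3)[of z] by (intro tendsto_intros) auto
    from lim_imp_Liminf[OF _ this]
    show "ennreal ((cmod (g z))\<^sup>2 * exp (- \<alpha> * (cmod z)\<^sup>2)) = liminf (\<lambda>n. ennreal ((cmod (f (r n) z))\<^sup>2 * exp (- \<alpha> * (cmod z)\<^sup>2)))"
      by simp
  qed
  also have "\<dots> \<le> liminf (\<lambda>n. fock_energy \<alpha> (f (r n)))"
    unfolding fock_energy_def by (rule nn_integral_liminf) measurable
  also have "\<dots> \<le> ennreal M"
    using E by (intro Liminf_le) (auto intro!: always_eventually)
  finally show ?thesis using g by (intro that[of g r]) auto
qed

lemma fock_energy_diff_le:
  assumes "f holomorphic_on UNIV" "g holomorphic_on UNIV"
  shows "fock_energy \<alpha> (\<lambda>z. c * (f z - g z)) \<le> ennreal (2 * (cmod c)\<^sup>2) * (fock_energy \<alpha> f + fock_energy \<alpha> g)"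
proof -
  have [measurable]: "g \<in> borel_measurable borel" "f \<in> borel_measurable borel"
    using assms by (auto intro: borel_measurable_entire)
  have "fock_energy \<alpha> (\<lambda>z. c * (f z - g z)) \<le> (\<integral>\<^sup>+z. ennreal (2 * (cmod c)\<^sup>2) * (ennreal ((cmod (f z))\<^sup>2 * exp (- \<alpha> * (cmod z)\<^sup>2)) + ennreal ((cmod (g z))\<^sup>2 * exp (- \<alpha> * (cmod z)\<^sup>2))) \<partial>lborel)"
    unfolding fock_energy_def
  proof (rule nn_integral_mono)
    fix z
    have "(cmod (f z - g z))\<^sup>2 \<le> (cmod (f z) + cmod (g z))\<^sup>2"
      by (intro power_mono norm_triangle_ineq4) auto
    also have "\<dots> \<le> 2 * (cmod (f z))\<^sup>2 + 2 * (cmod (g z))\<^sup>2"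
      using sum_squares_bound[of "cmod (f z)" "cmod (g z)"] by (simp add: power2_sum)
    finally have "(cmod c)\<^sup>2 * (cmod (f z - g z))\<^sup>2 * exp (- \<alpha> * (cmod z)\<^sup>2) \<le> (cmod c)\<^sup>2 * (2 * (cmod (f z))\<^sup>2 + 2 * (cmod (g z))\<^sup>2) * exp (- \<alpha> * (cmod z)\<^sup>2)"
      by (intro mult_right_mono mult_left_mono) auto
    then show "ennreal ((cmod (c * (f z - g z)))\<^sup>2 * exp (- \<alpha> * (cmod z)\<^sup>2)) \<le> ennreal (2 * (cmod c)\<^sup>2) * (ennreal ((cmod (f z))\<^sup>2 * exp (- \<alpha> * (cmod z)\<^sup>2)) + ennreal ((cmod (g z))\<^sup>2 * exp (- \<alpha> * (cmod z)\<^sup>2)))"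
      unfolding norm_mult power_mult_distrib
      by (simp flip: ennreal_plus ennreal_mult'' add: algebra_simps ennreal_leI)
  qed
  also have "\<dots> = ennreal (2 * (cmod c)\<^sup>2) * (fock_energy \<alpha> f + fock_energy \<alpha> g)"
    unfolding fock_energy_def by (subst nn_integral_cmult, measurable, subst nn_integral_add) simp_all
  finally show ?thesis .
qed

lemma interpolation_delta:
  assumes \<alpha>: "\<alpha> > 0" and I: "interpolation_set \<alpha> \<Gamma>" and w: "w \<in> \<Gamma>"
  obtains f where "f holomorphic_on UNIV" "fock_energy \<alpha> f < \<infinity>"
    "\<And>z. z \<in> \<Gamma> \<Longrightarrow> of_real (exp (- \<alpha> * (cmod z)\<^sup>2 / 2)) * f z = (if z = w then 1 else 0)"
proof -
  define a :: "complex \<Rightarrow> complex" where "a z = (if z = w then 1 else 0)" for z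
  have "(\<lambda>z. (cmod (a z))\<^sup>2) summable_on \<Gamma> \<longleftrightarrow> (\<lambda>z. (cmod (a z))\<^sup>2) summable_on {w}"
    by (rule summable_on_cong_neutral) (use w in \<open>auto simp: a_def\<close>)
  moreover have "(\<lambda>z. (cmod (a z))\<^sup>2) summable_on {w}" by (rule summable_on_finite) simp
  ultimately have "(\<lambda>z. (cmod (a z))\<^sup>2) summable_on \<Gamma>" by blast
  then obtain f where f: "f \<in> fock_space \<alpha>" "\<forall>z\<in>\<Gamma>. of_real (exp (- \<alpha> * (cmod z)\<^sup>2 / 2)) * f z = a z"
    using I unfolding interpolation_set_def by blast
  have "f holomorphic_on UNIV" "fock_energy \<alpha> f < \<infinity>" using f(1) unfolding fock_space_iff[OF \<alpha>] by blast+
  then show thesis by (rule that) (use f(2) in \<open>auto simp: a_def\<close>)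
qed

text \<open>A category argument. If the least energies of functions that interpolate \<open>1\<close> at one point and \<open>0\<close> at the
  others are unbounded, they exceed \<open>16 ^ k\<close> along distinct points \<open>w k\<close>. Use a bounded function \<open>\<phi>\<close> to assign
  the data \<open>\<phi> (c k) / 2 ^ k\<close> at \<open>w k\<close> to each \<open>c\<close> in the complete metric space \<open>nat \<Rightarrow> complex\<close>; they are
  square-summable. The sequences whose data have an interpolating function of energy at most \<open>n\<close> form a closed set, by
  the compactness above, so for some \<open>n\<close> this set has an inner point. Changing one late coordinate \<open>k\<close> of the inner point stays
  in the set, and the difference of two such functions, suitably scaled, interpolates \<open>1\<close> at \<open>w k\<close> and \<open>0\<close> elsewhere with energy
  of order \<open>4 ^ k * n\<close>, which is less than \<open>16 ^ k\<close>.\<close>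
lemma interpolation_uniform_bound:
  assumes \<alpha>: "\<alpha> > 0" and I: "interpolation_set \<alpha> \<Gamma>"
  shows "\<exists>M. \<forall>w\<in>\<Gamma>. \<exists>f. f holomorphic_on UNIV \<and> fock_energy \<alpha> f \<le> ennreal M \<and>
    (\<forall>z\<in>\<Gamma>. of_real (exp (- \<alpha> * (cmod z)\<^sup>2 / 2)) * f z = (if z = w then 1 else 0))"
proof (rule ccontr)
  define D where "D = (\<lambda>w f. f holomorphic_on UNIV \<and>
    (\<forall>z\<in>\<Gamma>. of_real (exp (- \<alpha> * (cmod z)\<^sup>2 / 2)) * f z = (if z = w then 1 else 0 :: complex)))"
  define m where "m = (\<lambda>w. INF f\<in>Collect (D w). fock_energy \<alpha> f)"
  assume no: "\<not> ?thesis"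
  have unb: "\<exists>w\<in>\<Gamma>. \<forall>f. D w f \<longrightarrow> ennreal M < fock_energy \<alpha> f" for M
  proof (rule ccontr)
    assume "\<not> ?thesis"
    then have "\<forall>w\<in>\<Gamma>. \<exists>f. D w f \<and> fock_energy \<alpha> f \<le> ennreal M" by (simp add: not_less)
    then have "\<forall>w\<in>\<Gamma>. \<exists>f. f holomorphic_on UNIV \<and> fock_energy \<alpha> f \<le> ennreal M \<and>
      (\<forall>z\<in>\<Gamma>. of_real (exp (- \<alpha> * (cmod z)\<^sup>2 / 2)) * f z = (if z = w then 1 else 0))"
      unfolding D_def by blast
    with no show False by blast
  qed
  have fin: "m w < \<infinity>" if w: "w \<in> \<Gamma>" for w
  proof -
    obtain f where f: "f holomorphic_on UNIV" "fock_energy \<alpha> f < \<infinity>"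
      "\<And>z. z \<in> \<Gamma> \<Longrightarrow> of_real (exp (- \<alpha> * (cmod z)\<^sup>2 / 2)) * f z = (if z = w then 1 else 0)"
      by (rule interpolation_delta[OF \<alpha> I w]) blast
    have "D w f" unfolding D_def by (intro conjI ballI f(1) f(3))
    then have "m w \<le> fock_energy \<alpha> f" unfolding m_def by (intro INF_lower) simp
    then show ?thesis using f(2) by (rule le_less_trans)
  qed
  obtain w where w: "\<And>n. w n \<in> \<Gamma>" "\<And>n f. D (w n) f \<Longrightarrow> ennreal (16 ^ n) < fock_energy \<alpha> f"
    "\<And>n::nat. m (w n) < m (w (Suc n))"
  proof -
    have "\<exists>w. \<forall>n. (w n \<in> \<Gamma> \<and> (\<forall>f. D (w n) f \<longrightarrow> ennreal (16 ^ n) < fock_energy \<alpha> f)) \<and> m (w n) < m (w (Suc n))"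
    proof (rule dependent_nat_choice)
      show "\<exists>x. x \<in> \<Gamma> \<and> (\<forall>f. D x f \<longrightarrow> ennreal (16 ^ 0) < fock_energy \<alpha> f)"
        using unb[of "16 ^ 0"] by auto
      fix x n assume x: "x \<in> \<Gamma> \<and> (\<forall>f. D x f \<longrightarrow> ennreal (16 ^ n) < fock_energy \<alpha> f)"
      obtain b where b: "m x = ennreal b" "b \<ge> 0" using fin[of x] x by (cases "m x") auto
      obtain y where y: "y \<in> \<Gamma>" "\<And>f. D y f \<Longrightarrow> ennreal (max (16 ^ Suc n) (b + 1)) < fock_energy \<alpha> f"
        using unb by blast
      have "ennreal (max (16 ^ Suc n) (b + 1)) \<le> m y"
        unfolding m_def by (rule INF_greatest) (use y in \<open>auto intro: less_imp_le\<close>)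
      moreover have "m x < ennreal (max (16 ^ Suc n) (b + 1))"
        using b by (auto simp: ennreal_less_iff)
      ultimately have "m x < m y" by (rule less_le_trans[rotated])
      moreover have "ennreal (16 ^ Suc n) < fock_energy \<alpha> f" if "D y f" for f
        by (rule le_less_trans[OF _ y(2)[OF that]]) (intro ennreal_leI max.cobounded1)
      ultimately show "\<exists>y. (y \<in> \<Gamma> \<and> (\<forall>f. D y f \<longrightarrow> ennreal (16 ^ Suc n) < fock_energy \<alpha> f)) \<and> m x < m y"
        using y(1) by blast
    qed
    then show thesis using that by blast
  qed
  have "strict_mono (\<lambda>n. m (w n))" using w(3) by (rule strict_mono_Suc_iff[THEN iffD2, rule_format])
  then have inj: "inj w" using strict_mono_eq by (fastforce simp: inj_def)
  \<comment> \<open>What matters is that \<open>\<phi>\<close> is continuous and bounded, and that \<open>\<phi> 1 - \<phi> 0 = 1 / 2\<close>.\<close>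
  define \<phi> :: "complex \<Rightarrow> complex" where "\<phi> u = u / of_real (1 + cmod u)" for u
  have \<phi>1: "cmod (\<phi> u) \<le> 1" for u
  proof -
    have "cmod (\<phi> u) = cmod u / \<bar>1 + cmod u\<bar>" unfolding \<phi>_def norm_divide norm_of_real ..
    moreover have "1 + cmod u > 0" by (simp add: add_pos_nonneg)
    ultimately show ?thesis by simp
  qed
  have \<phi>cont: "(\<lambda>j. \<phi> (u j)) \<longlonglongrightarrow> \<phi> l" if "u \<longlonglongrightarrow> l" for u l
  proof -
    have "complex_of_real (1 + cmod l) \<noteq> 0"
      by (metis add_pos_nonneg less_irrefl norm_ge_zero of_real_eq_0_iff zero_less_one)
    then show ?thesis unfolding \<phi>_def using that by (intro tendsto_intros)
  qed
  define S where "S = (\<lambda>(c :: nat \<Rightarrow> complex) f. f holomorphic_on UNIV \<and> 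
     (\<forall>k. of_real (exp (- \<alpha> * (cmod (w k))\<^sup>2 / 2)) * f (w k) = \<phi> (c k) / 2 ^ k) \<and> (\<forall>z\<in>\<Gamma> - range w. f z = 0))"
  define E where "E = (\<lambda>n::nat. {c. \<exists>f. S c f \<and> fock_energy \<alpha> f \<le> ennreal (real n)})"
  have cover: "(\<Union>n. E n) = UNIV"
  proof -
    have "c \<in> (\<Union>n. E n)" for c
    proof -
      define a where "a = (\<lambda>z. if z \<in> range w then \<phi> (c (inv w z)) / 2 ^ (inv w z) else 0)"
      have aw: "a (w k) = \<phi> (c k) / 2 ^ k" for k using inj by (simp add: a_def)
      have "summable (\<lambda>k. (cmod (a (w k)))\<^sup>2)"
      proof (rule summable_comparison_test'[where g="\<lambda>k. (1/4)^k" and N=0])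
        show "summable (\<lambda>k. (1 / 4 :: real) ^ k)" by (intro summable_geometric) auto
        fix k :: nat
        have "(4::real) ^ k = 2 ^ k * 2 ^ k" by (simp flip: power_mult_distrib)
        then have "(cmod (a (w k)))\<^sup>2 = (cmod (\<phi> (c k)))\<^sup>2 * (1 / 4) ^ k"
          by (simp add: aw norm_divide norm_power power_one_over power2_eq_square)
        also have "\<dots> \<le> 1 * (1 / 4) ^ k"
          using \<phi>1[of "c k"] by (intro mult_right_mono) (auto simp: power_le_one)
        finally show "norm ((cmod (a (w k)))\<^sup>2) \<le> (1 / 4) ^ k" by simp
      qed
      then have "(\<lambda>k. (cmod (a (w k)))\<^sup>2) summable_on UNIV"
        by (intro norm_summable_imp_summable_on) simp
      then have "(\<lambda>z. (cmod (a z))\<^sup>2) summable_on range w"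
        using summable_on_reindex[OF inj, of "\<lambda>z. (cmod (a z))\<^sup>2"] by (simp add: o_def)
      then have "(\<lambda>z. (cmod (a z))\<^sup>2) summable_on \<Gamma>"
        by (rule summable_on_cong_neutral[THEN iffD1, rotated -1]) (use w(1) in \<open>auto simp: a_def\<close>)
      then obtain f where f: "f \<in> fock_space \<alpha>" "\<And>z. z \<in> \<Gamma> \<Longrightarrow> of_real (exp (- \<alpha> * (cmod z)\<^sup>2 / 2)) * f z = a z"
        using I[unfolded interpolation_set_def] by blast
      then have f': "f holomorphic_on UNIV" "fock_energy \<alpha> f < \<infinity>"
        using fock_space_iff[OF \<alpha>] by auto
      have "S c f" unfolding S_def
      proof (intro conjI allI ballI)
        show "of_real (exp (- \<alpha> * (cmod (w k))\<^sup>2 / 2)) * f (w k) = \<phi> (c k) / 2 ^ k" for k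
          using f(2)[OF w(1)] aw by simp
        fix z assume "z \<in> \<Gamma> - range w"
        then show "f z = 0" using f(2)[of z] by (simp add: a_def)
      qed (rule f')
      obtain b where b: "fock_energy \<alpha> f = ennreal b" using f'(2) by (cases "fock_energy \<alpha> f") auto
      obtain n where "b \<le> real n" using real_arch_simple by blast
      then have "fock_energy \<alpha> f \<le> ennreal (real n)" unfolding b by (rule ennreal_leI)
      with \<open>S c f\<close> show ?thesis by (auto simp: E_def)
    qed
    then show ?thesis by blast
  qed
  have closed: "closed (E n)" for n
    unfolding closed_sequential_limits
  proof safe
    fix c l assume c: "\<forall>j. c j \<in> E n" and l: "c \<longlonglongrightarrow> l"
    then obtain f where f: "\<And>j. S (c j) (f j)" "\<And>j. fock_energy \<alpha> (f j) \<le> ennreal (real n)"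
      unfolding E_def by simp metis
    have fh: "f j holomorphic_on UNIV" for j using f(1)[of j] unfolding S_def by blast
    obtain g r where g: "g holomorphic_on UNIV" "strict_mono (r :: nat \<Rightarrow> nat)"
      "\<And>z. (\<lambda>n. f (r n) z) \<longlonglongrightarrow> g z" "fock_energy \<alpha> g \<le> ennreal (real n)"
      by (rule fock_limit[of \<alpha> f "real n", OF \<alpha> fh f(2)]) (rule that)
    have cl: "(\<lambda>j. c j k) \<longlonglongrightarrow> l k" for k
      using l unfolding limitin_canonical_iff[symmetric] euclidean_product_topology[symmetric] limitin_componentwise by simp
    have "S l g" unfolding S_def
    proof (intro conjI allI ballI g(1))
      fix k
      have "(\<lambda>n. of_real (exp (- \<alpha> * (cmod (w k))\<^sup>2 / 2)) * f (r n) (w k)) \<longlonglongrightarrow> of_real (exp (- \<alpha> * (cmod (w k))\<^sup>2 / 2)) * g (w k)"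
        by (intro tendsto_intros g)
      moreover have "(\<lambda>n. of_real (exp (- \<alpha> * (cmod (w k))\<^sup>2 / 2)) * f (r n) (w k)) = (\<lambda>n. \<phi> (c (r n) k) / 2 ^ k)"
        using f(1) unfolding S_def by auto
      moreover have "(\<lambda>n. \<phi> (c (r n) k) / 2 ^ k) \<longlonglongrightarrow> \<phi> (l k) / 2 ^ k"
        using LIMSEQ_subseq_LIMSEQ[OF cl g(2)] by (intro tendsto_intros \<phi>cont) (auto simp: o_def)
      ultimately show "of_real (exp (- \<alpha> * (cmod (w k))\<^sup>2 / 2)) * g (w k) = \<phi> (l k) / 2 ^ k"
        by (simp only:) (rule LIMSEQ_unique)
    next
      fix z assume "z \<in> \<Gamma> - range w"
      then have "f (r n) z = 0" for n using f(1) unfolding S_def by auto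
      then show "g z = 0" using g(3)[of z] by (simp add: LIMSEQ_const_iff)
    qed
    then show "l \<in> E n" using g(4) by (auto simp: E_def)
  qed
  have "\<exists>n. interior (E n) \<noteq> {}"
  proof (rule ccontr)
    assume "\<not> ?thesis"
    then have "Met_TC.mtopology interior_of \<Union>(range E) = {}"
    proof (intro Met_TC.metric_Baire_category_alt)
      fix T assume "T \<in> range E"
      then obtain n where "T = E n" by blast
      then show "closedin Met_TC.mtopology T \<and> Met_TC.mtopology interior_of T = {}"
        using closed[of n] \<open>\<not> (\<exists>n. interior (E n) \<noteq> {})\<close> by simp
    qed (simp_all add: complete_UNIV)
    then show False unfolding cover by simp
  qed
  then obtain n c0 where c0: "c0 \<in> interior (E n)" by blast
  have ev: "\<forall>\<^sub>F j in sequentially. c0(j := u) \<in> E n" for u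
  proof -
    have "(\<lambda>j. (c0(j := u)) k) \<longlonglongrightarrow> c0 k" for k
    proof (rule tendsto_eventually)
      show "\<forall>\<^sub>F j in sequentially. (c0(j := u)) k = c0 k"
        using eventually_gt_at_top[of k] by eventually_elim simp
    qed
    then have "(\<lambda>j. c0(j := u)) \<longlonglongrightarrow> c0"
      unfolding limitin_canonical_iff[symmetric] euclidean_product_topology[symmetric] limitin_componentwise by simp
    then have "\<forall>\<^sub>F j in sequentially. c0(j := u) \<in> interior (E n)"
      using c0 by (intro topological_tendstoD) auto
    then show ?thesis by eventually_elim (use interior_subset in blast)
  qed
  have "\<forall>\<^sub>F j in sequentially. 16 * real n < 4 ^ j"
    by (rule filterlim_at_top_dense[THEN iffD1, rule_format]) real_asymp
  then have "\<forall>\<^sub>F j in sequentially. 16 * real n < 4 ^ j \<and> c0(j := 1) \<in> E n \<and> c0(j := 0) \<in> E n"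
    using ev[of 1] ev[of 0] by eventually_elim blast
  then obtain k where k: "16 * real n < 4 ^ k" "c0(k := 1) \<in> E n" "c0(k := 0) \<in> E n"
    using eventually_happens'[OF sequentially_bot] by blast
  obtain f where f: "S (c0(k := 1)) f" "fock_energy \<alpha> f \<le> ennreal (real n)" using k(2) by (auto simp: E_def)
  obtain f0 where f0: "S (c0(k := 0)) f0" "fock_energy \<alpha> f0 \<le> ennreal (real n)" using k(3) by (auto simp: E_def)
  define C :: complex where "C = of_real (2 ^ Suc k)"
  define F where "F = (\<lambda>z. C * (f z - f0 z))"
  have hol: "f holomorphic_on UNIV" "f0 holomorphic_on UNIV" using f f0 by (auto simp: S_def)
  have "D (w k) F"
    unfolding D_def
  proof (intro conjI ballI)
    show "F holomorphic_on UNIV" unfolding F_def using hol by (intro holomorphic_intros)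
    fix z assume z: "z \<in> \<Gamma>"
    show "of_real (exp (- \<alpha> * (cmod z)\<^sup>2 / 2)) * F z = (if z = w k then 1 else 0)"
    proof (cases "z \<in> range w")
      case True
      then obtain j where j: "z = w j" by auto
      have "of_real (exp (- \<alpha> * (cmod z)\<^sup>2 / 2)) * F z = C * (of_real (exp (- \<alpha> * (cmod z)\<^sup>2 / 2)) * f z - of_real (exp (- \<alpha> * (cmod z)\<^sup>2 / 2)) * f0 z)"
        by (simp add: F_def algebra_simps)
      also have "\<dots> = C * (\<phi> ((c0(k := 1)) j) / 2 ^ j - \<phi> ((c0(k := 0)) j) / 2 ^ j)"
        using f(1) f0(1) unfolding S_def j by simp
      also have "\<dots> = (if j = k then 1 else 0)"
        by (simp add: C_def \<phi>_def)
      also have "\<dots> = (if z = w k then 1 else 0)" using inj by (auto simp: j inj_def)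
      finally show ?thesis .
    next
      case False
      then have "f z = 0" "f0 z = 0" using z f f0 by (auto simp: S_def)
      then show ?thesis using False by (auto simp: F_def)
    qed
  qed
  then have "ennreal (16 ^ k) < fock_energy \<alpha> F" by (rule w(2))
  also have "\<dots> \<le> ennreal (2 * (cmod C)\<^sup>2) * (fock_energy \<alpha> f + fock_energy \<alpha> f0)"
    unfolding F_def using hol by (rule fock_energy_diff_le)
  also have "\<dots> \<le> ennreal (2 * (cmod C)\<^sup>2) * (ennreal (real n) + ennreal (real n))"
    using f(2) f0(2) by (intro mult_left_mono add_mono) auto
  also have "\<dots> = ennreal (2 * (cmod C)\<^sup>2 * (2 * real n))"
    by (simp flip: ennreal_plus ennreal_mult'')
  also have "2 * (cmod C)\<^sup>2 * (2 * real n) = 4 ^ k * (16 * real n)"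
  proof -
    have "(4::real) ^ k = 2 ^ k * 2 ^ k" by (simp flip: power_mult_distrib)
    moreover have "cmod C = 2 * 2 ^ k"
      by (simp add: C_def norm_mult norm_power)
    ultimately show ?thesis by (simp add: power2_eq_square)
  qed
  finally have "16 ^ k < 4 ^ k * (16 * real n)"
    by (subst (asm) ennreal_less_iff) auto
  also have "\<dots> \<le> 4 ^ k * 4 ^ k" using k(1) by (intro mult_left_mono) auto
  finally show False by (simp flip: power_mult_distrib)
qed

section \<open>Separation, and positive definiteness of the Gaussian\<close>

text \<open>The function that interpolates \<open>1\<close> at \<open>w\<close> and \<open>0\<close> at the other points of \<open>P\<close>, fed into the inequality of Jensen type with \<open>w\<close> as the
  origin.\<close>
lemma interpolation_local_energy:
  assumes \<alpha>: "\<alpha> > 0" and I: "interpolation_set \<alpha> \<Gamma>"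
  obtains M where "M > 0" "\<And>P w. finite P \<Longrightarrow> P \<subseteq> \<Gamma> \<Longrightarrow> w \<in> P \<Longrightarrow>
     (\<integral>\<^sup>+z. ennreal ((\<Prod>\<gamma>\<in>P - {w}. max 1 ((cmod z)\<^sup>2 / (cmod (\<gamma> - w))\<^sup>2)) * exp (- \<alpha> * (cmod z)\<^sup>2)) \<partial>lborel) \<le> ennreal M"
proof -
  obtain M where M: "\<And>w. w \<in> \<Gamma> \<Longrightarrow> \<exists>f. f holomorphic_on UNIV \<and> fock_energy \<alpha> f \<le> ennreal M \<and>
    (\<forall>z\<in>\<Gamma>. of_real (exp (- \<alpha> * (cmod z)\<^sup>2 / 2)) * f z = (if z = w then 1 else 0))"
    using interpolation_uniform_bound[OF \<alpha> I] by blast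
  show thesis
  proof (rule that[of "max M 1"])
    fix P w assume P: "finite P" "P \<subseteq> \<Gamma>" and w: "w \<in> P"
    obtain f where f: "f holomorphic_on UNIV" "fock_energy \<alpha> f \<le> ennreal M"
      "\<And>z. z \<in> \<Gamma> \<Longrightarrow> of_real (exp (- \<alpha> * (cmod z)\<^sup>2 / 2)) * f z = (if z = w then 1 else 0)"
      using M[of w] P w by blast
    define g where "g = fock_shift \<alpha> w f"
    define Q where "Q = (\<lambda>\<gamma>. \<gamma> - w) ` (P - {w})"
    have g: "g holomorphic_on UNIV" unfolding g_def by (rule holomorphic_fock_shift) (rule f)
    have Q: "finite Q" "0 \<notin> Q" using P by (auto simp: Q_def)
    have zero: "g q = 0" if q: "q \<in> Q" for q
    proof -
      obtain \<gamma> where "\<gamma> \<in> P" "\<gamma> \<noteq> w" "q = \<gamma> - w" using q by (auto simp: Q_def)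
      then show ?thesis using f(3)[of \<gamma>] P by (auto simp: g_def fock_shift_def)
    qed
    have "cmod (of_real (exp (- \<alpha> * (cmod w)\<^sup>2 / 2)) * f w) = 1" using f(3)[of w] P w by auto
    then have g0: "cmod (g 0) = 1"
      using cmod_fock_shift[of \<alpha> w f 0] by (simp add: g_def norm_mult mult.commute)
    have "(\<Prod>\<gamma>\<in>P - {w}. max 1 ((cmod z)\<^sup>2 / (cmod (\<gamma> - w))\<^sup>2)) = (\<Prod>q\<in>Q. max 1 ((cmod z)\<^sup>2 / (cmod q)\<^sup>2))" for z
      unfolding Q_def by (subst prod.reindex) (auto simp: inj_on_def)
    then have "(\<integral>\<^sup>+z. ennreal ((\<Prod>\<gamma>\<in>P - {w}. max 1 ((cmod z)\<^sup>2 / (cmod (\<gamma> - w))\<^sup>2)) * exp (- \<alpha> * (cmod z)\<^sup>2)) \<partial>lborel) \<le> fock_energy \<alpha> g"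
      using fock_energy_ge_zeros[OF g Q zero, of \<alpha>] g0 by simp
    also have "\<dots> = fock_energy \<alpha> f" unfolding g_def using f(1) by (rule fock_energy_shift)
    also have "\<dots> \<le> ennreal (max M 1)" using f(2) by (rule order_trans) (simp add: ennreal_leI)
    finally show "(\<integral>\<^sup>+z. ennreal ((\<Prod>\<gamma>\<in>P - {w}. max 1 ((cmod z)\<^sup>2 / (cmod (\<gamma> - w))\<^sup>2)) * exp (- \<alpha> * (cmod z)\<^sup>2)) \<partial>lborel) \<le> ennreal (max M 1)" .
  qed simp
qed

text \<open>For two points at distance \<open>d\<close> the local energy has a factor \<open>|z|\<^sup>2 / d\<^sup>2\<close>, which is too large for small
  \<open>d\<close>.\<close>
lemma interpolation_imp_uniform_discrete:
  assumes \<alpha>: "\<alpha> > 0" and I: "interpolation_set \<alpha> \<Gamma>"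
  shows "uniform_discrete \<Gamma>"
proof -
  obtain M where M: "M > 0" "\<And>P w. finite P \<Longrightarrow> P \<subseteq> \<Gamma> \<Longrightarrow> w \<in> P \<Longrightarrow>
     (\<integral>\<^sup>+z. ennreal ((\<Prod>\<gamma>\<in>P - {w}. max 1 ((cmod z)\<^sup>2 / (cmod (\<gamma> - w))\<^sup>2)) * exp (- \<alpha> * (cmod z)\<^sup>2)) \<partial>lborel) \<le> ennreal M"
    using interpolation_local_energy[OF \<alpha> I] by blast
  define c where "c = pi / \<alpha> * exp (- \<alpha>)"
  have c: "c > 0" using \<alpha> by (simp add: c_def)
  have sep: "c / M \<le> (dist x y)\<^sup>2" if x: "x \<in> \<Gamma>" "y \<in> \<Gamma>" "x \<noteq> y" for x y
  proof -
    define d where "d = (cmod (y - x))\<^sup>2"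
    have d: "d > 0" using x by (simp add: d_def)
    have "ennreal (c / d) = ennreal (1 / d) * (\<integral>\<^sup>+z\<in>- ball 0 1. ennreal (exp (- \<alpha> * (cmod (z - 0))\<^sup>2)) \<partial>lborel)"
      unfolding nn_integral_gauss_tail[OF \<alpha> zero_le_one] using d c by (simp add: c_def mult.commute flip: ennreal_mult'')
    also have "\<dots> = (\<integral>\<^sup>+z. ennreal (1 / d) * (ennreal (exp (- \<alpha> * (cmod z)\<^sup>2)) * indicator (- ball 0 1) z) \<partial>lborel)"
      by (subst nn_integral_cmult) simp_all
    also have "\<dots> \<le> (\<integral>\<^sup>+z. ennreal ((\<Prod>\<gamma>\<in>{x, y} - {x}. max 1 ((cmod z)\<^sup>2 / (cmod (\<gamma> - x))\<^sup>2)) * exp (- \<alpha> * (cmod z)\<^sup>2)) \<partial>lborel)"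
    proof (rule nn_integral_mono)
      fix z :: complex
      have "{x, y} - {x} = {y}" using x by auto
      then have "(\<Prod>\<gamma>\<in>{x, y} - {x}. max 1 ((cmod z)\<^sup>2 / (cmod (\<gamma> - x))\<^sup>2)) = max 1 ((cmod z)\<^sup>2 / d)"
        by (simp add: d_def)
      moreover have "1 / d * exp (- \<alpha> * (cmod z)\<^sup>2) \<le> max 1 ((cmod z)\<^sup>2 / d) * exp (- \<alpha> * (cmod z)\<^sup>2)" if "z \<notin> ball 0 1"
      proof -
        have "1 \<le> (cmod z)\<^sup>2" using that by (simp add: one_le_power)
        then have "1 / d \<le> (cmod z)\<^sup>2 / d" using d by (intro divide_right_mono) auto
        then have "1 / d \<le> max 1 ((cmod z)\<^sup>2 / d)" by (rule max.coboundedI2)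
        then show ?thesis by (intro mult_right_mono) auto
      qed
      ultimately show "ennreal (1 / d) * (ennreal (exp (- \<alpha> * (cmod z)\<^sup>2)) * indicator (- ball 0 1) z) \<le>
          ennreal ((\<Prod>\<gamma>\<in>{x, y} - {x}. max 1 ((cmod z)\<^sup>2 / (cmod (\<gamma> - x))\<^sup>2)) * exp (- \<alpha> * (cmod z)\<^sup>2))"
        using d by (cases "z \<in> ball 0 1") (simp_all only: indicator_simps Compl_iff, simp_all flip: ennreal_mult'' add: ennreal_leI)
    qed
    also have "\<dots> \<le> ennreal M" by (rule M(2)) (use x in auto)
    finally have "c / d \<le> M" using M(1) by simp
    then have "c / M \<le> d" using d M(1) by (simp add: field_simps)
    then show ?thesis by (simp add: d_def dist_norm norm_minus_commute)
  qed
  have "\<forall>x\<in>\<Gamma>. \<forall>y\<in>\<Gamma>. dist x y < sqrt (c / M) \<longrightarrow> x = y"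
  proof (intro ballI impI, rule ccontr)
    fix x y assume xy: "x \<in> \<Gamma>" "y \<in> \<Gamma>" "dist x y < sqrt (c / M)" "x \<noteq> y"
    from sep[OF xy(1,2,4)] have "sqrt (c / M) \<le> dist x y" by (intro real_le_lsqrt) (use c M in auto)
    with xy(3) show False by simp
  qed
  moreover have "sqrt (c / M) > 0" using c M by simp
  ultimately show ?thesis unfolding uniform_discrete_def by blast
qed

text \<open>Up to the factor \<open>\<pi> \<tau> / 4\<close>, the Gaussian of \<open>w - \<gamma>\<close> is the overlap of two Gaussians of half the variance
  centred at \<open>w\<close> and \<open>\<gamma>\<close>. So the double sum is the square of the \<open>L\<^sup>2\<close> norm of a sum \<open>F\<close> of Gaussians. All but a fraction
  \<open>\<epsilon>\<close> of the mass of \<open>F\<close> lies in \<open>A\<close>, and Cauchy's inequality on \<open>A\<close> gives the bound.\<close>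
lemma gaussian_energy_lower_bound:
  fixes P A :: "complex set"
  assumes P: "finite P" and A[measurable]: "A \<in> sets borel" and AV: "emeasure lborel A = ennreal V" and V: "V > 0"
    and ball: "\<And>w. w \<in> P \<Longrightarrow> ball w \<rho> \<subseteq> A" and \<tau>: "\<tau> > 0" and \<rho>: "\<rho> \<ge> 0" and \<epsilon>: "exp (- 2 * \<rho>\<^sup>2 / \<tau>) \<le> \<epsilon>" "\<epsilon> \<le> 1"
  shows "pi * \<tau> * (real (card P))\<^sup>2 * (1 - \<epsilon>)\<^sup>2 \<le> V * (\<Sum>w\<in>P. \<Sum>\<gamma>\<in>P. exp (- (cmod (w - \<gamma>))\<^sup>2 / \<tau>))"
proof -
  define p where "p = real (card P)"
  define S where "S = (\<Sum>w\<in>P. \<Sum>\<gamma>\<in>P. exp (- (cmod (w - \<gamma>))\<^sup>2 / \<tau>))"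
  define e where "e = (\<lambda>w x. exp (- (2 / \<tau>) * (cmod (x - w))\<^sup>2))"
  define F where "F = (\<lambda>x. \<Sum>w\<in>P. e w x)"
  have [measurable]: "e w \<in> borel_measurable borel" for w unfolding e_def by measurable
  have [measurable]: "F \<in> borel_measurable borel" unfolding F_def by measurable
  have e0: "e w x \<ge> 0" for w x by (simp add: e_def)
  have F0: "F x \<ge> 0" for x unfolding F_def by (intro sum_nonneg e0)
  have t2: "2 / \<tau> > 0" using \<tau> by simp
  \<comment> \<open>The value that maximises \<open>2 c \<integral>F - c\<^sup>2 V\<close>, where \<open>\<integral>F\<close> is replaced by its lower bound.\<close>
  define c where "c = p * pi * \<tau> * (1 - \<epsilon>) / (2 * V)"
  have c0: "c \<ge> 0" using \<tau> V \<epsilon> by (simp add: c_def p_def)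
  have S0: "S \<ge> 0" unfolding S_def by (intro sum_nonneg) simp
  have FF: "(\<integral>\<^sup>+x. ennreal ((F x)\<^sup>2) \<partial>lborel) = ennreal (pi * \<tau> / 4 * S)"
  proof -
    have pr: "e w x * e \<gamma> x = exp (- (cmod (w - \<gamma>))\<^sup>2 / \<tau>) * exp (- (4 / \<tau>) * (cmod (x - (w + \<gamma>) / 2))\<^sup>2)" for w \<gamma> x
    proof -
      have "2 * (cmod (x - w))\<^sup>2 + 2 * (cmod (x - \<gamma>))\<^sup>2 = (cmod (w - \<gamma>))\<^sup>2 + 4 * (cmod (x - (w + \<gamma>) / 2))\<^sup>2"
        unfolding cmod_power2 by (simp add: power2_eq_square field_simps)
      then have "- (2 / \<tau>) * (cmod (x - w))\<^sup>2 + - (2 / \<tau>) * (cmod (x - \<gamma>))\<^sup>2 =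
           - (cmod (w - \<gamma>))\<^sup>2 / \<tau> + - (4 / \<tau>) * (cmod (x - (w + \<gamma>) / 2))\<^sup>2"
        using \<tau> by (simp add: field_simps)
      then show ?thesis unfolding e_def exp_add[symmetric] by simp
    qed
    have "(\<integral>\<^sup>+x. ennreal ((F x)\<^sup>2) \<partial>lborel) = (\<integral>\<^sup>+x. (\<Sum>w\<in>P. \<Sum>\<gamma>\<in>P. ennreal (e w x * e \<gamma> x)) \<partial>lborel)"
      unfolding F_def power2_eq_square sum_product
      by (intro nn_integral_cong) (simp add: e0 sum_nonneg)
    also have "\<dots> = (\<Sum>w\<in>P. \<Sum>\<gamma>\<in>P. \<integral>\<^sup>+x. ennreal (e w x * e \<gamma> x) \<partial>lborel)"
      by (simp add: nn_integral_sum)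
    also have "\<dots> = (\<Sum>w\<in>P. \<Sum>\<gamma>\<in>P. ennreal (exp (- (cmod (w - \<gamma>))\<^sup>2 / \<tau>) * (pi * \<tau> / 4)))"
    proof (intro sum.cong refl)
      fix w \<gamma>
      have "(\<integral>\<^sup>+x. ennreal (e w x * e \<gamma> x) \<partial>lborel) = ennreal (exp (- (cmod (w - \<gamma>))\<^sup>2 / \<tau>)) * (\<integral>\<^sup>+x. ennreal (exp (- (4 / \<tau>) * (cmod (x - (w + \<gamma>) / 2))\<^sup>2)) \<partial>lborel)"
        unfolding pr by (subst nn_integral_cmult[symmetric]) (auto simp: ennreal_mult'' intro!: nn_integral_cong)
      also have "\<dots> = ennreal (exp (- (cmod (w - \<gamma>))\<^sup>2 / \<tau>)) * ennreal (pi / (4 / \<tau>))"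
        using \<tau> by (subst nn_integral_gauss) auto
      finally show "(\<integral>\<^sup>+x. ennreal (e w x * e \<gamma> x) \<partial>lborel) = ennreal (exp (- (cmod (w - \<gamma>))\<^sup>2 / \<tau>) * (pi * \<tau> / 4))"
        using \<tau> by (simp flip: ennreal_mult'')
    qed
    also have "\<dots> = ennreal (\<Sum>w\<in>P. \<Sum>\<gamma>\<in>P. exp (- (cmod (w - \<gamma>))\<^sup>2 / \<tau>) * (pi * \<tau> / 4))"
      using \<tau> by (simp add: sum_nonneg)
    also have "(\<Sum>w\<in>P. \<Sum>\<gamma>\<in>P. exp (- (cmod (w - \<gamma>))\<^sup>2 / \<tau>) * (pi * \<tau> / 4)) = pi * \<tau> / 4 * S"
      unfolding S_def sum_distrib_left by (simp only: mult.commute)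
    finally show ?thesis .
  qed
  have FA: "ennreal (p * (pi * \<tau> / 2 * (1 - \<epsilon>))) \<le> (\<integral>\<^sup>+x\<in>A. ennreal (F x) \<partial>lborel)"
  proof -
    have "ennreal (p * (pi * \<tau> / 2 * (1 - \<epsilon>))) = (\<Sum>w\<in>P. ennreal (pi * \<tau> / 2 * (1 - \<epsilon>)))"
      using \<tau> \<epsilon> by (simp add: p_def ennreal_of_nat_eq_real_of_nat flip: ennreal_mult)
    also have "\<dots> \<le> (\<Sum>w\<in>P. \<integral>\<^sup>+x\<in>A. ennreal (e w x) \<partial>lborel)"
    proof (rule sum_mono)
      fix w assume w: "w \<in> P"
      have [measurable]: "ball w \<rho> \<in> sets borel" "- ball w \<rho> \<in> sets borel"
        by (auto intro: borel_open borel_closed)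
      have "(\<integral>\<^sup>+x. ennreal (e w x) \<partial>lborel) = (\<integral>\<^sup>+x. ennreal (e w x) * indicator (ball w \<rho>) x + ennreal (e w x) * indicator (- ball w \<rho>) x \<partial>lborel)"
        by (intro nn_integral_cong) (auto simp: indicator_def)
      also have "\<dots> = (\<integral>\<^sup>+x\<in>ball w \<rho>. ennreal (e w x) \<partial>lborel) + (\<integral>\<^sup>+x\<in>- ball w \<rho>. ennreal (e w x) \<partial>lborel)"
        by (rule nn_integral_add) auto
      also have "(\<integral>\<^sup>+x\<in>- ball w \<rho>. ennreal (e w x) \<partial>lborel) = ennreal (pi / (2 / \<tau>) * exp (- (2 / \<tau>) * \<rho>\<^sup>2))"
        unfolding e_def by (rule nn_integral_gauss_tail[OF t2 \<rho>])
      also have "(\<integral>\<^sup>+x. ennreal (e w x) \<partial>lborel) = ennreal (pi / (2 / \<tau>))"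
        unfolding e_def by (rule nn_integral_gauss[OF t2])
      finally have eq: "(\<integral>\<^sup>+x\<in>ball w \<rho>. ennreal (e w x) \<partial>lborel) = ennreal (pi / (2 / \<tau>)) - ennreal (pi / (2 / \<tau>) * exp (- (2 / \<tau>) * \<rho>\<^sup>2))"
        by simp
      have "- (2 / \<tau>) * \<rho>\<^sup>2 = - 2 * \<rho>\<^sup>2 / \<tau>" by simp
      then have "pi / (2 / \<tau>) * exp (- (2 / \<tau>) * \<rho>\<^sup>2) \<le> pi / (2 / \<tau>) * \<epsilon>"
        using \<epsilon> \<tau> by (intro mult_left_mono) auto
      moreover have "pi * \<tau> / 2 * (1 - \<epsilon>) = pi / (2 / \<tau>) - pi / (2 / \<tau>) * \<epsilon>"
        by (simp add: field_simps)
      ultimately have "pi * \<tau> / 2 * (1 - \<epsilon>) \<le> pi / (2 / \<tau>) - pi / (2 / \<tau>) * exp (- (2 / \<tau>) * \<rho>\<^sup>2)"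
        by linarith
      then have "ennreal (pi * \<tau> / 2 * (1 - \<epsilon>)) \<le> ennreal (pi / (2 / \<tau>)) - ennreal (pi / (2 / \<tau>) * exp (- (2 / \<tau>) * \<rho>\<^sup>2))"
        using \<tau> by (subst ennreal_minus) (auto intro!: ennreal_leI)
      also have "\<dots> \<le> (\<integral>\<^sup>+x\<in>A. ennreal (e w x) \<partial>lborel)"
        unfolding eq[symmetric] using ball[OF w] by (intro nn_integral_mono) (auto simp: indicator_def)
      finally show "ennreal (pi * \<tau> / 2 * (1 - \<epsilon>)) \<le> (\<integral>\<^sup>+x\<in>A. ennreal (e w x) \<partial>lborel)" .
    qed
    also have "\<dots> = (\<integral>\<^sup>+x. (\<Sum>w\<in>P. ennreal (e w x) * indicator A x) \<partial>lborel)"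
      by (subst nn_integral_sum) auto
    also have "\<dots> = (\<integral>\<^sup>+x\<in>A. ennreal (F x) \<partial>lborel)"
      unfolding F_def by (intro nn_integral_cong) (simp add: e0 sum_distrib_right[symmetric])
    finally show ?thesis .
  qed
  have "ennreal (2 * c * (p * (pi * \<tau> / 2 * (1 - \<epsilon>)))) \<le> ennreal (2 * c) * (\<integral>\<^sup>+x\<in>A. ennreal (F x) \<partial>lborel)"
    unfolding ennreal_mult'[OF mult_nonneg_nonneg[OF zero_le_numeral c0]] by (rule mult_left_mono[OF FA]) simp
  also have "\<dots> = (\<integral>\<^sup>+x. ennreal (2 * c) * (ennreal (F x) * indicator A x) \<partial>lborel)"
    by (subst nn_integral_cmult) simp_all
  also have "\<dots> \<le> (\<integral>\<^sup>+x. ennreal ((F x)\<^sup>2) + ennreal (c\<^sup>2) * indicator A x \<partial>lborel)"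
  proof (rule nn_integral_mono)
    fix x
    have "2 * c * F x \<le> (F x)\<^sup>2 + c\<^sup>2" using sum_squares_bound[of c "F x"] by simp
    then show "ennreal (2 * c) * (ennreal (F x) * indicator A x) \<le> ennreal ((F x)\<^sup>2) + ennreal (c\<^sup>2) * indicator A x"
      using c0 F0[of x] by (auto simp: indicator_def ennreal_leI simp flip: ennreal_plus ennreal_mult'')
  qed
  also have "\<dots> = ennreal (pi * \<tau> / 4 * S) + ennreal (c\<^sup>2) * ennreal V"
    by (subst nn_integral_add) (simp_all add: FF AV nn_integral_cmult_indicator)
  also have "\<dots> = ennreal (pi * \<tau> / 4 * S + c\<^sup>2 * V)"
    using V \<tau> S0 by (simp flip: ennreal_mult'' ennreal_plus)
  finally have "2 * c * (p * (pi * \<tau> / 2 * (1 - \<epsilon>))) \<le> pi * \<tau> / 4 * S + c\<^sup>2 * V"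
    using V \<tau> S0 by (subst (asm) ennreal_le_iff) auto
  moreover have "2 * c * (p * (pi * \<tau> / 2 * (1 - \<epsilon>))) = 2 * c\<^sup>2 * V"
    using V by (simp add: c_def power2_eq_square mult_ac)
  ultimately have "c\<^sup>2 * V \<le> pi * \<tau> / 4 * S" by linarith
  then have "c\<^sup>2 * V * (4 * V / (pi * \<tau>)) \<le> pi * \<tau> / 4 * S * (4 * V / (pi * \<tau>))"
    using V \<tau> by (intro mult_right_mono) auto
  moreover have "c\<^sup>2 * V * (4 * V / (pi * \<tau>)) = pi * \<tau> * p\<^sup>2 * (1 - \<epsilon>)\<^sup>2"
    using V \<tau> by (simp add: c_def power2_eq_square mult_ac)
  moreover have "pi * \<tau> / 4 * S * (4 * V / (pi * \<tau>)) = V * S" using V \<tau> by simp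
  ultimately show ?thesis by (simp add: S_def p_def)
qed

section \<open>Logarithmic energy at one scale\<close>

text \<open>The mean for the exponential distribution, which is the law of \<open>|z|\<^sup>2 / t\<close> when \<open>z\<close> has the Gaussian
  density \<open>exp (- |z|\<^sup>2 / t) / (\<pi> t)\<close>. Leaving out \<open>0\<close> keeps logarithms away from their default value.\<close>
definition exp_mean :: "(real \<Rightarrow> ennreal) \<Rightarrow> ennreal" where
  "exp_mean F = (\<integral>\<^sup>+y\<in>{0<..}. F y * ennreal (exp (- y)) \<partial>lborel)"

lemma nn_integral_atLeast_greaterThan:
  "(\<integral>\<^sup>+y\<in>{0..}. f y \<partial>lborel) = (\<integral>\<^sup>+y\<in>{0<..}. f y \<partial>(lborel :: real measure))"
  by (intro nn_integral_cong_AE) (use AE_lborel_singleton[of "0::real"] in \<open>auto simp: indicator_def\<close>)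

lemma exp_mean_const: "exp_mean (\<lambda>_. c) = c"
proof -
  have "exp_mean (\<lambda>_. c) = (\<integral>\<^sup>+y. c * (ennreal (exp (- 1 * y)) * indicator {0<..} y) \<partial>lborel)"
    unfolding exp_mean_def by (simp add: mult_ac)
  also have "\<dots> = c * (\<integral>\<^sup>+y\<in>{0..}. ennreal (exp (- 1 * y)) \<partial>lborel)"
    unfolding nn_integral_atLeast_greaterThan by (rule nn_integral_cmult) measurable
  also have "(\<integral>\<^sup>+y\<in>{0..}. ennreal (exp (- 1 * y)) \<partial>lborel) = ennreal (1 / 1)"
    by (rule nn_integral_exp_scale) simp
  finally show ?thesis by simp
qed

lemma exp_mean_ident: "exp_mean ennreal = 1"
proof -
  have "((\<lambda>y. - (y + 1) * exp (- y :: real)) \<longlongrightarrow> 0) at_top" by real_asymp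
  then have "(\<integral>\<^sup>+y\<in>{0..}. ennreal (y * exp (- y)) \<partial>lborel) = ennreal (0 - (- (0 + 1) * exp (- 0)))"
    by (intro nn_integral_FTC_atLeast) (auto intro!: derivative_eq_intros simp: algebra_simps)
  moreover have "exp_mean ennreal = (\<integral>\<^sup>+y\<in>{0..}. ennreal (y * exp (- y)) \<partial>lborel)"
    unfolding nn_integral_atLeast_greaterThan exp_mean_def
    by (intro nn_integral_cong) (auto simp: indicator_def ennreal_mult'')
  ultimately show ?thesis by simp
qed

text \<open>The mean is \<open>\<Gamma>(1/2)\<close>; only its finiteness matters.\<close>
lemma exp_mean_inverse_sqrt: "\<exists>C\<ge>0. exp_mean (\<lambda>y. ennreal (1 / sqrt y)) \<le> ennreal C"
proof -
  have "((\<lambda>t. t powr (1/2 - 1) / exp t) has_integral Gamma (1/2 :: real)) {0..}"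
    by (rule Gamma_integral_real) simp
  then have "((\<lambda>t. if t \<in> {0..} then t powr (1/2 - 1) / exp t else 0) has_integral Gamma (1/2 :: real)) UNIV"
    by (subst has_integral_restrict_UNIV)
  then have "(\<integral>\<^sup>+t. ennreal (if t \<in> {0..} then t powr (1/2 - 1) / exp t else 0) \<partial>lborel) = ennreal (Gamma (1/2))"
    by (intro nn_integral_has_integral_lborel) auto
  moreover have "exp_mean (\<lambda>y. ennreal (1 / sqrt y)) = (\<integral>\<^sup>+t. ennreal (if t \<in> {0..} then t powr (1/2 - 1) / exp t else 0) \<partial>lborel)"
    unfolding exp_mean_def
    by (intro nn_integral_cong)
      (auto simp: indicator_def powr_minus powr_half_sqrt exp_minus field_simps simp flip: ennreal_mult'')
  moreover have "Gamma (1/2 :: real) \<ge> 0" by (simp add: Gamma_one_half_real)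
  ultimately show ?thesis by (intro exI[of _ "Gamma (1/2)"]) simp
qed

lemma exp_mean_add:
  "F \<in> borel_measurable borel \<Longrightarrow> G \<in> borel_measurable borel \<Longrightarrow>
    exp_mean (\<lambda>y. F y + G y) = exp_mean F + exp_mean G"
  unfolding exp_mean_def by (subst nn_integral_add[symmetric]) (auto simp: algebra_simps)

lemma exp_mean_cmult:
  "F \<in> borel_measurable borel \<Longrightarrow> exp_mean (\<lambda>y. c * F y) = c * exp_mean F"
  unfolding exp_mean_def by (subst nn_integral_cmult[symmetric]) (auto simp: algebra_simps)

lemma exp_mean_sum:
  "(\<And>i. i \<in> I \<Longrightarrow> F i \<in> borel_measurable borel) \<Longrightarrow>
    exp_mean (\<lambda>y. \<Sum>i\<in>I. F i y) = (\<Sum>i\<in>I. exp_mean (F i))"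
  unfolding exp_mean_def by (subst nn_integral_sum[symmetric]) (auto simp: sum_distrib_right)

lemma exp_mean_mono:
  "(\<And>y. y > 0 \<Longrightarrow> F y \<le> G y) \<Longrightarrow> exp_mean F \<le> exp_mean G"
  unfolding exp_mean_def by (intro nn_integral_mono) (auto simp: indicator_def intro!: mult_right_mono)

lemma exp_mean_rescale:
  assumes t: "t > 0" and [measurable]: "G \<in> borel_measurable borel"
  shows "exp_mean (\<lambda>y. G (t * y) * ennreal (t * y)) = (\<integral>\<^sup>+x\<in>{0<..}. G x * ennreal (x / t * exp (- x / t)) \<partial>lborel)"
proof -
  have "(\<integral>\<^sup>+x\<in>{0<..}. G x * ennreal (x / t * exp (- x / t)) \<partial>lborel) =
      ennreal \<bar>t\<bar> * (\<integral>\<^sup>+y. G (0 + t * y) * ennreal ((0 + t * y) / t * exp (- (0 + t * y) / t)) * indicator {0<..} (0 + t * y) \<partial>lborel)"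
    using t by (intro nn_integral_real_affine) auto
  also have "\<dots> = exp_mean (\<lambda>y. G (t * y) * ennreal (t * y))"
    unfolding exp_mean_def using t
    by (subst nn_integral_cmult[symmetric]) 
      (auto intro!: nn_integral_cong simp: indicator_def zero_less_mult_iff mult_ac ennreal_mult')
  finally show ?thesis ..
qed

text \<open>With \<open>a = |w - \<gamma>|\<^sup>2\<close> this is a superposition of Gaussians in \<open>w - \<gamma>\<close> of variances \<open>s t \<in> {1..t}\<close>. The full
  range \<open>{0..1}\<close> of \<open>s\<close> would give the mean of \<open>log\<^sup>+ (t y / a)\<close>; cutting it off at \<open>1 / t\<close> makes the
  value at \<open>a = 0\<close> finite.\<close>
definition log_kernel :: "real \<Rightarrow> real \<Rightarrow> ennreal" where
  "log_kernel t a = (\<integral>\<^sup>+s\<in>{1/t..1}. ennreal (exp (- a / (s * t)) / s) \<partial>lborel)"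

lemma nn_integral_inverse:
  assumes "0 < a" "a \<le> 1"
  shows "(\<integral>\<^sup>+s\<in>{a..1}. ennreal (1 / s) \<partial>lborel) = ennreal (- ln a)"
proof -
  have "(\<integral>\<^sup>+s. ennreal (1 / s) * indicator {a..1} s \<partial>lborel) = ennreal (ln 1 - ln a)"
    using assms by (intro nn_integral_FTC_Icc) (auto intro!: derivative_eq_intros)
  then show ?thesis by simp
qed

lemma log_kernel_0: "t \<ge> 1 \<Longrightarrow> log_kernel t 0 = ennreal (ln t)"
  unfolding log_kernel_def using nn_integral_inverse[of "1 / t"] by (simp add: ln_div)

text \<open>Write \<open>log\<^sup>+ (t y / a)\<close> as the integral of \<open>1 / s\<close> over the \<open>s \<le> 1\<close> with \<open>y \<ge> a / (s t)\<close> and exchange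
  the integrals: the exponential distribution gives this event the probability \<open>exp (- a / (s t))\<close>.\<close>
lemma log_kernel_le_exp_mean:
  assumes t: "t \<ge> 1" and a: "a > 0"
  shows "log_kernel t a \<le> exp_mean (\<lambda>y. ennreal (ln (max 1 (t * y / a))))"
proof -
  have "log_kernel t a = (\<integral>\<^sup>+s. ennreal (1 / s) * indicator {1/t..1} s * (\<integral>\<^sup>+y. ennreal (exp (- y)) * indicator {a / (s * t)..} y \<partial>lborel) \<partial>lborel)"
    unfolding log_kernel_def
  proof (rule nn_integral_cong)
    fix s :: real
    have "((\<lambda>y. - exp (- y :: real)) \<longlongrightarrow> 0) at_top" by real_asymp
    then have "(\<integral>\<^sup>+y. ennreal (exp (- y)) * indicator {a / (s * t)..} y \<partial>lborel) = ennreal (0 - (- exp (- (a / (s * t)))))"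
      by (intro nn_integral_FTC_atLeast) (auto intro!: derivative_eq_intros)
    moreover have "s > 0" if "s \<in> {1/t..1}" using that t by (auto intro: less_le_trans[of 0 "1/t"])
    ultimately show "ennreal (exp (- a / (s * t)) / s) * indicator {1/t..1} s = ennreal (1 / s) * indicator {1/t..1} s * (\<integral>\<^sup>+y. ennreal (exp (- y)) * indicator {a / (s * t)..} y \<partial>lborel)"
      by (auto simp: indicator_def simp flip: ennreal_mult'')
  qed
  also have "\<dots> = (\<integral>\<^sup>+s. (\<integral>\<^sup>+y. ennreal (1 / s) * indicator {1/t..1} s * (ennreal (exp (- y)) * indicator {a / (s * t)..} y) \<partial>lborel) \<partial>lborel)"
    by (intro nn_integral_cong nn_integral_cmult[symmetric]) simp
  also have "\<dots> = (\<integral>\<^sup>+y. (\<integral>\<^sup>+s. ennreal (1 / s) * indicator {1/t..1} s * (ennreal (exp (- y)) * indicator {a / (s * t)..} y) \<partial>lborel) \<partial>lborel)"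
  proof (rule lborel_pair.Fubini')
    have *: "indicator {a / (s * t)..} y = (if a / (s * t) \<le> y then 1 else 0 :: ennreal)" for s y
      by (simp add: indicator_def)
    show "(\<lambda>(y, s). ennreal (1 / s) * indicator {1/t..1} s * (ennreal (exp (- y)) * indicator {a / (s * t)..} y)) \<in> borel_measurable (lborel \<Otimes>\<^sub>M lborel)"
      unfolding * by measurable
  qed
  also have "\<dots> \<le> exp_mean (\<lambda>y. ennreal (ln (max 1 (t * y / a))))"
    unfolding exp_mean_def
  proof (rule nn_integral_mono)
    fix y :: real
    have pos: "s > 0" if "s \<in> {1/t..1}" for s using that t by (auto intro: less_le_trans[of 0 "1/t"])
    have "(\<integral>\<^sup>+s. ennreal (1 / s) * indicator {1/t..1} s * (ennreal (exp (- y)) * indicator {a / (s * t)..} y) \<partial>lborel)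
       \<le> (\<integral>\<^sup>+s. (ennreal (exp (- y)) * indicator {0<..} y) * (ennreal (1 / s) * indicator {a / (t * y)..1} s) \<partial>lborel)"
    proof (rule nn_integral_mono)
      fix s
      show "ennreal (1 / s) * indicator {1/t..1} s * (ennreal (exp (- y)) * indicator {a / (s * t)..} y)
        \<le> (ennreal (exp (- y)) * indicator {0<..} y) * (ennreal (1 / s) * indicator {a / (t * y)..1} s)"
      proof (cases "s \<in> {1/t..1} \<and> a / (s * t) \<le> y")
        case True
        then have "s > 0" using pos by blast
        then have "a / (s * t) > 0" using a t by simp
        then have "y > 0" using True by linarith
        moreover from this have "a / (t * y) \<le> s" using True \<open>s > 0\<close> t by (simp add: field_simps)
        ultimately show ?thesis using True by (simp add: mult_ac)
      qed (auto simp: indicator_def)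
    qed
    also have "\<dots> = (ennreal (exp (- y)) * indicator {0<..} y) * (\<integral>\<^sup>+s. ennreal (1 / s) * indicator {a / (t * y)..1} s \<partial>lborel)"
      by (rule nn_integral_cmult) measurable
    also have "\<dots> \<le> (ennreal (exp (- y)) * indicator {0<..} y) * ennreal (ln (max 1 (t * y / a)))"
    proof (cases "y > 0")
      case y: True
      have "(\<integral>\<^sup>+s. ennreal (1 / s) * indicator {a / (t * y)..1} s \<partial>lborel) \<le> ennreal (ln (max 1 (t * y / a)))"
      proof (cases "a / (t * y) \<le> 1")
        case True
        moreover have "a / (t * y) > 0" using a t y by simp
        moreover have "- ln (a / (t * y)) = ln (t * y / a)" using a t y by (simp add: ln_div ln_mult)
        moreover have "t * y / a \<ge> 1" using True a t y by (simp add: field_simps)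
        ultimately show ?thesis by (simp add: nn_integral_inverse max_def)
      qed simp
      then show ?thesis by (rule mult_left_mono) simp
    qed simp
    finally show "(\<integral>\<^sup>+s. ennreal (1 / s) * indicator {1/t..1} s * (ennreal (exp (- y)) * indicator {a / (s * t)..} y) \<partial>lborel)
        \<le> ennreal (ln (max 1 (t * y / a))) * ennreal (exp (- y)) * indicator {0<..} y"
      by (simp add: mult_ac)
  qed
  finally show ?thesis .
qed

text \<open>A lower bound of the logarithm that is integrable at \<open>0\<close>.\<close>
lemma ln_ge_inverse_sqrt: "y > 0 \<Longrightarrow> ln y \<ge> 2 - 2 / sqrt (y::real)"
proof -
  assume y: "y > 0"
  have "ln (1 / sqrt y) \<le> 1 / sqrt y - 1" using y by (intro ln_le_minus_one) simp
  moreover have "ln (1 / sqrt y) = - (ln y / 2)" using y by (simp add: ln_div ln_sqrt)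
  ultimately show ?thesis by simp
qed

text \<open>As a mean over \<open>x = t y\<close>, with \<open>y\<close> exponentially distributed, the right side has the integrand \<open>exp X\<close> for
  \<open>X = \<Sum> log\<^sup>+ (x / |\<gamma> - w|\<^sup>2) - \<alpha> x + ln x\<close>, and \<open>exp X \<ge> exp m * (1 + X - m)\<close> makes it linear in the logarithms.
  The weight contributes \<open>ln t\<close>, which is \<open>log_kernel t 0\<close>: this is why the sum on the left may include
  \<open>\<gamma> = w\<close>.\<close>
lemma scale_energy:
  fixes P :: "complex set"
  assumes \<alpha>: "\<alpha> > 0" and t: "t \<ge> 1" and P: "finite P" "w \<in> P" and m: "m \<le> 0"
    and C: "C \<ge> 0" "exp_mean (\<lambda>y. ennreal (1 / sqrt y)) \<le> ennreal C"
  defines "G \<equiv> (\<lambda>x. ennreal ((\<Prod>\<gamma>\<in>P - {w}. max 1 (x / (cmod (\<gamma> - w))\<^sup>2)) * exp (- \<alpha> * x)))"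
  shows "ennreal (exp m) * (ennreal (3 - m) + (\<Sum>\<gamma>\<in>P. log_kernel t ((cmod (\<gamma> - w))\<^sup>2)))
     \<le> (\<integral>\<^sup>+x\<in>{0<..}. G x * ennreal (x / t * exp (- x / t)) \<partial>lborel) + ennreal (exp m * (\<alpha> * t + 2 * C))"
proof -
  define a where "a = (\<lambda>\<gamma>. (cmod (\<gamma> - w))\<^sup>2)"
  have a: "a \<gamma> > 0" if "\<gamma> \<in> P - {w}" for \<gamma> using that by (simp add: a_def)
  define L where "L = (\<lambda>y \<gamma>. ln (max 1 (t * y / a \<gamma>)))"
  have L0: "L y \<gamma> \<ge> 0" for y \<gamma> by (simp add: L_def)
  have [measurable]: "(\<lambda>y. L y \<gamma>) \<in> borel_measurable borel" for \<gamma> unfolding L_def by measurable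
  have [measurable]: "G \<in> borel_measurable borel" unfolding G_def by measurable
  have "(\<Sum>\<gamma>\<in>P. log_kernel t (a \<gamma>)) = ennreal (ln t) + (\<Sum>\<gamma>\<in>P - {w}. log_kernel t (a \<gamma>))"
    using P t by (simp add: sum.remove[of P w] log_kernel_0 a_def)
  also have "\<dots> \<le> ennreal (ln t) + (\<Sum>\<gamma>\<in>P - {w}. exp_mean (\<lambda>y. ennreal (L y \<gamma>)))"
    unfolding L_def by (intro add_left_mono sum_mono log_kernel_le_exp_mean t a)
  also have "\<dots> = exp_mean (\<lambda>y. ennreal (ln t + (\<Sum>\<gamma>\<in>P - {w}. L y \<gamma>)))"
    using t L0 by (simp add: exp_mean_sum[symmetric] exp_mean_const exp_mean_add[of "\<lambda>_. ennreal (ln t)", symmetric, simplified exp_mean_const]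
      sum_nonneg ennreal_plus)
  finally have "ennreal (exp m) * (ennreal (3 - m) + (\<Sum>\<gamma>\<in>P. log_kernel t (a \<gamma>)))
     \<le> ennreal (exp m) * (ennreal (3 - m) + exp_mean (\<lambda>y. ennreal (ln t + (\<Sum>\<gamma>\<in>P - {w}. L y \<gamma>))))"
    by (intro mult_left_mono add_left_mono) auto
  also have "\<dots> = ennreal (exp m) * exp_mean (\<lambda>y. ennreal (3 - m) + ennreal (ln t + (\<Sum>\<gamma>\<in>P - {w}. L y \<gamma>)))"
    by (subst exp_mean_add) (simp_all add: exp_mean_const)
  also have "\<dots> = exp_mean (\<lambda>y. ennreal (exp m) * (ennreal (3 - m) + ennreal (ln t + (\<Sum>\<gamma>\<in>P - {w}. L y \<gamma>))))"
    by (rule exp_mean_cmult[symmetric]) measurable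
  also have "\<dots> \<le> exp_mean (\<lambda>y. G (t * y) * ennreal (t * y) + (ennreal (exp m * (\<alpha> * t)) * ennreal y + ennreal (exp m * 2) * ennreal (1 / sqrt y)))"
  proof (rule exp_mean_mono)
    fix y :: real assume y: "y > 0"
    define X where "X = (\<Sum>\<gamma>\<in>P - {w}. L y \<gamma>) - \<alpha> * (t * y) + ln (t * y)"
    have "(\<Prod>\<gamma>\<in>P - {w}. max 1 (t * y / (cmod (\<gamma> - w))\<^sup>2)) = exp (\<Sum>\<gamma>\<in>P - {w}. L y \<gamma>)"
      using P by (subst exp_sum) (auto simp: L_def a_def intro!: prod.cong)
    then have GX: "G (t * y) * ennreal (t * y) = ennreal (exp X)"
      using y t unfolding G_def X_def by (simp add: exp_add exp_diff exp_minus field_simps flip: ennreal_mult'')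
    have "exp (X - m) \<ge> 1 + (X - m)" by (rule exp_ge_add_one_self)
    then have "exp m * (1 + (X - m)) \<le> exp m * exp (X - m)" by (rule mult_left_mono) simp
    also have "\<dots> = exp X" by (simp flip: exp_add)
    finally have 1: "exp m * (1 + (X - m)) \<le> exp X" .
    have "ln (t * y) = ln t + ln y" using t y by (simp add: ln_mult)
    then have "3 - m + (ln t + (\<Sum>\<gamma>\<in>P - {w}. L y \<gamma>)) \<le> 1 + (X - m) + (\<alpha> * t * y + 2 * (1 / sqrt y))"
      using ln_ge_inverse_sqrt[OF y] unfolding X_def by simp
    then have "exp m * (3 - m + (ln t + (\<Sum>\<gamma>\<in>P - {w}. L y \<gamma>))) \<le> exp m * (1 + (X - m) + (\<alpha> * t * y + 2 * (1 / sqrt y)))"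
      by (rule mult_left_mono) simp
    also have "\<dots> = exp m * (1 + (X - m)) + (exp m * (\<alpha> * t) * y + exp m * 2 * (1 / sqrt y))"
      by (simp add: algebra_simps)
    also have "\<dots> \<le> exp X + (exp m * (\<alpha> * t) * y + exp m * 2 * (1 / sqrt y))"
      using 1 by simp
    finally have 2: "exp m * (3 - m + (ln t + (\<Sum>\<gamma>\<in>P - {w}. L y \<gamma>))) \<le> exp X + (exp m * (\<alpha> * t) * y + exp m * 2 * (1 / sqrt y))" .
    have "ennreal (exp m) * (ennreal (3 - m) + ennreal (ln t + (\<Sum>\<gamma>\<in>P - {w}. L y \<gamma>))) = ennreal (exp m * (3 - m + (ln t + (\<Sum>\<gamma>\<in>P - {w}. L y \<gamma>))))"
      using m t L0 by (simp add: sum_nonneg ennreal_mult'' flip: ennreal_plus)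
    also have "\<dots> \<le> ennreal (exp X + (exp m * (\<alpha> * t) * y + exp m * 2 * (1 / sqrt y)))"
      using 2 by (rule ennreal_leI)
    also have "\<dots> = ennreal (exp X) + (ennreal (exp m * (\<alpha> * t)) * ennreal y + ennreal (exp m * 2) * ennreal (1 / sqrt y))"
      using \<alpha> t y by (subst ennreal_plus ennreal_mult''[symmetric], simp, simp)+
    finally show "ennreal (exp m) * (ennreal (3 - m) + ennreal (ln t + (\<Sum>\<gamma>\<in>P - {w}. L y \<gamma>)))
      \<le> G (t * y) * ennreal (t * y) + (ennreal (exp m * (\<alpha> * t)) * ennreal y + ennreal (exp m * 2) * ennreal (1 / sqrt y))"
      unfolding GX .
  qed
  also have "\<dots> = exp_mean (\<lambda>y. G (t * y) * ennreal (t * y)) + (ennreal (exp m * (\<alpha> * t)) * exp_mean ennreal + ennreal (exp m * 2) * exp_mean (\<lambda>y. ennreal (1 / sqrt y)))"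
    by (simp add: exp_mean_add exp_mean_cmult)
  also have "\<dots> \<le> (\<integral>\<^sup>+x\<in>{0<..}. G x * ennreal (x / t * exp (- x / t)) \<partial>lborel) + (ennreal (exp m * (\<alpha> * t)) * 1 + ennreal (exp m * 2) * ennreal C)"
    using C t by (intro add_mono mult_left_mono) (simp_all add: exp_mean_rescale exp_mean_ident)
  also have "ennreal (exp m * (\<alpha> * t)) * 1 + ennreal (exp m * 2) * ennreal C = ennreal (exp m * (\<alpha> * t + 2 * C))"
    using C \<alpha> t by (simp add: distrib_left mult_ac flip: ennreal_mult'' ennreal_plus)
  finally show ?thesis by (simp add: a_def)
qed

text \<open>The terms \<open>u exp (- u)\<close> with \<open>u = x / 2 ^ k\<close> are at most \<open>2 (exp (- u / 2) - exp (- u))\<close>, which telescopes. So all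
  scales together cost no more than a multiple of one energy.\<close>
lemma sum_dyadic_weights:
  assumes x: "x \<ge> (0::real)"
  shows "(\<Sum>k<n. x / 2 ^ k * exp (- x / 2 ^ k)) \<le> 2"
proof -
  have *: "u * exp (- u) \<le> 2 * (exp (- (u / 2)) - exp (- u))" for u :: real
  proof -
    have "u / 2 \<le> exp (u / 2) - 1" using exp_ge_add_one_self[of "u / 2"] by linarith
    then have "exp (- u) * (u / 2) \<le> exp (- u) * (exp (u / 2) - 1)" by (rule mult_left_mono) simp
    also have "\<dots> = exp (- (u / 2)) - exp (- u)" by (simp add: algebra_simps flip: exp_add)
    finally show ?thesis by (simp add: mult.commute)
  qed
  have "(\<Sum>k<n. x / 2 ^ k * exp (- x / 2 ^ k)) \<le> (\<Sum>k<n. 2 * (exp (- (x / 2 ^ Suc k)) - exp (- (x / 2 ^ k))))"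
    using *[of "x / 2 ^ _"] by (intro sum_mono) (simp add: mult_ac)
  also have "\<dots> = 2 * (\<Sum>k<n. exp (- (x / 2 ^ Suc k)) - exp (- (x / 2 ^ k)))"
    by (rule sum_distrib_left[symmetric])
  also have "(\<Sum>k<n. exp (- (x / 2 ^ Suc k)) - exp (- (x / 2 ^ k))) = exp (- (x / 2 ^ n)) - exp (- (x / 2 ^ 0))"
    by (rule sum_lessThan_telescope)
  also have "2 * (exp (- (x / 2 ^ n)) - exp (- (x / 2 ^ 0))) \<le> 2 * (1 - 0)" using x by (intro mult_left_mono diff_mono) auto
  finally show ?thesis by simp
qed

section \<open>The density of an interpolation set\<close>

text \<open>The Gaussian lower bound, integrated over the variances that make up the kernel.\<close>
lemma log_kernel_sum_lower_bound:
  fixes P A :: "complex set"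
  assumes P: "finite P" and A: "A \<in> sets borel" "emeasure lborel A = ennreal V" and V: "V > 0"
    and ball: "\<And>w. w \<in> P \<Longrightarrow> ball w \<rho> \<subseteq> A" and t: "1 \<le> t" "t \<le> T" and \<rho>: "\<rho> \<ge> 0"
    and \<epsilon>: "exp (- 2 * \<rho>\<^sup>2 / T) \<le> \<epsilon>" "\<epsilon> \<le> 1"
  shows "ennreal (pi * (real (card P))\<^sup>2 * ((1 - \<epsilon>)\<^sup>2 / V) * (t - 1)) \<le> (\<Sum>w\<in>P. \<Sum>\<gamma>\<in>P. log_kernel t ((cmod (\<gamma> - w))\<^sup>2))"
proof -
  define K where "K = pi * (real (card P))\<^sup>2 * ((1 - \<epsilon>)\<^sup>2 / V)"
  have K: "K \<ge> 0" using V by (simp add: K_def)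
  have "ennreal (K * (t - 1)) = (\<integral>\<^sup>+s. ennreal (K * t) * indicator {1/t..1} s \<partial>lborel)"
  proof -
    have "K * (t - 1) = K * t * (1 - 1 / t)" using t by (simp add: field_simps)
    then show ?thesis using t K by (simp add: nn_integral_cmult_indicator flip: ennreal_mult')
  qed
  also have "\<dots> \<le> (\<integral>\<^sup>+s. (\<Sum>w\<in>P. \<Sum>\<gamma>\<in>P. ennreal (exp (- (cmod (\<gamma> - w))\<^sup>2 / (s * t)) / s) * indicator {1/t..1} s) \<partial>lborel)"
  proof (rule nn_integral_mono)
    fix s
    show "ennreal (K * t) * indicator {1/t..1} s \<le> (\<Sum>w\<in>P. \<Sum>\<gamma>\<in>P. ennreal (exp (- (cmod (\<gamma> - w))\<^sup>2 / (s * t)) / s) * indicator {1/t..1} s)"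
    proof (cases "s \<in> {1/t..1}")
      case True
      then have s: "s > 0" using t by (auto intro: less_le_trans[of 0 "1/t"])
      define \<tau> where "\<tau> = s * t"
      have \<tau>: "0 < \<tau>" "\<tau> \<le> T"
        using s t True by (auto simp: \<tau>_def intro: order_trans[of _ "1 * t"] mult_right_mono)
      have "2 * \<rho>\<^sup>2 / T \<le> 2 * \<rho>\<^sup>2 / \<tau>" using \<tau> by (intro divide_left_mono) auto
      then have "exp (- 2 * \<rho>\<^sup>2 / \<tau>) \<le> exp (- 2 * \<rho>\<^sup>2 / T)" by simp
      then have "exp (- 2 * \<rho>\<^sup>2 / \<tau>) \<le> \<epsilon>" using \<epsilon> by linarith
      from gaussian_energy_lower_bound[OF P A V ball \<tau>(1) \<rho> this \<epsilon>(2)]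
      have "pi * \<tau> * (real (card P))\<^sup>2 * (1 - \<epsilon>)\<^sup>2 \<le> V * (\<Sum>w\<in>P. \<Sum>\<gamma>\<in>P. exp (- (cmod (w - \<gamma>))\<^sup>2 / \<tau>))" .
      then have "K * \<tau> \<le> (\<Sum>w\<in>P. \<Sum>\<gamma>\<in>P. exp (- (cmod (w - \<gamma>))\<^sup>2 / \<tau>))"
        using V unfolding K_def by (simp add: field_simps)
      then have "K * \<tau> / s \<le> (\<Sum>w\<in>P. \<Sum>\<gamma>\<in>P. exp (- (cmod (w - \<gamma>))\<^sup>2 / \<tau>)) / s"
        using s by (intro divide_right_mono) auto
      then have *: "K * t \<le> (\<Sum>w\<in>P. \<Sum>\<gamma>\<in>P. exp (- (cmod (\<gamma> - w))\<^sup>2 / \<tau>) / s)"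
        using s by (simp add: \<tau>_def sum_divide_distrib norm_minus_commute)
      show ?thesis using True ennreal_leI[OF *] s by (simp add: sum_nonneg \<tau>_def)
    qed simp
  qed
  also have "\<dots> = (\<Sum>w\<in>P. \<Sum>\<gamma>\<in>P. log_kernel t ((cmod (\<gamma> - w))\<^sup>2))"
    unfolding log_kernel_def by (subst nn_integral_sum, measurable)+ 
  finally show ?thesis by (simp add: K_def)
qed

text \<open>Sum the estimate at one scale over the scales \<open>2 ^ k\<close> for \<open>k < n\<close> and over \<open>w \<in> P\<close>, and bound the double sums
  from below. The choice \<open>m = - ln n\<close> balances the total energy against the number of scales and produces the gain
  \<open>n ln n\<close> on the right.\<close>
lemma interpolation_energy_inequality:
  fixes P A :: "complex set"
  assumes \<alpha>: "\<alpha> > 0" and P: "finite P" "P \<noteq> {}" and M: "M > 0"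
    and E: "\<And>w. w \<in> P \<Longrightarrow>
     (\<integral>\<^sup>+z. ennreal ((\<Prod>\<gamma>\<in>P - {w}. max 1 ((cmod z)\<^sup>2 / (cmod (\<gamma> - w))\<^sup>2)) * exp (- \<alpha> * (cmod z)\<^sup>2)) \<partial>lborel) \<le> ennreal M"
    and A: "A \<in> sets borel" "emeasure lborel A = ennreal V" and V: "V > 0"
    and ball: "\<And>w. w \<in> P \<Longrightarrow> ball w \<rho> \<subseteq> A" and \<rho>: "\<rho> \<ge> 0"
    and n: "n \<ge> 1" and \<epsilon>: "exp (- 2 * \<rho>\<^sup>2 / 2 ^ n) \<le> \<epsilon>" "\<epsilon> \<le> 1"
    and C: "C \<ge> 0" "exp_mean (\<lambda>y. ennreal (1 / sqrt y)) \<le> ennreal C"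
  shows "pi * real (card P) * ((1 - \<epsilon>)\<^sup>2 / V) * (2 ^ n - 1 - real n) \<le>
     \<alpha> * (2 ^ n - 1) - real n * (ln (real n) + 3 - 2 * M / pi - 2 * C)"
proof -
  define m where "m = - ln (real n)"
  have m: "m \<le> 0" using n by (simp add: m_def)
  have em: "exp m = 1 / real n" using n by (simp add: m_def exp_minus inverse_eq_divide)
  define p where "p = real (card P)"
  have p: "p > 0" using P by (simp add: p_def card_gt_0_iff)
  define \<kappa> where "\<kappa> = (1 - \<epsilon>)\<^sup>2 / V"
  have \<kappa>: "\<kappa> \<ge> 0" using V by (simp add: \<kappa>_def)
  define G where "G = (\<lambda>w x. ennreal ((\<Prod>\<gamma>\<in>P - {w}. max 1 (x / (cmod (\<gamma> - w))\<^sup>2)) * exp (- \<alpha> * x)))"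
  have [measurable]: "G w \<in> borel_measurable borel" for w unfolding G_def by measurable
  have GM: "(\<integral>\<^sup>+x\<in>{0<..}. G w x \<partial>lborel) \<le> ennreal (M / pi)" if w: "w \<in> P" for w
  proof -
    have "ennreal pi * (\<integral>\<^sup>+x\<in>{0<..}. G w x \<partial>lborel) \<le> ennreal M"
      using E[OF w] nn_integral_radial[of "G w"] unfolding nn_integral_atLeast_greaterThan by (simp add: G_def)
    then have "ennreal (1 / pi) * (ennreal pi * (\<integral>\<^sup>+x\<in>{0<..}. G w x \<partial>lborel)) \<le> ennreal (1 / pi) * ennreal M"
      by (rule mult_left_mono) simp
    moreover have "ennreal (1 / pi) * (ennreal pi * I) = I" for I
      unfolding mult.assoc[symmetric] by (simp flip: ennreal_mult'')
    ultimately show ?thesis by (simp flip: ennreal_mult')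
  qed
  have step: "(\<Sum>k<n. ennreal (exp m) * (ennreal (3 - m) + (\<Sum>\<gamma>\<in>P. log_kernel (2 ^ k) ((cmod (\<gamma> - w))\<^sup>2))))
    \<le> ennreal (2 * (M / pi)) + ennreal (\<Sum>k<n. exp m * (\<alpha> * 2 ^ k + 2 * C))" if w: "w \<in> P" for w
  proof -
    have "(\<Sum>k<n. ennreal (exp m) * (ennreal (3 - m) + (\<Sum>\<gamma>\<in>P. log_kernel (2 ^ k) ((cmod (\<gamma> - w))\<^sup>2))))
      \<le> (\<Sum>k<n. (\<integral>\<^sup>+x\<in>{0<..}. G w x * ennreal (x / 2 ^ k * exp (- x / 2 ^ k)) \<partial>lborel) + ennreal (exp m * (\<alpha> * 2 ^ k + 2 * C)))"
      unfolding G_def by (intro sum_mono scale_energy \<alpha> P w m C) simp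
    also have "\<dots> = (\<Sum>k<n. (\<integral>\<^sup>+x\<in>{0<..}. G w x * ennreal (x / 2 ^ k * exp (- x / 2 ^ k)) \<partial>lborel)) + (\<Sum>k<n. ennreal (exp m * (\<alpha> * 2 ^ k + 2 * C)))"
      by (rule sum.distrib)
    also have "(\<Sum>k<n. (\<integral>\<^sup>+x\<in>{0<..}. G w x * ennreal (x / 2 ^ k * exp (- x / 2 ^ k)) \<partial>lborel)) = (\<integral>\<^sup>+x. (\<Sum>k<n. G w x * ennreal (x / 2 ^ k * exp (- x / 2 ^ k)) * indicator {0<..} x) \<partial>lborel)"
      by (rule nn_integral_sum[symmetric]) measurable
    also have "(\<Sum>k<n. ennreal (exp m * (\<alpha> * 2 ^ k + 2 * C))) = ennreal (\<Sum>k<n. exp m * (\<alpha> * 2 ^ k + 2 * C))"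
      using \<alpha> C by (intro sum_ennreal) simp
    also have "(\<integral>\<^sup>+x. (\<Sum>k<n. G w x * ennreal (x / 2 ^ k * exp (- x / 2 ^ k)) * indicator {0<..} x) \<partial>lborel) \<le> (\<integral>\<^sup>+x. ennreal 2 * (G w x * indicator {0<..} x) \<partial>lborel)"
    proof (rule nn_integral_mono)
      fix x :: real
      show "(\<Sum>k<n. G w x * ennreal (x / 2 ^ k * exp (- x / 2 ^ k)) * indicator {0<..} x) \<le> ennreal 2 * (G w x * indicator {0<..} x)"
      proof (cases "x > 0")
        case True
        have "(\<Sum>k<n. G w x * ennreal (x / 2 ^ k * exp (- x / 2 ^ k)) * indicator {0<..} x) = G w x * ennreal (\<Sum>k<n. x / 2 ^ k * exp (- x / 2 ^ k))"
          using True by (simp add: sum_distrib_left[symmetric])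
        also have "\<dots> \<le> G w x * ennreal 2"
          using True by (intro mult_left_mono ennreal_leI sum_dyadic_weights) auto
        finally show ?thesis using True by (simp add: mult.commute)
      qed simp
    qed
    also have "\<dots> = ennreal 2 * (\<integral>\<^sup>+x. G w x * indicator {0<..} x \<partial>lborel)"
      by (rule nn_integral_cmult) measurable
    also have "\<dots> \<le> ennreal 2 * ennreal (M / pi)" using GM[OF w] by (rule mult_left_mono) simp
    also have "\<dots> = ennreal (2 * (M / pi))" using M by (intro ennreal_mult'[symmetric]) simp
    finally show ?thesis by (simp add: add_right_mono)
  qed
  have "ennreal (\<Sum>k<n. exp m * (p * (3 - m) + pi * p\<^sup>2 * \<kappa> * (2 ^ k - 1))) = (\<Sum>k<n. ennreal (exp m) * (ennreal (p * (3 - m)) + ennreal (pi * p\<^sup>2 * \<kappa> * (2 ^ k - 1))))"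
    using m p \<kappa> by (simp flip: ennreal_plus ennreal_mult'')
  also have "\<dots> \<le> (\<Sum>k<n. ennreal (exp m) * (ennreal (p * (3 - m)) + (\<Sum>w\<in>P. \<Sum>\<gamma>\<in>P. log_kernel (2 ^ k) ((cmod (\<gamma> - w))\<^sup>2))))"
    unfolding p_def \<kappa>_def
    by (intro sum_mono mult_left_mono add_left_mono log_kernel_sum_lower_bound[OF P(1) A V ball _ _ \<rho> \<epsilon>]) (auto intro: power_increasing)
  also have "\<dots> = (\<Sum>w\<in>P. \<Sum>k<n. ennreal (exp m) * (ennreal (3 - m) + (\<Sum>\<gamma>\<in>P. log_kernel (2 ^ k) ((cmod (\<gamma> - w))\<^sup>2))))"
  proof -
    have eq: "ennreal (p * (3 - m)) = (\<Sum>w\<in>P. ennreal (3 - m))"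
      using m by (simp add: p_def ennreal_of_nat_eq_real_of_nat flip: ennreal_mult)
    have "(\<Sum>w\<in>P. \<Sum>k<n. ennreal (exp m) * (ennreal (3 - m) + (\<Sum>\<gamma>\<in>P. log_kernel (2 ^ k) ((cmod (\<gamma> - w))\<^sup>2)))) = (\<Sum>k<n. \<Sum>w\<in>P. ennreal (exp m) * (ennreal (3 - m) + (\<Sum>\<gamma>\<in>P. log_kernel (2 ^ k) ((cmod (\<gamma> - w))\<^sup>2))))"
      by (rule sum.swap)
    also have "\<dots> = (\<Sum>k<n. ennreal (exp m) * (ennreal (p * (3 - m)) + (\<Sum>w\<in>P. \<Sum>\<gamma>\<in>P. log_kernel (2 ^ k) ((cmod (\<gamma> - w))\<^sup>2))))"
      by (intro sum.cong refl) (simp only: sum_distrib_left[symmetric] sum.distrib eq)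
    finally show ?thesis ..
  qed
  also have "\<dots> \<le> (\<Sum>w\<in>P. ennreal (2 * (M / pi)) + ennreal (\<Sum>k<n. exp m * (\<alpha> * 2 ^ k + 2 * C)))"
    by (rule sum_mono) (rule step)
  also have "\<dots> = ennreal (p * (2 * (M / pi) + (\<Sum>k<n. exp m * (\<alpha> * 2 ^ k + 2 * C))))"
    using M \<alpha> C by (simp add: p_def ennreal_of_nat_eq_real_of_nat sum_nonneg flip: ennreal_plus ennreal_mult)
  finally have le: "(\<Sum>k<n. exp m * (p * (3 - m) + pi * p\<^sup>2 * \<kappa> * (2 ^ k - 1))) \<le> p * (2 * (M / pi) + (\<Sum>k<n. exp m * (\<alpha> * 2 ^ k + 2 * C)))"
    using M \<alpha> C p by (subst (asm) ennreal_le_iff) (auto intro!: mult_nonneg_nonneg add_nonneg_nonneg sum_nonneg)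
  have g: "(\<Sum>k<n. (2::real) ^ k) = 2 ^ n - 1" using sum_gp_strict[of "2::real" n] by simp
  have l: "(\<Sum>k<n. exp m * (p * (3 - m) + pi * p\<^sup>2 * \<kappa> * (2 ^ k - 1))) = p * exp m * (real n * (3 - m) + pi * p * \<kappa> * (2 ^ n - 1 - real n))"
    unfolding sum_distrib_left[symmetric] sum.distrib sum_subtractf g by (simp add: power2_eq_square algebra_simps)
  have r: "(\<Sum>k<n. exp m * (\<alpha> * 2 ^ k + 2 * C)) = exp m * (\<alpha> * (2 ^ n - 1) + real n * (2 * C))"
    unfolding sum_distrib_left[symmetric] sum.distrib g by simp
  have "p * (exp m * (real n * (3 - m) + pi * p * \<kappa> * (2 ^ n - 1 - real n))) \<le> p * (exp m * (2 * (M / pi) * real n + \<alpha> * (2 ^ n - 1) + real n * (2 * C)))"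
    using le n unfolding l r by (simp add: em algebra_simps add_divide_distrib)
  then have "real n * (3 - m) + pi * p * \<kappa> * (2 ^ n - 1 - real n) \<le> 2 * (M / pi) * real n + \<alpha> * (2 ^ n - 1) + real n * (2 * C)"
    using p by simp
  then show ?thesis by (simp add: p_def \<kappa>_def m_def algebra_simps)
qed

text \<open>Fix \<open>n\<close> so large that the gain \<open>ln n\<close> beats all constants; what is left over lowers the density by
  \<open>\<eta>\<close>. Then \<open>\<epsilon>\<close> and \<open>\<rho>\<close> are chosen so that the mass outside \<open>A\<close> does not use up \<open>\<eta>\<close>.\<close>
lemma interpolation_count_bound:
  assumes \<alpha>: "\<alpha> > 0" and I: "interpolation_set \<alpha> \<Gamma>"
  obtains \<beta> \<rho> where "0 \<le> \<beta>" "\<beta> < \<alpha>" "\<rho> > 0"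
    "\<And>P A V. finite P \<Longrightarrow> P \<subseteq> \<Gamma> \<Longrightarrow> A \<in> sets borel \<Longrightarrow> emeasure lborel A = ennreal V \<Longrightarrow> V > 0 \<Longrightarrow>
       (\<And>w. w \<in> P \<Longrightarrow> ball w \<rho> \<subseteq> A) \<Longrightarrow> pi * real (card P) \<le> \<beta> * V"
proof -
  obtain M where M: "M > 0" "\<And>P w. finite P \<Longrightarrow> P \<subseteq> \<Gamma> \<Longrightarrow> w \<in> P \<Longrightarrow>
     (\<integral>\<^sup>+z. ennreal ((\<Prod>\<gamma>\<in>P - {w}. max 1 ((cmod z)\<^sup>2 / (cmod (\<gamma> - w))\<^sup>2)) * exp (- \<alpha> * (cmod z)\<^sup>2)) \<partial>lborel) \<le> ennreal M"
    using interpolation_local_energy[OF \<alpha> I] by blast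
  obtain C where C: "C \<ge> 0" "exp_mean (\<lambda>y. ennreal (1 / sqrt y)) \<le> ennreal C"
    using exp_mean_inverse_sqrt by blast
  have "\<forall>\<^sub>F n in sequentially. ln (real n) > \<alpha> + 1 - 3 + 2 * M / pi + 2 * C"
    by (rule filterlim_at_top_dense[THEN iffD1, rule_format]) real_asymp
  then have "\<forall>\<^sub>F n in sequentially. ln (real n) > \<alpha> + 1 - 3 + 2 * M / pi + 2 * C \<and> n \<ge> 2"
    using eventually_ge_at_top[of 2] by eventually_elim blast
  then obtain n where n: "ln (real n) > \<alpha> + 1 - 3 + 2 * M / pi + 2 * C" "n \<ge> 2"
    using eventually_happens'[OF sequentially_bot] by blast
  define D where "D = (2::real) ^ n - 1 - real n"
  have D: "D > 0"
  proof -
    have "(2::nat) ^ n > 1 + n" using n(2) by (induction n rule: dec_induct) auto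
    then have "real (2 ^ n) > real (1 + n)" by (simp only: of_nat_less_iff)
    then show ?thesis by (simp add: D_def)
  qed
  \<comment> \<open>The energy inequality subtracts \<open>n (\<alpha> + 1)\<close>: the part \<open>\<alpha> n\<close> turns \<open>2 ^ n - 1\<close> into \<open>D\<close>, and \<open>n = \<eta> D\<close> is the gain.\<close>
  define \<eta> where "\<eta> = real n / D"
  have \<eta>: "\<eta> > 0" using D n by (simp add: \<eta>_def)
  define \<epsilon> where "\<epsilon> = min (1/2) (\<eta> / (4 * \<alpha>))"
  have \<epsilon>: "\<epsilon> > 0" "\<epsilon> \<le> 1/2" "4 * \<alpha> * \<epsilon> \<le> \<eta>"
    using \<eta> \<alpha> by (auto simp: \<epsilon>_def min_def field_simps)
  have e1: "(1 - \<epsilon>)\<^sup>2 > 0" using \<epsilon> by simp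
  define \<beta> where "\<beta> = max 0 ((\<alpha> - \<eta>) / (1 - \<epsilon>)\<^sup>2)"
  have \<beta>: "\<beta> < \<alpha>"
  proof -
    have "\<alpha> - \<eta> < \<alpha> * (1 - 2 * \<epsilon>)" using \<epsilon> \<eta> \<alpha> by (simp add: algebra_simps)
    also have "\<dots> \<le> \<alpha> * (1 - \<epsilon>)\<^sup>2" using \<alpha> by (intro mult_left_mono) (auto simp: power2_eq_square algebra_simps)
    finally show ?thesis using e1 \<alpha> by (simp add: \<beta>_def divide_less_eq)
  qed
  have "\<forall>\<^sub>F \<rho> in at_top. exp (- 2 * \<rho>\<^sup>2 / 2 ^ n) < \<epsilon>"
  proof (rule order_tendstoD(2))
    show "((\<lambda>\<rho>::real. exp (- 2 * \<rho>\<^sup>2 / 2 ^ n)) \<longlongrightarrow> 0) at_top" by real_asymp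
  qed (rule \<epsilon>)
  then have "\<forall>\<^sub>F \<rho> in at_top. exp (- 2 * \<rho>\<^sup>2 / 2 ^ n) < \<epsilon> \<and> \<rho> > 0"
    using eventually_gt_at_top[of 0] by eventually_elim blast
  then obtain \<rho> where \<rho>: "exp (- 2 * \<rho>\<^sup>2 / 2 ^ n) < \<epsilon>" "\<rho> > 0"
    using eventually_happens'[OF trivial_limit_at_top_linorder] by blast
  show thesis
  proof (rule that[OF _ \<beta> \<rho>(2)])
    show "0 \<le> \<beta>" by (simp add: \<beta>_def)
    fix P A V
    assume P: "finite P" "P \<subseteq> \<Gamma>" and A: "A \<in> sets borel" "emeasure lborel A = ennreal V" and V: "V > 0"
      and ball: "\<And>w. w \<in> P \<Longrightarrow> ball w \<rho> \<subseteq> A"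
    show "pi * real (card P) \<le> \<beta> * V"
    proof (cases "P = {}")
      case False
      have "pi * real (card P) * ((1 - \<epsilon>)\<^sup>2 / V) * (2 ^ n - 1 - real n) \<le>
        \<alpha> * (2 ^ n - 1) - real n * (ln (real n) + 3 - 2 * M / pi - 2 * C)"
        by (rule interpolation_energy_inequality[OF \<alpha> P(1) False M(1) M(2)[OF P] A V ball])
          (use \<rho> n \<epsilon> C in auto)
      also have "\<dots> \<le> \<alpha> * (2 ^ n - 1) - real n * (\<alpha> + 1)"
        using n by (intro diff_left_mono mult_left_mono) auto
      also have "\<dots> = (\<alpha> - \<eta>) * D" using D by (simp add: \<eta>_def D_def field_simps)
      finally have "pi * real (card P) * ((1 - \<epsilon>)\<^sup>2 / V) \<le> \<alpha> - \<eta>"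
        unfolding D_def[symmetric] by (rule mult_right_le_imp_le[OF _ D])
      then have "pi * real (card P) \<le> (\<alpha> - \<eta>) / (1 - \<epsilon>)\<^sup>2 * V"
        using e1 V by (simp add: field_simps)
      also have "\<dots> \<le> \<beta> * V" using V by (intro mult_right_mono) (auto simp: \<beta>_def)
      finally show ?thesis .
    qed (use V in \<open>simp add: \<beta>_def\<close>)
  qed
qed

text \<open>The area bound is applied to a dilate of an open set \<open>U\<close> that is slightly larger than \<open>I\<close>: for large
  \<open>r\<close> the dilate contains the balls of fixed radius about the points counted.\<close>
lemma interpolation_imp_density:
  assumes \<alpha>: "\<alpha> > 0" and I: "compact I" "emeasure lborel I = 1" and int: "interpolation_set \<alpha> \<Gamma>"
  shows "upper_uniform_density I \<Gamma> < ereal (\<alpha> / pi)"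
proof -
  obtain \<beta> \<rho> where \<beta>: "0 \<le> \<beta>" "\<beta> < \<alpha>" "\<rho> > 0"
    and cnt: "\<And>P A V. finite P \<Longrightarrow> P \<subseteq> \<Gamma> \<Longrightarrow> A \<in> sets borel \<Longrightarrow> emeasure lborel A = ennreal V \<Longrightarrow> V > 0 \<Longrightarrow>
       (\<And>w. w \<in> P \<Longrightarrow> ball w \<rho> \<subseteq> A) \<Longrightarrow> pi * real (card P) \<le> \<beta> * V"
    using interpolation_count_bound[OF \<alpha> int] by metis
  define \<delta> where "\<delta> = (\<alpha> - \<beta>) / (2 * \<alpha>)"
  have \<delta>: "\<delta> > 0" using \<alpha> \<beta> by (simp add: \<delta>_def)
  have Ib: "I \<in> sets borel" using I(1) by (rule borel_compact)
  obtain U where U: "open U" "I \<subseteq> U" "emeasure lborel (U - I) < ennreal \<delta>"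
    using outer_regular_lborel[OF Ib, of \<delta>] \<delta> by auto
  define v where "v = measure lborel U"
  have "emeasure lborel U = emeasure lborel I + emeasure lborel (U - I)"
    using U Ib by (subst plus_emeasure) (auto simp: Un_absorb1)
  then have Ule: "emeasure lborel U \<le> ennreal (1 + \<delta>)"
    using U(3) I(2) \<delta> by (simp add: ennreal_plus less_imp_le)
  then have Uv: "emeasure lborel U = ennreal v"
    unfolding v_def by (intro emeasure_eq_ennreal_measure) (auto simp: top_unique)
  have v: "1 \<le> v" "v \<le> 1 + \<delta>"
  proof -
    have "emeasure lborel I \<le> emeasure lborel U" using U by (intro emeasure_mono) auto
    then have "ennreal 1 \<le> ennreal v" using I by (simp add: Uv)
    then show "1 \<le> v" by (subst (asm) ennreal_le_iff) (simp_all add: v_def)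
    show "v \<le> 1 + \<delta>" using Ule \<delta> unfolding Uv by (subst (asm) ennreal_le_iff) auto
  qed
  obtain d where d: "d > 0" "(\<Union>x\<in>I. ball x d) \<subseteq> U"
    using compact_subset_open_imp_ball_epsilon_subset[OF I(1) U(1,2)] by blast
  define b where "b = \<beta> * v / pi"
  have bnd: "real (max_points I \<Gamma> r) \<le> b * r\<^sup>2" if r: "r > 0" "r \<ge> \<rho> / d" for r
  proof -
    define S where "S = (\<lambda>w. \<Gamma> \<inter> (\<lambda>z. w + of_real r * z) ` I)"
    have fin: "real (card P) \<le> b * r\<^sup>2" if P: "finite P" "P \<subseteq> S w" for P w
    proof -
      have "pi * real (card P) \<le> \<beta> * (r\<^sup>2 * v)"
      proof (rule cnt[of P "(\<lambda>z. w + of_real r * z) ` U"])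
        show "P \<subseteq> \<Gamma>" using P by (auto simp: S_def)
        have Ub: "U \<in> sets borel" using U(1) by (rule borel_open)
        have r0: "r \<noteq> 0" using r by simp
        show "(\<lambda>z. w + of_real r * z) ` U \<in> sets borel" by (rule emeasure_affine_image(1)[OF r0 Ub])
        show "emeasure lborel ((\<lambda>z. w + of_real r * z) ` U) = ennreal (r\<^sup>2 * v)"
          unfolding emeasure_affine_image(2)[OF r0 Ub] Uv using v by (simp add: ennreal_mult'')
        show "r\<^sup>2 * v > 0" using r v by simp
        fix x assume "x \<in> P"
        then obtain y where y: "y \<in> I" "x = w + of_real r * y" using P by (auto simp: S_def)
        show "ball x \<rho> \<subseteq> (\<lambda>z. w + of_real r * z) ` U"
        proof
          fix u assume u: "u \<in> ball x \<rho>"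
          define z where "z = (u - w) / of_real r"
          have uz: "u = w + of_real r * z" using r by (simp add: z_def)
          have "x - u = of_real r * (y - z)" by (simp add: y uz algebra_simps)
          then have "dist x u = r * dist y z" using r by (simp add: dist_norm norm_mult)
          then have "r * dist y z < \<rho>" using u by simp
          moreover have "\<rho> \<le> r * d" using r d by (simp add: field_simps)
          ultimately have "dist y z < d" using r by (metis less_le_trans mult_less_cancel_left_pos)
          then have "z \<in> ball y d" by simp
          then have "z \<in> U" using d(2) y(1) by blast
          then show "u \<in> (\<lambda>z. w + of_real r * z) ` U" using uz by blast
        qed
      qed (rule P)
      then show ?thesis by (simp add: b_def field_simps)
    qed
    obtain N :: nat where N: "b * r\<^sup>2 \<le> real N" using real_arch_simple by blast
    have fS: "finite (S w)" for w
    proof (rule ccontr)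
      assume "infinite (S w)"
      then obtain P where "finite P" "card P = Suc N" "P \<subseteq> S w" using infinite_arbitrarily_large by blast
      with fin[of P w] N show False by simp
    qed
    have cS: "real (card (S w)) \<le> b * r\<^sup>2" for w using fin[OF fS subset_refl] .
    have "card (S w) \<le> N" for w using cS[of w] N by linarith
    then have "range (\<lambda>w. card (S w)) \<subseteq> {..N}" by auto
    then have "finite (range (\<lambda>w. card (S w)))" by (rule finite_subset) simp
    then have "Max (range (\<lambda>w. card (S w))) \<in> range (\<lambda>w. card (S w))" by (intro Max_in) auto
    then show ?thesis using cS by (auto simp: max_points_def S_def)
  qed
  have "upper_uniform_density I \<Gamma> \<le> ereal b"
    unfolding upper_uniform_density_def
  proof (rule Limsup_bounded)
    show "\<forall>\<^sub>F r in at_top. ereal (real (max_points I \<Gamma> r) / r\<^sup>2) \<le> ereal b"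
      using eventually_gt_at_top[of 0] eventually_ge_at_top[of "\<rho> / d"]
      by eventually_elim (use bnd in \<open>simp add: divide_le_eq\<close>)
  qed
  also have "b < \<alpha> / pi"
  proof -
    have "\<beta> * v \<le> \<beta> * (1 + \<delta>)" using \<beta> v by (intro mult_left_mono) auto
    also have "\<dots> < \<alpha>" 
    proof -
      have "\<beta> * \<delta> < \<alpha> * \<delta>" using \<beta> \<delta> by simp
      also have "\<dots> = (\<alpha> - \<beta>) / 2" using \<alpha> by (simp add: \<delta>_def)
      finally show ?thesis using \<beta> by (simp add: algebra_simps)
    qed
    finally show ?thesis by (simp add: b_def divide_strict_right_mono)
  qed
  finally show ?thesis by simp
qed

section \<open>An entire function vanishing on the Gaussian integers\<close>

definition gauss_int :: "complex set" where
  "gauss_int = {z. Re z \<in> \<int> \<and> Im z \<in> \<int>}"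

definition nearest :: "complex \<Rightarrow> complex" where
  "nearest z = Complex (of_int (round (Re z))) (of_int (round (Im z)))"

lemma gauss_intE:
  assumes "\<mu> \<in> gauss_int"
  obtains m n :: int where "Re \<mu> = of_int m" "Im \<mu> = of_int n"
  using assms by (auto simp: gauss_int_def elim!: Ints_cases)

lemma nearest_in_gauss_int: "nearest z \<in> gauss_int"
  by (simp add: nearest_def gauss_int_def)

lemma gauss_int_diff: "\<mu> \<in> gauss_int \<Longrightarrow> \<nu> \<in> gauss_int \<Longrightarrow> \<mu> - \<nu> \<in> gauss_int"
  by (simp add: gauss_int_def)

lemma cmod_gauss_int_ge_1:
  assumes "\<mu> \<in> gauss_int" "\<mu> \<noteq> 0" shows "cmod \<mu> \<ge> 1"
proof -
  obtain m n :: int where mn: "Re \<mu> = of_int m" "Im \<mu> = of_int n"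
    using assms(1) by (rule gauss_intE)
  then have "m \<noteq> 0 \<or> n \<noteq> 0" using assms(2) by (auto simp: complex_eq_iff)
  then have "\<bar>Re \<mu>\<bar> \<ge> 1 \<or> \<bar>Im \<mu>\<bar> \<ge> 1" unfolding mn by linarith
  then show ?thesis using abs_Re_le_cmod[of \<mu>] abs_Im_le_cmod[of \<mu>] by linarith
qed

lemma cmod_minus_nearest: "cmod (z - nearest z) \<le> 3 / 4"
proof -
  have "\<bar>Re z - of_int (round (Re z))\<bar> \<le> 1/2" "\<bar>Im z - of_int (round (Im z))\<bar> \<le> 1/2"
    using of_int_round_abs_le[of "Re z"] of_int_round_abs_le[of "Im z"] by (simp_all add: abs_minus_commute)
  then have "(Re z - of_int (round (Re z)))\<^sup>2 \<le> (1/2)\<^sup>2" "(Im z - of_int (round (Im z)))\<^sup>2 \<le> (1/2)\<^sup>2"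
    by (metis abs_ge_zero power2_abs power_mono)+
  then have "(cmod (z - nearest z))\<^sup>2 \<le> (3/4)\<^sup>2"
    unfolding cmod_power2 nearest_def by (simp add: power2_eq_square)
  then show ?thesis by (rule power2_le_imp_le) simp
qed

lemma nearest_minimal:
  assumes "\<mu> \<in> gauss_int" shows "cmod (z - nearest z) \<le> cmod (z - \<mu>)"
proof -
  obtain m n :: int where mn: "Re \<mu> = of_int m" "Im \<mu> = of_int n"
    using assms(1) by (rule gauss_intE)
  have "(Re z - of_int (round (Re z)))\<^sup>2 \<le> (Re z - Re \<mu>)\<^sup>2" "(Im z - of_int (round (Im z)))\<^sup>2 \<le> (Im z - Im \<mu>)\<^sup>2"
    unfolding mn abs_le_square_iff[symmetric] by (rule round_diff_minimal)+
  then have "(cmod (z - nearest z))\<^sup>2 \<le> (cmod (z - \<mu>))\<^sup>2"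
    unfolding cmod_power2 nearest_def by simp
  then show ?thesis by (rule power2_le_imp_le) simp
qed

text \<open>The double series is dominated by a product of two convergent series in one variable, because
  \<open>(1 + |Re \<mu>|) (1 + |Im \<mu>|) \<le> 4 |\<mu>|\<^sup>2\<close> on nonzero lattice points. The exponent \<open>5/2\<close> lies between \<open>2\<close>, where the
  sum diverges, and \<open>3\<close>, the decay of the far terms below.\<close>
lemma gauss_int_sum_bound:
  "\<exists>K\<ge>0. \<forall>F. finite F \<longrightarrow> F \<subseteq> gauss_int - {0} \<longrightarrow> (\<Sum>\<mu>\<in>F. 1 / ((cmod \<mu>)\<^sup>2 * sqrt (cmod \<mu>))) \<le> K"
proof -
  define w where "w = (\<lambda>x::real. (1 + \<bar>x\<bar>) powr (-5/4))"
  have w0: "w x \<ge> 0" for x by (simp add: w_def)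
  have "summable (\<lambda>n. real (Suc n) powr (-5/4))"
    by (rule summable_Suc_iff[THEN iffD2]) (simp add: summable_real_powr_iff)
  then have sw: "summable (\<lambda>n. w (real n))" by (simp add: w_def add.commute)
  define S where "S = (\<Sum>n. w (real n))"
  have S0: "S \<ge> 0" unfolding S_def by (rule suminf_nonneg[OF sw w0])
  have ws: "(\<Sum>m\<in>{-int M..int M}. w (of_int m)) \<le> 2 * S" for M
  proof -
    have sub: "{-int M..int M} \<subseteq> int ` {..M} \<union> (\<lambda>n. - int n) ` {..M}"
    proof
      fix m assume "m \<in> {-int M..int M}"
      then have "(m = int (nat m) \<and> nat m \<le> M) \<or> (m = - int (nat (-m)) \<and> nat (-m) \<le> M)" by auto
      then show "m \<in> int ` {..M} \<union> (\<lambda>n. - int n) ` {..M}" by blast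
    qed
    have "(\<Sum>m\<in>{-int M..int M}. w (of_int m)) \<le> (\<Sum>m\<in>int ` {..M} \<union> (\<lambda>n. - int n) ` {..M}. w (of_int m))"
      by (rule sum_mono2[OF _ sub]) (auto simp: w0)
    also have "\<dots> \<le> (\<Sum>m\<in>int ` {..M}. w (of_int m)) + (\<Sum>m\<in>(\<lambda>n. - int n) ` {..M}. w (of_int m))"
      by (subst sum_Un) (auto intro!: sum_nonneg simp: w0)
    also have "\<dots> = (\<Sum>n\<le>M. w (real n)) + (\<Sum>n\<le>M. w (real n))"
      by (simp add: sum.reindex inj_on_def w_def)
    also have "(\<Sum>n\<le>M. w (real n)) \<le> S" unfolding S_def by (rule sum_le_suminf[OF sw]) (auto simp: w0)
    finally show ?thesis by simp
  qed
  define c where "c = (4::real) powr (5/4)"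
  have pt: "1 / ((cmod \<mu>)\<^sup>2 * sqrt (cmod \<mu>)) \<le> c * (w (Re \<mu>) * w (Im \<mu>))" if \<mu>: "\<mu> \<in> gauss_int - {0}" for \<mu>
  proof -
    define l where "l = cmod \<mu>"
    have l: "l \<ge> 1" using cmod_gauss_int_ge_1 \<mu> by (auto simp: l_def)
    have "1 + \<bar>Re \<mu>\<bar> \<le> 2 * l" "1 + \<bar>Im \<mu>\<bar> \<le> 2 * l"
      using l abs_Re_le_cmod[of \<mu>] abs_Im_le_cmod[of \<mu>] by (auto simp: l_def)
    then have "(1 + \<bar>Re \<mu>\<bar>) * (1 + \<bar>Im \<mu>\<bar>) \<le> (2 * l) * (2 * l)" by (intro mult_mono) auto
    then have "(1 + \<bar>Re \<mu>\<bar>) * (1 + \<bar>Im \<mu>\<bar>) \<le> 4 * l\<^sup>2" by (simp add: power2_eq_square)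
    then have "((1 + \<bar>Re \<mu>\<bar>) * (1 + \<bar>Im \<mu>\<bar>)) powr (5/4) \<le> (4 * l\<^sup>2) powr (5/4)"
      by (intro powr_mono2) auto
    also have "\<dots> = c * (l\<^sup>2 * sqrt l)"
    proof -
      have "(l\<^sup>2) powr (5/4) = l powr (2 * (5/4))"
        using l by (simp add: powr_powr flip: powr_numeral)
      also have "\<dots> = l powr 2 * l powr (1/2)" by (subst powr_add[symmetric]) simp
      also have "\<dots> = l\<^sup>2 * sqrt l" using l by (simp add: powr_half_sqrt)
      finally show ?thesis by (simp add: powr_mult c_def)
    qed
    finally have *: "((1 + \<bar>Re \<mu>\<bar>) * (1 + \<bar>Im \<mu>\<bar>)) powr (5/4) \<le> c * (l\<^sup>2 * sqrt l)" .
    have ww: "w (Re \<mu>) * w (Im \<mu>) = 1 / ((1 + \<bar>Re \<mu>\<bar>) * (1 + \<bar>Im \<mu>\<bar>)) powr (5/4)"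
      by (simp add: w_def powr_mult powr_minus divide_simps)
    have "l\<^sup>2 * sqrt l > 0" "((1 + \<bar>Re \<mu>\<bar>) * (1 + \<bar>Im \<mu>\<bar>)) powr (5/4) > 0" using l by auto
    then show ?thesis using * unfolding ww l_def[symmetric] by (simp add: field_simps)
  qed
  show ?thesis
  proof (intro exI[of _ "c * ((2 * S) * (2 * S))"] conjI allI impI)
    show "0 \<le> c * ((2 * S) * (2 * S))" using S0 by (simp add: c_def)
    fix F :: "complex set" assume F: "finite F" "F \<subseteq> gauss_int - {0}"
    obtain B where B: "\<And>\<mu>. \<mu> \<in> F \<Longrightarrow> cmod \<mu> \<le> B"
      using finite_imp_bounded[OF F(1)] by (auto simp: bounded_iff)
    obtain M :: nat where M: "B \<le> real M" using real_arch_simple by blast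
    define I where "I = {-int M..int M}"
    have sub: "F \<subseteq> (\<lambda>(m, n). Complex (of_int m) (of_int n)) ` (I \<times> I)"
    proof
      fix \<mu> assume \<mu>: "\<mu> \<in> F"
      then obtain m n :: int where mn: "Re \<mu> = of_int m" "Im \<mu> = of_int n"
        using F(2) gauss_intE[of \<mu>] by blast
      have "\<bar>real_of_int m\<bar> \<le> real M" "\<bar>real_of_int n\<bar> \<le> real M"
        using abs_Re_le_cmod[of \<mu>] abs_Im_le_cmod[of \<mu>] B[OF \<mu>] M by (auto simp: mn)
      then have "m \<in> I" "n \<in> I" by (auto simp: I_def abs_le_iff)
      moreover have "\<mu> = Complex (of_int m) (of_int n)" by (simp add: complex_eq_iff mn)
      ultimately show "\<mu> \<in> (\<lambda>(m, n). Complex (of_int m) (of_int n)) ` (I \<times> I)" by auto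
    qed
    have "(\<Sum>\<mu>\<in>F. 1 / ((cmod \<mu>)\<^sup>2 * sqrt (cmod \<mu>))) \<le> (\<Sum>\<mu>\<in>F. c * (w (Re \<mu>) * w (Im \<mu>)))"
      using F(2) by (intro sum_mono pt) auto
    also have "\<dots> \<le> (\<Sum>\<mu>\<in>(\<lambda>(m, n). Complex (of_int m) (of_int n)) ` (I \<times> I). c * (w (Re \<mu>) * w (Im \<mu>)))"
      by (rule sum_mono2) (use sub w0 in \<open>auto simp: I_def c_def\<close>)
    also have "\<dots> = (\<Sum>(m, n)\<in>I \<times> I. c * (w (of_int m) * w (of_int n)))"
      by (subst sum.reindex) (auto simp: inj_on_def intro!: sum.cong)
    also have "\<dots> = c * ((\<Sum>m\<in>I. w (of_int m)) * (\<Sum>n\<in>I. w (of_int n)))"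
      unfolding sum_product sum.cartesian_product[symmetric] by (simp only: sum_distrib_left)
    also have "\<dots> \<le> c * ((2 * S) * (2 * S))"
      using ws[of M] S0 by (intro mult_left_mono mult_mono) (auto simp: I_def c_def intro!: sum_nonneg w0)
    finally show "(\<Sum>\<mu>\<in>F. 1 / ((cmod \<mu>)\<^sup>2 * sqrt (cmod \<mu>))) \<le> c * ((2 * S) * (2 * S))" .
  qed
qed

text \<open>A partial product of a theta function: the \<open>k\<close>th factor is
  \<open>sin (\<pi> (z - \<i> k)) sin (\<pi> (z + \<i> k)) / sinh\<^sup>2 (\<pi> k)\<close>, and the Gaussian factor makes the growth radial. Only the lattice points with
  \<open>|Im| \<le> K\<close> are zeros, so the bounds have to be uniform in \<open>K\<close>.\<close>
definition lattice_sine :: "nat \<Rightarrow> complex \<Rightarrow> complex" where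
  "lattice_sine K z = exp (of_real pi * z\<^sup>2 / 2) * (sin (of_real pi * z) *
     (\<Prod>k=1..K. 1 + (sin (of_real pi * z))\<^sup>2 / of_real ((sinh (pi * real k))\<^sup>2)))"

lemma holomorphic_lattice_sine: "lattice_sine K holomorphic_on UNIV"
  unfolding lattice_sine_def[abs_def] by (intro holomorphic_intros) auto

lemma deriv_lattice_sine: "(lattice_sine K has_field_derivative of_real pi) (at 0)"
proof -
  define R :: "complex \<Rightarrow> complex" where "R = (\<lambda>z. exp (of_real pi * z\<^sup>2 / 2) * (\<Prod>k=1..K. 1 + (sin (of_real pi * z))\<^sup>2 / of_real ((sinh (pi * real k))\<^sup>2)))"
  have "R holomorphic_on UNIV" unfolding R_def by (intro holomorphic_intros) auto
  then have "(R has_field_derivative deriv R 0) (at 0)"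
    by (rule holomorphic_derivI) auto
  then have "((\<lambda>z. sin (of_real pi * z) * R z) has_field_derivative (of_real pi * cos (of_real pi * 0) * R 0 + deriv R 0 * sin (of_real pi * 0))) (at 0)"
    by (intro derivative_eq_intros refl | simp)+
  moreover have "(\<lambda>z. sin (of_real pi * z) * R z) = lattice_sine K"
    by (simp add: fun_eq_iff R_def lattice_sine_def)
  moreover have "R 0 = 1" by (simp add: R_def)
  ultimately show ?thesis by simp
qed

lemma lattice_sine_zero:
  assumes \<mu>: "\<mu> \<in> gauss_int" "\<bar>Im \<mu>\<bar> \<le> real K"
  shows "lattice_sine K \<mu> = 0"
proof -
  obtain m n :: int where mn: "Re \<mu> = of_int m" "Im \<mu> = of_int n"
    using assms(1) by (rule gauss_intE)
  have \<mu>': "of_real pi * \<mu> = of_real (pi * of_int m) + \<i> * of_real (pi * of_int n)"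
    using mn by (simp add: complex_eq_iff)
  have s0: "sin (complex_of_real (pi * of_int m)) = 0"
    unfolding sin_of_real by simp
  have c1: "(cos (complex_of_real (pi * of_int m)))\<^sup>2 = 1"
    unfolding cos_of_real by (simp add: cos_npi_int flip: of_real_power)
  have ss: "(sin (of_real pi * \<mu>))\<^sup>2 = - of_real ((sinh (pi * of_int n))\<^sup>2)"
  proof -
    have "sin (of_real pi * \<mu>) = cos (complex_of_real (pi * of_int m)) * sin (\<i> * of_real (pi * of_int n))"
      unfolding \<mu>' sin_add s0 by simp
    also have "sin (\<i> * complex_of_real (pi * of_int n)) = \<i> * of_real (sinh (pi * of_int n))"
    proof -
      have "sin (\<i> * complex_of_real y) = \<i> * of_real (sinh y)" for y
      proof -
        have "\<i> * (\<i> * complex_of_real y) = of_real (- y)" by simp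
        then have "sin (\<i> * complex_of_real y) = (exp (of_real (- y)) - exp (of_real y)) / (2 * \<i>)"
          unfolding sin_exp_eq by (simp add: mult.assoc[symmetric])
        moreover have "(a - b) / (2 * \<i>) = \<i> * ((b - a) / 2)" for a b :: complex
          by (simp add: field_simps)
        ultimately show ?thesis unfolding exp_of_real sinh_field_def by simp
      qed
      then show ?thesis .
    qed
    finally show ?thesis by (simp only: power_mult_distrib c1) (simp add: power_mult_distrib)
  qed
  show ?thesis
  proof (cases "n = 0")
    case True
    then have "sin (of_real pi * \<mu>) = 0" using ss by simp
    then show ?thesis by (simp add: lattice_sine_def)
  next
    case False
    define k where "k = nat \<bar>n\<bar>"
    have k: "k \<in> {1..K}" using False \<mu>(2) mn by (auto simp: k_def)
    have "(sinh (pi * real k))\<^sup>2 = (sinh (pi * of_int n))\<^sup>2"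
      by (cases "n \<ge> 0") (simp_all add: k_def)
    moreover have "sinh (pi * real_of_int n) \<noteq> 0" using False by simp
    ultimately have "1 + (sin (of_real pi * \<mu>))\<^sup>2 / of_real ((sinh (pi * real k))\<^sup>2) = 0"
      unfolding ss by simp
    then have "(\<Prod>k=1..K. 1 + (sin (of_real pi * \<mu>))\<^sup>2 / of_real ((sinh (pi * real k))\<^sup>2)) = 0"
      using k by (intro prod_zero) auto
    then show ?thesis by (simp add: lattice_sine_def)
  qed
qed

lemma cmod_sin_le_exp: "cmod (sin z) \<le> exp \<bar>Im z\<bar>"
proof -
  have "cmod (sin z) = cmod (exp (\<i> * z) - exp (- (\<i> * z))) / 2"
    by (simp add: sin_exp_eq norm_divide norm_mult)
  also have "\<dots> \<le> (cmod (exp (\<i> * z)) + cmod (exp (- (\<i> * z)))) / 2"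
    by (intro divide_right_mono norm_triangle_ineq4) simp
  also have "\<dots> = (exp (- Im z) + exp (Im z)) / 2" by simp
  also have "\<dots> \<le> (exp \<bar>Im z\<bar> + exp \<bar>Im z\<bar>) / 2" by (intro divide_right_mono add_mono) auto
  finally show ?thesis by simp
qed

text \<open>Put \<open>Y = |Im z|\<close>. The \<open>k\<close>th factor is at most \<open>1 + 16 exp (2 \<pi> (Y - k))\<close>; the product of the large ones, those with
  \<open>k \<le> Y\<close>, is \<open>exp (\<pi> Y\<^sup>2 + O (Y))\<close>, and the other ones contribute a constant. The Gaussian factor turns \<open>\<pi> Y\<^sup>2\<close> into
  \<open>\<pi> |z|\<^sup>2 / 2\<close>.\<close>
lemma lattice_sine_bound:
  "cmod (lattice_sine K z) \<le> exp (pi / 2 * (cmod z)\<^sup>2 + 14 * cmod z + 30)"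
proof -
  define Y where "Y = \<bar>Im z\<bar>"
  define N where "N = nat \<lceil>Y\<rceil>"
  have N: "Y \<le> real N" "real N \<le> Y + 1" by (auto simp: N_def Y_def)
  define F where "F = (\<lambda>k. 1 + 16 * exp (2 * pi * (real N - real k)))"
  have F1: "F k \<ge> 1" for k by (simp add: F_def)
  have sinh: "sinh (pi * real k) \<ge> exp (pi * real k) / 4" if "k \<ge> 1" for k
  proof -
    have "1 * 1 \<le> pi * real k" using that pi_gt3 by (intro mult_mono) auto
    then have "1 \<le> pi * real k" by simp
    then have "2 \<le> exp (pi * real k)" using exp_ge_add_one_self[of "pi * real k"] by linarith
    moreover have "exp (- (pi * real k)) \<le> 1" by simp
    moreover have "a / 4 \<le> (a - b) / 2" if "2 \<le> a" "b \<le> 1" for a b :: real using that by (simp add: field_simps)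
    ultimately show ?thesis unfolding sinh_field_def by blast
  qed
  have "cmod (1 + (sin (of_real pi * z))\<^sup>2 / of_real ((sinh (pi * real k))\<^sup>2)) \<le> F k" if k: "k \<in> {1..K}" for k
  proof -
    have "cmod ((sin (of_real pi * z))\<^sup>2 / of_real ((sinh (pi * real k))\<^sup>2)) = (cmod (sin (of_real pi * z)))\<^sup>2 / (sinh (pi * real k))\<^sup>2"
      by (simp add: norm_divide norm_power)
    also have "\<dots> \<le> (exp (pi * real N))\<^sup>2 / (exp (pi * real k) / 4)\<^sup>2"
    proof (intro frac_le power_mono)
      have "cmod (sin (of_real pi * z)) \<le> exp (pi * Y)"
        using cmod_sin_le_exp[of "of_real pi * z"] by (simp add: Y_def abs_mult)
      also have "\<dots> \<le> exp (pi * real N)" using N by simp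
      finally show "cmod (sin (of_real pi * z)) \<le> exp (pi * real N)" .
    qed (use sinh k in auto)
    also have "\<dots> = 16 * exp (2 * pi * (real N - real k))"
      by (simp add: power_divide right_diff_distrib exp_diff flip: exp_of_nat_mult) (simp add: mult_ac)
    finally show ?thesis unfolding F_def using norm_triangle_ineq[of 1 "(sin (of_real pi * z))\<^sup>2 / of_real ((sinh (pi * real k))\<^sup>2)"]
      by simp
  qed
  then have "cmod (\<Prod>k=1..K. 1 + (sin (of_real pi * z))\<^sup>2 / of_real ((sinh (pi * real k))\<^sup>2)) \<le> (\<Prod>k=1..K. F k)"
    unfolding prod_norm[symmetric] by (intro prod_mono) auto
  also have "\<dots> \<le> (\<Prod>k\<in>{1..N} \<union> {N+1..N+K}. F k)"
    by (rule prod_mono2) (use F1 in \<open>auto intro: order_trans[OF zero_le_one]\<close>)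
  also have "\<dots> = (\<Prod>k\<in>{1..N}. F k) * (\<Prod>k\<in>{N+1..N+K}. F k)"
    by (rule prod.union_disjoint) auto
  also have "\<dots> \<le> exp (pi * Y\<^sup>2 + 9 * Y + 5) * exp 16"
  proof (intro mult_mono)
    have "(\<Prod>k\<in>{1..N}. F k) \<le> (\<Prod>k\<in>{1..N}. exp (5 + 2 * pi * (real N - real k)))"
    proof (rule prod_mono)
      fix k assume k: "k \<in> {1..N}"
      have e5: "17 \<le> exp (5::real)"
      proof -
        have "(2::real) \<le> exp 1" using exp_ge_add_one_self[of 1] by simp
        then have "(2::real) ^ 5 \<le> exp 1 ^ 5" by (rule power_mono) simp
        also have "exp (1::real) ^ 5 = exp 5" by (simp flip: exp_of_nat_mult)
        finally show ?thesis by simp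
      qed
      have "0 \<le> 2 * pi * (real N - real k)" using k by simp
      then have "1 \<le> exp (2 * pi * (real N - real k))" by simp
      then have "F k \<le> 17 * exp (2 * pi * (real N - real k))" unfolding F_def by simp
      also have "\<dots> \<le> exp 5 * exp (2 * pi * (real N - real k))" using e5 by (rule mult_right_mono) simp
      finally show "0 \<le> F k \<and> F k \<le> exp (5 + 2 * pi * (real N - real k))"
        using F1[of k] by (simp add: exp_add)
    qed
    also have "\<dots> = exp (\<Sum>k\<in>{1..N}. 5 + 2 * pi * (real N - real k))" by (simp add: exp_sum)
    also have "(\<Sum>k\<in>{1..N}. 5 + 2 * pi * (real N - real k)) = 5 * real N + pi * (real N * (real N - 1))"
    proof -
      have "(\<Sum>k\<in>{1..N}. real k) = real N * (real N + 1) / 2" by (induction N) (auto simp: field_simps)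
      then have "(\<Sum>k\<in>{1..N}. real N - real k) = real N * (real N - 1) / 2"
        by (simp add: sum_subtractf field_simps)
      then show ?thesis by (simp add: sum.distrib flip: sum_distrib_left)
    qed
    also have "\<dots> \<le> 5 * (Y + 1) + pi * ((Y + 1) * Y)"
    proof -
      have "real N * (real N - 1) \<le> (Y + 1) * Y"
      proof (cases "N = 0")
        case False
        then show ?thesis using N by (intro mult_mono) (auto simp: Y_def)
      qed (simp add: Y_def)
      then show ?thesis using N by (intro add_mono mult_left_mono) auto
    qed
    also have "\<dots> \<le> pi * Y\<^sup>2 + 9 * Y + 5"
    proof -
      have "pi * Y \<le> 4 * Y" using pi_less_4 by (intro mult_right_mono) (auto simp: Y_def)
      then show ?thesis by (simp add: power2_eq_square algebra_simps)
    qed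
    finally show "(\<Prod>k\<in>{1..N}. F k) \<le> exp (pi * Y\<^sup>2 + 9 * Y + 5)" by simp
    have "(\<Prod>k\<in>{N+1..N+K}. F k) \<le> (\<Prod>k\<in>{N+1..N+K}. exp (16 * (1/2) ^ (k - N)))"
    proof (rule prod_mono)
      fix k assume k: "k \<in> {N+1..N+K}"
      define j where "j = k - N"
      have kj: "real N - real k = - real j" using k by (simp add: j_def)
      have "2 * exp (- (2 * pi)) \<le> (1::real)"
      proof -
        have "2 \<le> 1 + 2 * pi" using pi_gt3 by simp
        also have "\<dots> \<le> exp (2 * pi)" by (rule exp_ge_add_one_self)
        finally show ?thesis by (simp add: exp_minus field_simps)
      qed
      then have "exp (- (2 * pi)) ^ j \<le> (1/2) ^ j" by (intro power_mono) auto
      moreover have "exp (2 * pi * (real N - real k)) = exp (- (2 * pi)) ^ j"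
        unfolding kj by (simp add: mult_ac flip: exp_of_nat_mult)
      ultimately have "F k \<le> 1 + 16 * (1/2) ^ j" unfolding F_def by simp
      also have "\<dots> \<le> exp (16 * (1/2) ^ j)" by (rule exp_ge_add_one_self)
      finally show "0 \<le> F k \<and> F k \<le> exp (16 * (1/2) ^ (k - N))"
        using F1[of k] by (simp add: j_def)
    qed
    also have "\<dots> = exp (16 * (\<Sum>k\<in>{N+1..N+K}. (1/2) ^ (k - N)))" by (simp add: exp_sum sum_distrib_left)
    also have "(\<Sum>k\<in>{N+1..N+K}. (1/2) ^ (k - N)) \<le> (1::real)"
    proof -
      have "(\<Sum>k\<in>{N+1..N+K}. (1/2) ^ (k - N)) = 1 - (1/2::real) ^ K" by (induction K) (auto simp: field_simps)
      then show ?thesis by simp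
    qed
    finally show "(\<Prod>k\<in>{N+1..N+K}. F k) \<le> exp 16" by simp
  qed (auto intro!: prod_nonneg intro: order_trans[OF zero_le_one F1])
  finally have prod: "cmod (\<Prod>k=1..K. 1 + (sin (of_real pi * z))\<^sup>2 / of_real ((sinh (pi * real k))\<^sup>2)) \<le> exp (pi * Y\<^sup>2 + 9 * Y + 5) * exp 16" .
  have "cmod (lattice_sine K z) = exp (pi * ((Re z)\<^sup>2 - Y\<^sup>2) / 2) * (cmod (sin (of_real pi * z)) *
     cmod (\<Prod>k=1..K. 1 + (sin (of_real pi * z))\<^sup>2 / of_real ((sinh (pi * real k))\<^sup>2)))"
    unfolding lattice_sine_def norm_mult by (simp add: power2_eq_square Y_def)
  also have "\<dots> \<le> exp (pi * ((Re z)\<^sup>2 - Y\<^sup>2) / 2) * (exp (pi * Y) * (exp (pi * Y\<^sup>2 + 9 * Y + 5) * exp 16))"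
    using prod cmod_sin_le_exp[of "of_real pi * z"] by (intro mult_left_mono mult_mono) (auto simp: Y_def abs_mult)
  also have "\<dots> = exp (pi * ((Re z)\<^sup>2 - Y\<^sup>2) / 2 + (pi * Y + (pi * Y\<^sup>2 + 9 * Y + 5 + 16)))"
    by (simp only: exp_add)
  also have "\<dots> \<le> exp (pi / 2 * (cmod z)\<^sup>2 + 14 * cmod z + 30)"
  proof -
    have "pi * Y \<le> 4 * Y" using pi_less_4 by (intro mult_right_mono) (auto simp: Y_def)
    moreover have "Y \<le> cmod z" using abs_Im_le_cmod by (simp add: Y_def)
    moreover have "pi * ((Re z)\<^sup>2 - Y\<^sup>2) / 2 + pi * Y\<^sup>2 = pi / 2 * (cmod z)\<^sup>2"
      by (simp add: cmod_power2 Y_def field_simps)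
    moreover have "a + (p + (b + 9 * y + 5 + 16)) \<le> c + 14 * d + 30"
      if "p \<le> 4 * y" "y \<le> d" "a + b = c" "0 \<le> d" for a b c d p y :: real using that by linarith
    ultimately show ?thesis unfolding exp_le_cancel_iff using norm_ge_zero[of z] by blast
  qed
  finally show ?thesis .
qed

section \<open>Moving a zero within its cell\<close>

lemma cmod_one_minus_le_exp: "cmod (1 - w) \<le> exp (- Re w + (cmod w)\<^sup>2 / 2)"
proof (rule power2_le_imp_le)
  have "(cmod (1 - w))\<^sup>2 = 1 + (- 2 * Re w + (cmod w)\<^sup>2)"
    unfolding cmod_power2 by (simp add: power2_eq_square algebra_simps)
  also have "\<dots> \<le> exp (- 2 * Re w + (cmod w)\<^sup>2)" by (rule exp_ge_add_one_self)
  also have "\<dots> = (exp (- Re w + (cmod w)\<^sup>2 / 2))\<^sup>2" by (simp flip: exp_of_nat_mult)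
  finally show "(cmod (1 - w))\<^sup>2 \<le> (exp (- Re w + (cmod w)\<^sup>2 / 2))\<^sup>2" .
qed simp

text \<open>Write \<open>1 - u = (1 - v) (1 - w)\<close> with \<open>w = (u - v) / (1 - v)\<close>. The exponential factor \<open>exp (u - v)\<close> cancels
  the first order of \<open>1 - w\<close> up to a term of order \<open>v\<close>.\<close>
lemma primary_factor_ratio:
  assumes v: "cmod v \<le> 1 / 4"
  shows "cmod ((1 - u) * exp (u - v)) \<le> cmod (1 - v) * exp (2 * cmod (u - v) * (cmod v + cmod (u - v)))"
proof -
  define \<delta> where "\<delta> = u - v"
  have v1: "cmod (1 - v) \<ge> 1 / 2" using v norm_triangle_ineq2[of 1 v] by simp
  then have v0: "1 - v \<noteq> 0" by auto
  define w where "w = \<delta> / (1 - v)"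
  have uv: "1 - u = (1 - v) * (1 - w)" using v0 by (simp add: w_def \<delta>_def field_simps)
  have wle: "cmod w \<le> 2 * cmod \<delta>"
  proof -
    have "cmod \<delta> / cmod (1 - v) \<le> cmod \<delta> / (1 / 2)" using v1 by (intro divide_left_mono) auto
    then show ?thesis by (simp add: w_def norm_divide)
  qed
  have "\<delta> - w = - (w * v)" using v0 by (simp add: w_def field_simps)
  then have "cmod (\<delta> - w) = cmod w * cmod v" by (simp add: norm_mult)
  then have "Re \<delta> - Re w \<le> cmod w * cmod v"
    using complex_Re_le_cmod[of "\<delta> - w"] by simp
  also have "\<dots> \<le> 2 * cmod \<delta> * cmod v" using wle by (rule mult_right_mono) simp
  finally have 1: "Re \<delta> - Re w \<le> 2 * cmod \<delta> * cmod v" .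
  have "(cmod w)\<^sup>2 \<le> (2 * cmod \<delta>)\<^sup>2" using wle by (rule power_mono) simp
  then have 2: "(cmod w)\<^sup>2 / 2 \<le> 2 * cmod \<delta> * cmod \<delta>" by (simp add: power2_eq_square)
  have "cmod ((1 - u) * exp (u - v)) = cmod (1 - v) * (cmod (1 - w) * exp (Re \<delta>))"
    unfolding uv by (simp add: norm_mult \<delta>_def)
  also have "\<dots> \<le> cmod (1 - v) * (exp (- Re w + (cmod w)\<^sup>2 / 2) * exp (Re \<delta>))"
    by (intro mult_left_mono mult_right_mono cmod_one_minus_le_exp) auto
  also have "\<dots> = cmod (1 - v) * exp (Re \<delta> - Re w + (cmod w)\<^sup>2 / 2)"
    by (simp add: algebra_simps flip: exp_add)
  also have "\<dots> \<le> cmod (1 - v) * exp (2 * cmod \<delta> * cmod v + 2 * cmod \<delta> * cmod \<delta>)"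
    using 1 2 by (intro mult_left_mono) auto
  finally show ?thesis by (simp add: \<delta>_def distrib_left)
qed

definition cell_weight :: "complex \<Rightarrow> real" where
  "cell_weight \<mu> = 1 / ((cmod \<mu>)\<^sup>2 * sqrt (cmod \<mu>))"

text \<open>Crude bounds for the three factors separately; enough for the zeros \<open>\<nu>\<close> of modulus at most a multiple of
  \<open>|z|\<close>.\<close>
lemma moved_zero_near:
  assumes \<nu>: "cmod \<nu> \<ge> 1" and \<gamma>: "cmod (\<gamma> - \<nu>) \<le> 3 / 4"
    and c: "cmod (\<gamma> - z) \<le> cmod (\<nu> - z) * exp c"
  shows "cmod (\<nu> * (1 - z / \<gamma>) * exp (z / \<gamma> - z / \<nu>)) \<le> cmod (z - \<nu>) * exp (c + 3 / cmod \<nu> + 3 * cmod z / (cmod \<nu>)\<^sup>2)"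
proof -
  define l where "l = cmod \<nu>"
  have g: "cmod \<gamma> \<ge> l / 4" using \<nu> \<gamma> norm_triangle_ineq2[of \<nu> "\<nu> - \<gamma>"] by (simp add: l_def norm_minus_commute)
  have l: "l \<ge> 1" using \<nu> by (simp add: l_def)
  have g0: "cmod \<gamma> > 0" "\<gamma> \<noteq> 0" using g l by auto
  have \<nu>0: "\<nu> \<noteq> 0" using \<nu> by auto
  have "1 - z / \<gamma> = (\<gamma> - z) / \<gamma>" using g0 by (simp add: field_simps)
  then have A: "cmod (\<nu> * (1 - z / \<gamma>)) = cmod (\<gamma> - z) * (l / cmod \<gamma>)"
    by (simp add: norm_mult norm_divide l_def)
  have "l \<le> cmod \<gamma> + 3 / 4" using \<gamma> norm_triangle_ineq2[of \<nu> \<gamma>] by (simp add: l_def norm_minus_commute)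
  then have "l / cmod \<gamma> \<le> (cmod \<gamma> + 3 / 4) / cmod \<gamma>" using g0 by (intro divide_right_mono) auto
  also have "\<dots> = 1 + (3 / 4) / cmod \<gamma>" using g0 by (simp add: field_simps)
  also have "\<dots> \<le> 1 + (3 / 4) / (l / 4)" using g l g0 by (intro add_left_mono divide_left_mono mult_pos_pos) auto
  also have "\<dots> = 1 + 3 / l" by simp
  also have "\<dots> \<le> exp (3 / l)" by (rule exp_ge_add_one_self)
  finally have B: "l / cmod \<gamma> \<le> exp (3 / l)" .
  have "z / \<gamma> - z / \<nu> = z * (\<nu> - \<gamma>) / (\<gamma> * \<nu>)" using g0 \<nu>0 by (simp add: field_simps)
  then have "cmod (z / \<gamma> - z / \<nu>) = cmod z * cmod (\<gamma> - \<nu>) / (cmod \<gamma> * l)"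
    by (simp add: norm_mult norm_divide l_def norm_minus_commute)
  also have "\<dots> \<le> cmod z * (3 / 4) / (l / 4 * l)"
    using g g0 l \<gamma> by (intro frac_le mult_left_mono mult_right_mono) auto
  also have "\<dots> = 3 * cmod z / l\<^sup>2" using l by (simp add: power2_eq_square)
  finally have "Re (z / \<gamma> - z / \<nu>) \<le> 3 * cmod z / l\<^sup>2"
    using complex_Re_le_cmod[of "z / \<gamma> - z / \<nu>"] by linarith
  then have C: "cmod (exp (z / \<gamma> - z / \<nu>)) \<le> exp (3 * cmod z / l\<^sup>2)" by simp
  have "cmod (\<nu> * (1 - z / \<gamma>) * exp (z / \<gamma> - z / \<nu>)) = cmod (\<gamma> - z) * (l / cmod \<gamma>) * cmod (exp (z / \<gamma> - z / \<nu>))"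
    by (simp only: norm_mult[of "\<nu> * (1 - z / \<gamma>)"] A)
  also have "\<dots> \<le> (cmod (\<nu> - z) * exp c) * exp (3 / l) * exp (3 * cmod z / l\<^sup>2)"
    using l g0 by (intro mult_mono c B C) auto
  also have "\<dots> = cmod (z - \<nu>) * exp (c + 3 / l + 3 * cmod z / l\<^sup>2)"
    by (simp add: exp_add norm_minus_commute)
  finally show ?thesis by (simp add: l_def)
qed

text \<open>For distant zeros the convergence factors are needed: a displacement by at most \<open>3/4\<close> raises the logarithm of the modulus by
  at most \<open>O (|z|\<^sup>2 / |\<nu>|\<^sup>3)\<close>, which is summable over the lattice.\<close>
lemma moved_zero_far:
  assumes \<nu>: "cmod \<nu> \<ge> 1" and \<gamma>: "cmod (\<gamma> - \<nu>) \<le> 3 / 4" and far: "cmod z \<le> cmod \<nu> / 4"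
  shows "cmod (\<nu> * (1 - z / \<gamma>) * exp (z / \<gamma> - z / \<nu>)) \<le> cmod (z - \<nu>) * exp (24 * (cmod z)\<^sup>2 / cmod \<nu> ^ 3)"
proof -
  define l where "l = cmod \<nu>"
  have g: "cmod \<gamma> \<ge> l / 4" using \<nu> \<gamma> norm_triangle_ineq2[of \<nu> "\<nu> - \<gamma>"] by (simp add: l_def norm_minus_commute)
  have l: "l \<ge> 1" using \<nu> by (simp add: l_def)
  have g0: "cmod \<gamma> > 0" "\<gamma> \<noteq> 0" using g l by auto
  have \<nu>0: "\<nu> \<noteq> 0" using \<nu> by auto
  define u v where "u = z / \<gamma>" and "v = z / \<nu>"
  have vl: "cmod v = cmod z / l" by (simp add: v_def l_def norm_divide)
  have v4: "cmod v \<le> 1 / 4" using far l unfolding vl by (simp add: l_def[symmetric] field_simps)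
  have "u - v = z * (\<nu> - \<gamma>) / (\<gamma> * \<nu>)" using g0 \<nu>0 by (simp add: field_simps u_def v_def)
  then have "cmod (u - v) = cmod z * cmod (\<gamma> - \<nu>) / (cmod \<gamma> * l)"
    by (simp add: norm_mult norm_divide l_def norm_minus_commute)
  also have "\<dots> \<le> cmod z * (3 / 4) / (l / 4 * l)"
    using g g0 l \<gamma> by (intro frac_le mult_left_mono mult_right_mono) auto
  also have "\<dots> = 3 * cmod z / l\<^sup>2" using l by (simp add: power2_eq_square)
  finally have d: "cmod (u - v) \<le> 3 * cmod z / l\<^sup>2" .
  have "3 * cmod z / l\<^sup>2 \<le> 3 * cmod z / l" using l by (intro divide_left_mono) (auto simp: power2_eq_square)
  then have "cmod v + cmod (u - v) \<le> 4 * (cmod z / l)" using d unfolding vl by simp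
  then have "2 * cmod (u - v) * (cmod v + cmod (u - v)) \<le> 2 * (3 * cmod z / l\<^sup>2) * (4 * (cmod z / l))"
    using d by (intro mult_mono) auto
  also have "\<dots> = 24 * (cmod z)\<^sup>2 / l ^ 3" using l by (simp add: power2_eq_square power3_eq_cube)
  finally have e: "2 * cmod (u - v) * (cmod v + cmod (u - v)) \<le> 24 * (cmod z)\<^sup>2 / l ^ 3" .
  have "cmod (\<nu> * (1 - u) * exp (u - v)) = l * cmod ((1 - u) * exp (u - v))"
    by (simp add: norm_mult l_def)
  also have "\<dots> \<le> l * (cmod (1 - v) * exp (2 * cmod (u - v) * (cmod v + cmod (u - v))))"
    using l by (intro mult_left_mono primary_factor_ratio v4) auto
  also have "\<dots> \<le> l * (cmod (1 - v) * exp (24 * (cmod z)\<^sup>2 / l ^ 3))"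
    using l e by (intro mult_left_mono) auto
  also have "\<dots> = cmod (\<nu> * (1 - v)) * exp (24 * (cmod z)\<^sup>2 / l ^ 3)" by (simp add: norm_mult l_def)
  also have "\<nu> * (1 - v) = \<nu> - z" using \<nu>0 by (simp add: v_def field_simps)
  finally show ?thesis by (simp add: l_def u_def v_def norm_minus_commute)
qed

text \<open>Near and far zeros under a single summable bound. For \<open>|\<nu>| \<le> 4 (1 + |z|)\<close> a factor \<open>|\<nu>| powr (3/2)\<close> is traded for
  \<open>(1 + |z|) powr (3/2)\<close>; the second weight accounts for the zeros close to \<open>z\<close>.\<close>
lemma moved_zero_bound:
  assumes \<nu>: "\<nu> \<in> gauss_int" "\<nu> \<noteq> 0" "\<nu> \<noteq> nearest z" and \<gamma>: "cmod (\<gamma> - \<nu>) \<le> 3 / 4"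
  shows "cmod (\<nu> * (1 - z / \<gamma>) * exp (z / \<gamma> - z / \<nu>)) \<le>
    cmod (z - \<nu>) * exp (100 * ((1 + cmod z) * sqrt (1 + cmod z)) * (cell_weight \<nu> + cell_weight (\<nu> - nearest z)))"
proof -
  define l d X where "l = cmod \<nu>" and "d = cmod (\<nu> - nearest z)" and "X = 1 + cmod z"
  have l: "l \<ge> 1" unfolding l_def by (rule cmod_gauss_int_ge_1) (use \<nu> in auto)
  have d: "d \<ge> 1" unfolding d_def by (rule cmod_gauss_int_ge_1) (use \<nu> gauss_int_diff nearest_in_gauss_int in auto)
  have X: "X \<ge> 1" "cmod z \<le> X" by (auto simp: X_def)
  have wl: "cell_weight \<nu> = 1 / (l\<^sup>2 * sqrt l)" and wd: "cell_weight (\<nu> - nearest z) = 1 / (d\<^sup>2 * sqrt d)"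
    by (simp_all add: cell_weight_def l_def d_def)
  define Y where "Y = X * sqrt X"
  have Y: "Y \<ge> 0" using X by (simp add: Y_def)
  show ?thesis
  proof (cases "l \<ge> 4 * X")
    case True
    then have far: "cmod z \<le> cmod \<nu> / 4" by (simp add: l_def X_def)
    have "24 * (cmod z)\<^sup>2 / l ^ 3 \<le> 24 * X\<^sup>2 / l ^ 3"
      using l X by (intro divide_right_mono mult_left_mono power_mono) auto
    also have "\<dots> \<le> 24 * Y * (1 / (l\<^sup>2 * sqrt l))"
    proof -
      have sq: "X\<^sup>2 = X * (sqrt X * sqrt X)" "l ^ 3 = l\<^sup>2 * (sqrt l * sqrt l)"
        using X l by (simp_all add: power2_eq_square power3_eq_cube)
      have "24 * X\<^sup>2 / l ^ 3 = 24 * Y * (1 / (l\<^sup>2 * sqrt l)) * (sqrt X / sqrt l)"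
      proof -
        have "24 * (A * (s * s)) / (B * (r * r)) = 24 * (A * s) * (1 / (B * r)) * (s / r)" for A B s r :: real by simp
        then show ?thesis unfolding sq Y_def .
      qed
      also have "\<dots> \<le> 24 * Y * (1 / (l\<^sup>2 * sqrt l)) * 1"
        using True X l Y by (intro mult_left_mono) auto
      finally show ?thesis by simp
    qed
    also have "\<dots> \<le> 100 * Y * (1 / (l\<^sup>2 * sqrt l) + 1 / (d\<^sup>2 * sqrt d))"
      using Y l d by (intro mult_mono) auto
    finally have "24 * (cmod z)\<^sup>2 / l ^ 3 \<le> 100 * Y * (cell_weight \<nu> + cell_weight (\<nu> - nearest z))"
      unfolding wl wd .
    then have "cmod (z - \<nu>) * exp (24 * (cmod z)\<^sup>2 / cmod \<nu> ^ 3) \<le> cmod (z - \<nu>) * exp (100 * Y * (cell_weight \<nu> + cell_weight (\<nu> - nearest z)))"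
      unfolding l_def by (intro mult_left_mono) auto
    with moved_zero_far[OF l[unfolded l_def] \<gamma> far] show ?thesis unfolding Y_def X_def by linarith
  next
    case False
    have nz: "cmod (z - nearest z) \<le> 3 / 4" by (rule cmod_minus_nearest)
    have dz: "d / 4 \<le> cmod (\<nu> - z)"
    proof -
      have "d \<le> cmod (\<nu> - z) + cmod (z - nearest z)"
        unfolding d_def using norm_triangle_ineq[of "\<nu> - z" "z - nearest z"] by simp
      then show ?thesis using nz d by simp
    qed
    then have z0: "cmod (\<nu> - z) > 0" using d by linarith
    have "cmod (\<gamma> - z) \<le> cmod (\<nu> - z) + 3 / 4"
      using norm_triangle_ineq[of "\<gamma> - \<nu>" "\<nu> - z"] \<gamma> by simp
    also have "\<dots> = cmod (\<nu> - z) * (1 + (3 / 4) / cmod (\<nu> - z))" using z0 by (simp add: field_simps)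
    also have "\<dots> \<le> cmod (\<nu> - z) * (1 + (3 / 4) / (d / 4))"
      using dz d z0 by (intro mult_left_mono add_left_mono divide_left_mono) auto
    also have "\<dots> = cmod (\<nu> - z) * (1 + 3 / d)" by simp
    also have "\<dots> \<le> cmod (\<nu> - z) * exp (3 / d)" by (intro mult_left_mono exp_ge_add_one_self) auto
    finally have c: "cmod (\<gamma> - z) \<le> cmod (\<nu> - z) * exp (3 / d)" .
    have "sqrt l \<le> sqrt (4 * X)" using False by simp
    then have sl: "sqrt l \<le> 2 * sqrt X" by (simp add: real_sqrt_mult)
    have "d \<le> 9 * X"
    proof -
      have "d \<le> l + cmod (nearest z)" unfolding d_def l_def by (rule norm_triangle_ineq4)
      moreover have "cmod (nearest z) \<le> cmod z + 3 / 4"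
        using norm_triangle_ineq2[of "nearest z" z] nz by (simp add: norm_minus_commute)
      ultimately show ?thesis using False norm_ge_zero[of z] unfolding X_def by argo
    qed
    then have "sqrt d \<le> sqrt (9 * X)" by simp
    moreover have "sqrt 9 = (3::real)" by (rule real_sqrt_unique) auto
    ultimately have sd: "sqrt d \<le> 3 * sqrt X" by (simp add: real_sqrt_mult)
    have 1: "3 / d \<le> 81 * Y * (1 / (d\<^sup>2 * sqrt d))"
    proof -
      have "d * sqrt d \<le> (9 * X) * (3 * sqrt X)" using \<open>d \<le> 9 * X\<close> sd d X by (intro mult_mono) auto
      then have "3 * (d * sqrt d) * d \<le> 81 * Y * d" using d by (intro mult_right_mono) (auto simp: Y_def)
      then show ?thesis using d by (simp add: field_simps power2_eq_square)
    qed
    have 2: "3 / l \<le> 24 * Y * (1 / (l\<^sup>2 * sqrt l))"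
    proof -
      have "l * sqrt l \<le> (4 * X) * (2 * sqrt X)" using False sl l X by (intro mult_mono) auto
      then have "3 * (l * sqrt l) * l \<le> 24 * Y * l" using l by (intro mult_right_mono) (auto simp: Y_def)
      then show ?thesis using l by (simp add: field_simps power2_eq_square)
    qed
    have 3: "3 * cmod z / l\<^sup>2 \<le> 6 * Y * (1 / (l\<^sup>2 * sqrt l))"
    proof -
      have "cmod z * sqrt l \<le> X * (2 * sqrt X)" using X sl l by (intro mult_mono) auto
      then have "3 * (cmod z * sqrt l) * l\<^sup>2 \<le> 6 * Y * l\<^sup>2" by (intro mult_right_mono) (auto simp: Y_def mult_ac)
      then show ?thesis using l by (simp add: field_simps)
    qed
    have "3 / d + 3 / l + 3 * cmod z / l\<^sup>2 \<le> 81 * Y * cell_weight (\<nu> - nearest z) + 24 * Y * cell_weight \<nu> + 6 * Y * cell_weight \<nu>"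
      unfolding wl wd by (rule add_mono[OF add_mono[OF 1 2] 3])
    also have "\<dots> = 81 * Y * cell_weight (\<nu> - nearest z) + 30 * Y * cell_weight \<nu>" by simp
    also have "\<dots> \<le> 100 * Y * cell_weight (\<nu> - nearest z) + 100 * Y * cell_weight \<nu>"
      using Y l d unfolding wl wd by (intro add_mono mult_right_mono) auto
    also have "\<dots> = 100 * Y * (cell_weight \<nu> + cell_weight (\<nu> - nearest z))" by (simp add: algebra_simps)
    finally have "cmod (z - \<nu>) * exp (3 / d + 3 / cmod \<nu> + 3 * cmod z / (cmod \<nu>)\<^sup>2) \<le> cmod (z - \<nu>) * exp (100 * Y * (cell_weight \<nu> + cell_weight (\<nu> - nearest z)))"
      unfolding l_def by (intro mult_left_mono) auto
    with moved_zero_near[OF l[unfolded l_def] \<gamma> c] show ?thesis unfolding Y_def X_def by linarith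
  qed
qed

lemma moved_zero_bound_nearest:
  assumes \<nu>: "\<nu> \<in> gauss_int" "\<nu> \<noteq> 0" and z: "1 / 2 \<le> cmod (z - \<nu>)" and \<gamma>: "cmod (\<gamma> - \<nu>) \<le> 3 / 4"
  shows "cmod (\<nu> * (1 - z / \<gamma>) * exp (z / \<gamma> - z / \<nu>)) \<le> cmod (z - \<nu>) * exp (5 + 3 * cmod z)"
proof -
  have l: "cmod \<nu> \<ge> 1" by (rule cmod_gauss_int_ge_1) (use \<nu> in auto)
  have "cmod (\<gamma> - z) \<le> cmod (\<nu> - z) + 3 / 4"
    using norm_triangle_ineq[of "\<gamma> - \<nu>" "\<nu> - z"] \<gamma> by simp
  also have "\<dots> \<le> cmod (\<nu> - z) * (1 + 2)" using z by (simp add: norm_minus_commute)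
  also have "\<dots> \<le> cmod (\<nu> - z) * exp 2" by (intro mult_left_mono exp_ge_add_one_self) auto
  finally have c: "cmod (\<gamma> - z) \<le> cmod (\<nu> - z) * exp 2" .
  have "3 / cmod \<nu> \<le> 3" using l by (simp add: divide_le_eq)
  moreover have "3 * cmod z / (cmod \<nu>)\<^sup>2 \<le> 3 * cmod z / 1"
    using l by (intro divide_left_mono) (auto simp: one_le_power)
  ultimately have "2 + 3 / cmod \<nu> + 3 * cmod z / (cmod \<nu>)\<^sup>2 \<le> 5 + 3 * cmod z" by simp
  then have "cmod (z - \<nu>) * exp (2 + 3 / cmod \<nu> + 3 * cmod z / (cmod \<nu>)\<^sup>2) \<le> cmod (z - \<nu>) * exp (5 + 3 * cmod z)"
    by (intro mult_left_mono) auto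
  with moved_zero_near[OF l \<gamma> c] show ?thesis by linarith
qed

section \<open>One zero in each cell\<close>

text \<open>Two applications of the inequality of arithmetic and geometric means.\<close>
lemma three_halves_power_bound:
  assumes D: "D \<ge> 0" and \<epsilon>: "\<epsilon> > 0"
  shows "\<exists>C. \<forall>r\<ge>0. D * ((2 + r) * sqrt (2 + r)) \<le> \<epsilon> * r\<^sup>2 + (C::real)"
proof -
  define \<delta> where "\<delta> = \<epsilon> / 4"
  have \<delta>: "\<delta> > 0" using \<epsilon> by (simp add: \<delta>_def)
  define E where "E = D\<^sup>2 / (4 * \<delta>)"
  have amgm: "a * b \<le> \<delta> * b\<^sup>2 + a\<^sup>2 / (4 * \<delta>)" for a b :: real
  proof -
    have "0 \<le> \<delta> * (b - a / (2 * \<delta>))\<^sup>2" using \<delta> by simp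
    also have "\<dots> = \<delta> * b\<^sup>2 + a\<^sup>2 / (4 * \<delta>) - a * b"
      using \<delta> by (simp add: power2_eq_square field_simps)
    finally show ?thesis by simp
  qed
  have "D * ((2 + r) * sqrt (2 + r)) \<le> \<epsilon> * r\<^sup>2 + (4 * \<epsilon> + E\<^sup>2 / (4 * \<delta>))" if r: "r \<ge> 0" for r
  proof -
    define y where "y = 2 + r"
    have y: "y \<ge> 0" using r by (simp add: y_def)
    have "D * sqrt y \<le> \<delta> * y + E" using amgm[of D "sqrt y"] y by (simp add: E_def)
    then have "(D * sqrt y) * y \<le> (\<delta> * y + E) * y" using y by (rule mult_right_mono)
    also have "\<dots> = \<delta> * y\<^sup>2 + E * y" by (simp add: power2_eq_square algebra_simps)
    also have "E * y \<le> \<delta> * y\<^sup>2 + E\<^sup>2 / (4 * \<delta>)" by (rule amgm)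
    finally have 1: "(D * sqrt y) * y \<le> \<delta> * y\<^sup>2 + (\<delta> * y\<^sup>2 + E\<^sup>2 / (4 * \<delta>))" by simp
    have "y\<^sup>2 \<le> 2 * r\<^sup>2 + 8"
      using zero_le_power2[of "r - 2"] by (simp add: y_def power2_eq_square algebra_simps)
    then have 2: "2 * \<delta> * y\<^sup>2 \<le> 2 * \<delta> * (2 * r\<^sup>2 + 8)" using \<delta> by (intro mult_left_mono) auto
    have "(D * sqrt y) * y \<le> 2 * \<delta> * y\<^sup>2 + E\<^sup>2 / (4 * \<delta>)" using 1 by simp
    also have "\<dots> \<le> 2 * \<delta> * (2 * r\<^sup>2 + 8) + E\<^sup>2 / (4 * \<delta>)"
      using 2 by (rule add_right_mono)
    also have "\<dots> = \<epsilon> * r\<^sup>2 + (4 * \<epsilon> + E\<^sup>2 / (4 * \<delta>))" by (simp add: \<delta>_def algebra_simps)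
    finally show ?thesis by (simp add: y_def mult_ac)
  qed
  then show ?thesis by blast
qed

definition off_lattice :: "complex \<Rightarrow> bool" where
  "off_lattice z \<longleftrightarrow> (\<forall>\<mu>\<in>gauss_int. 1 / 2 \<le> cmod (z - \<mu>))"

text \<open>The maximum principle on the disc of radius \<open>1/2\<close> about the lattice point next to \<open>z\<close>, whose boundary is
  off the lattice.\<close>
lemma bound_from_off_lattice:
  assumes g: "g holomorphic_on UNIV" and D: "D \<ge> 0"
    and b: "\<And>z. off_lattice z \<Longrightarrow> cmod (g z) \<le> exp (pi / 2 * (cmod z)\<^sup>2 + D * ((1 + cmod z) * sqrt (1 + cmod z)))"
  shows "cmod (g z) \<le> exp (pi / 2 * (1 + cmod z)\<^sup>2 + D * ((2 + cmod z) * sqrt (2 + cmod z)))"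
proof -
  have mono: "cmod (g u) \<le> exp (pi / 2 * (1 + cmod z)\<^sup>2 + D * ((2 + cmod z) * sqrt (2 + cmod z)))"
    if u: "off_lattice u" "cmod u \<le> 1 + cmod z" for u
  proof -
    have "pi / 2 * (cmod u)\<^sup>2 \<le> pi / 2 * (1 + cmod z)\<^sup>2"
      using u(2) by (intro mult_left_mono power_mono) auto
    moreover have "D * ((1 + cmod u) * sqrt (1 + cmod u)) \<le> D * ((2 + cmod z) * sqrt (2 + cmod z))"
      using u(2) D by (intro mult_left_mono mult_mono) auto
    ultimately have "exp (pi / 2 * (cmod u)\<^sup>2 + D * ((1 + cmod u) * sqrt (1 + cmod u))) \<le> exp (pi / 2 * (1 + cmod z)\<^sup>2 + D * ((2 + cmod z) * sqrt (2 + cmod z)))"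
      unfolding exp_le_cancel_iff by (rule add_mono)
    with b[OF u(1)] show ?thesis by (rule order_trans)
  qed
  define \<nu> where "\<nu> = nearest z"
  show ?thesis
  proof (cases "cmod (z - \<nu>) < 1 / 2")
    case True
    show ?thesis
    proof (rule maximum_modulus_frontier[of g "ball \<nu> (1/2)"])
      show "g holomorphic_on interior (ball \<nu> (1/2))" "continuous_on (closure (ball \<nu> (1/2))) g"
        using g holomorphic_on_subset holomorphic_on_imp_continuous_on continuous_on_subset by blast+
      show "z \<in> ball \<nu> (1/2)" using True by (simp add: dist_norm norm_minus_commute)
      fix u assume "u \<in> frontier (ball \<nu> (1/2))"
      then have u: "cmod (u - \<nu>) = 1 / 2" by (simp add: dist_norm norm_minus_commute)
      have "off_lattice u" unfolding off_lattice_def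
      proof
        fix \<mu> assume \<mu>: "\<mu> \<in> gauss_int"
        show "1 / 2 \<le> cmod (u - \<mu>)"
        proof (cases "\<mu> = \<nu>")
          case False
          then have "1 \<le> cmod (\<mu> - \<nu>)"
            using \<mu> by (intro cmod_gauss_int_ge_1 gauss_int_diff) (auto simp: \<nu>_def nearest_in_gauss_int)
          then show ?thesis using u norm_triangle_ineq4[of "u - \<nu>" "u - \<mu>"] by simp
        qed (use u in simp)
      qed
      moreover have "cmod u \<le> 1 + cmod z"
        using norm_triangle_ineq[of "u - \<nu>" "\<nu> - z"] norm_triangle_ineq2[of u z] u True
        by (simp add: norm_minus_commute)
      ultimately show "cmod (g u) \<le> exp (pi / 2 * (1 + cmod z)\<^sup>2 + D * ((2 + cmod z) * sqrt (2 + cmod z)))"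
        by (rule mono)
    qed simp
  next
    case False
    have "off_lattice z" unfolding off_lattice_def
      using False nearest_minimal[of _ z] by (force simp: \<nu>_def)
    then show ?thesis by (rule mono) simp
  qed
qed

text \<open>Divide the lattice function by \<open>z - \<nu>\<close> for \<open>\<nu> = 0\<close> and for each occupied cell, and multiply by the factors that
  have their zeros at the points of \<open>Q\<close>. Points in the cell of \<open>0\<close>, collected in \<open>Q0\<close>, get no
  convergence factor: there is at most one, and it is bounded by means of \<open>q\<close>.\<close>
lemma entire_with_one_zero_per_cell:
  assumes q: "q > 0"
  shows "\<exists>D\<ge>0. \<forall>Q. finite Q \<longrightarrow> inj_on nearest Q \<longrightarrow> (\<forall>\<gamma>\<in>Q. q \<le> cmod \<gamma>) \<longrightarrow>
     (\<exists>g. g holomorphic_on UNIV \<and> g 0 = of_real pi \<and> (\<forall>\<gamma>\<in>Q. g \<gamma> = 0) \<and>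
       (\<forall>z. cmod (g z) \<le> exp (pi / 2 * (1 + cmod z)\<^sup>2 + D * ((2 + cmod z) * sqrt (2 + cmod z)))))"
proof -
  obtain K where K: "K \<ge> 0" "\<And>F. finite F \<Longrightarrow> F \<subseteq> gauss_int - {0} \<Longrightarrow> (\<Sum>\<mu>\<in>F. cell_weight \<mu>) \<le> K"
    using gauss_int_sum_bound unfolding cell_weight_def by metis
  define D where "D = 60 + 1 / q + 200 * K"
  have D: "D \<ge> 0" using q K by (simp add: D_def)
  have main: "\<exists>g. g holomorphic_on UNIV \<and> g 0 = of_real pi \<and> (\<forall>\<gamma>\<in>Q. g \<gamma> = 0) \<and>
       (\<forall>z. cmod (g z) \<le> exp (pi / 2 * (1 + cmod z)\<^sup>2 + D * ((2 + cmod z) * sqrt (2 + cmod z))))"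
    if Q: "finite Q" "inj_on nearest Q" "\<And>\<gamma>. \<gamma> \<in> Q \<Longrightarrow> q \<le> cmod \<gamma>" for Q
  proof -
    define Q0 Q1 where "Q0 = {\<gamma>\<in>Q. nearest \<gamma> = 0}" and "Q1 = {\<gamma>\<in>Q. nearest \<gamma> \<noteq> 0}"
    have fQ: "finite Q0" "finite Q1" using Q(1) by (auto simp: Q0_def Q1_def)
    have inj1: "inj_on nearest Q1" using Q(2) by (rule inj_on_subset) (auto simp: Q1_def)
    have Qn: "\<gamma> \<noteq> 0" if "\<gamma> \<in> Q" for \<gamma> using Q(3)[OF that] q by auto
    \<comment> \<open>The occupied lattice points other than \<open>0\<close>.\<close>
    define L where "L = nearest ` Q1"
    have L: "finite L" "0 \<notin> L" "L \<subseteq> gauss_int - {0}"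
      using fQ by (auto simp: L_def Q1_def nearest_in_gauss_int)
    obtain B where B: "\<And>\<nu>. \<nu> \<in> L \<Longrightarrow> cmod \<nu> \<le> B"
      using finite_imp_bounded[OF L(1)] by (auto simp: bounded_iff)
    obtain N :: nat where N: "B \<le> real N" using real_arch_simple by blast
    define \<sigma> where "\<sigma> = lattice_sine N"
    have "\<sigma> \<nu> = 0" if "\<nu> \<in> insert 0 L" for \<nu>
      unfolding \<sigma>_def
    proof (rule lattice_sine_zero)
      show "\<nu> \<in> gauss_int" using that L by (auto simp: gauss_int_def)
      show "\<bar>Im \<nu>\<bar> \<le> real N" using that B[of \<nu>] N abs_Im_le_cmod[of \<nu>] by auto
    qed
    then obtain h where h: "h holomorphic_on UNIV" "\<And>z. \<sigma> z = h z * (\<Prod>\<nu>\<in>insert 0 L. z - \<nu>)"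
      using entire_factor_finite_zeros[of "insert 0 L" \<sigma>] L(1) holomorphic_lattice_sine by (auto simp: \<sigma>_def)
    have \<sigma>eq: "\<sigma> z = z * (h z * (\<Prod>\<gamma>\<in>Q1. z - nearest \<gamma>))" for z
      using h(2)[of z] L(1,2) by (simp add: L_def prod.reindex[OF inj1])
    define k where "k = (\<lambda>z. h z * (\<Prod>\<gamma>\<in>Q1. z - nearest \<gamma>))"
    have kh: "k holomorphic_on UNIV" unfolding k_def using h(1) by (intro holomorphic_intros)
    have k0: "k 0 = of_real pi"
    proof -
      have "(k has_field_derivative deriv k 0) (at 0)" using kh by (rule holomorphic_derivI) auto
      then have "((\<lambda>z. z * k z) has_field_derivative (1 * k 0 + deriv k 0 * 0)) (at 0)"
        by (rule DERIV_mult[OF DERIV_ident])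
      moreover have "(\<lambda>z. z * k z) = \<sigma>" by (simp add: fun_eq_iff \<sigma>eq k_def)
      ultimately have "(\<sigma> has_field_derivative k 0) (at 0)" by simp
      moreover have "(\<sigma> has_field_derivative of_real pi) (at 0)" unfolding \<sigma>_def by (rule deriv_lattice_sine)
      ultimately show ?thesis by (rule DERIV_unique)
    qed
    define m where "m = (\<lambda>\<gamma> z. nearest \<gamma> * (1 - z / \<gamma>) * exp (z / \<gamma> - z / nearest \<gamma>))"
    \<comment> \<open>The sign makes the factors equal to \<open>0 - nearest \<gamma>\<close> at \<open>z = 0\<close>, so that \<open>g 0 = k 0\<close>.\<close>
    define g where "g = (\<lambda>z. h z * (\<Prod>\<gamma>\<in>Q0. 1 - z / \<gamma>) * (\<Prod>\<gamma>\<in>Q1. - m \<gamma> z))"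
    have g: "g holomorphic_on UNIV" unfolding g_def m_def
      using h(1) by (intro holomorphic_intros) (auto simp: Q0_def Q1_def Qn)
    have g0: "g 0 = of_real pi" using k0 by (simp add: g_def k_def m_def)
    have gz: "g \<gamma> = 0" if \<gamma>: "\<gamma> \<in> Q" for \<gamma>
    proof (cases "\<gamma> \<in> Q0")
      case True
      then have "(\<Prod>\<delta>\<in>Q0. 1 - \<gamma> / \<delta>) = 0" using Qn[OF \<gamma>] fQ by (intro prod_zero) auto
      then show ?thesis by (simp add: g_def)
    next
      case False
      then have "\<gamma> \<in> Q1" using \<gamma> by (simp add: Q0_def Q1_def)
      then have "(\<Prod>\<delta>\<in>Q1. - m \<delta> \<gamma>) = 0" using Qn[OF \<gamma>] fQ by (intro prod_zero) (auto simp: m_def)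
      then show ?thesis by (simp add: g_def)
    qed
    have bound: "cmod (g z) \<le> exp (pi / 2 * (cmod z)\<^sup>2 + D * ((1 + cmod z) * sqrt (1 + cmod z)))" if z: "off_lattice z" for z
    proof -
      define Y where "Y = (1 + cmod z) * sqrt (1 + cmod z)"
      have "(1 + cmod z) * 1 \<le> Y" unfolding Y_def by (intro mult_left_mono) auto
      then have Y: "Y \<ge> 1 + cmod z" by simp
      have Y0: "Y \<ge> 0" by (simp add: Y_def)
      have z2: "1 / 2 \<le> cmod z" using z[unfolded off_lattice_def, rule_format, of 0] by (simp add: gauss_int_def)
      then have z0: "cmod z > 0" by linarith
      define b where "b = (\<lambda>\<gamma>. if nearest \<gamma> = nearest z then 5 + 3 * cmod z
          else 100 * Y * (cell_weight (nearest \<gamma>) + cell_weight (nearest \<gamma> - nearest z)))"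
      have mb: "cmod (m \<gamma> z) \<le> cmod (z - nearest \<gamma>) * exp (b \<gamma>)" if \<gamma>: "\<gamma> \<in> Q1" for \<gamma>
      proof -
        have n0: "nearest \<gamma> \<noteq> 0" using \<gamma> by (simp add: Q1_def)
        note near = nearest_in_gauss_int[of \<gamma>] n0 and close = cmod_minus_nearest[of \<gamma>]
        show ?thesis
        proof (cases "nearest \<gamma> = nearest z")
          case True
          have "1 / 2 \<le> cmod (z - nearest \<gamma>)" using z nearest_in_gauss_int by (simp add: off_lattice_def)
          from moved_zero_bound_nearest[OF near this close] show ?thesis
            unfolding m_def b_def if_P[OF True] .
        next
          case False
          from moved_zero_bound[OF near False close] show ?thesis
            unfolding m_def b_def Y_def if_not_P[OF False] .
        qed
      qed
      have sumb: "(\<Sum>\<gamma>\<in>Q1. b \<gamma>) \<le> (5 + 3 * cmod z) + 200 * K * Y"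
      proof -
        define S where "S = {\<gamma>\<in>Q1. nearest \<gamma> \<noteq> nearest z}"
        define T where "T = {\<gamma>\<in>Q1. nearest \<gamma> = nearest z}"
        have ST: "Q1 = T \<union> S" "T \<inter> S = {}" "finite S" "finite T" using fQ by (auto simp: S_def T_def)
        have injS: "inj_on nearest S" using inj1 by (rule inj_on_subset) (auto simp: S_def)
        have "inj_on nearest T" using inj1 by (rule inj_on_subset) (auto simp: T_def)
        then have "card T = card (nearest ` T)" by (rule card_image[symmetric])
        also have "\<dots> \<le> card {nearest z}" by (rule card_mono) (auto simp: T_def)
        finally have "card T \<le> 1" by simp
        then have T: "(\<Sum>\<gamma>\<in>T. b \<gamma>) \<le> 5 + 3 * cmod z"
        proof -
          have "(\<Sum>\<gamma>\<in>T. b \<gamma>) = real (card T) * (5 + 3 * cmod z)" by (simp add: b_def T_def)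
          also have "\<dots> \<le> 1 * (5 + 3 * cmod z)" using \<open>card T \<le> 1\<close> by (intro mult_right_mono) auto
          finally show ?thesis by simp
        qed
        have "(\<Sum>\<gamma>\<in>S. b \<gamma>) = 100 * Y * ((\<Sum>\<gamma>\<in>S. cell_weight (nearest \<gamma>)) + (\<Sum>\<gamma>\<in>S. cell_weight (nearest \<gamma> - nearest z)))"
          by (simp add: b_def S_def sum_distrib_left sum.distrib distrib_left)
        also have "\<dots> \<le> 100 * Y * (K + K)"
        proof (intro mult_left_mono add_mono)
          have "(\<Sum>\<gamma>\<in>S. cell_weight (nearest \<gamma>)) = (\<Sum>\<mu>\<in>nearest ` S. cell_weight \<mu>)"
            by (simp add: sum.reindex[OF injS])
          also have "\<dots> \<le> K" using ST(3) by (intro K(2)) (auto simp: S_def Q1_def nearest_in_gauss_int)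
          finally show "(\<Sum>\<gamma>\<in>S. cell_weight (nearest \<gamma>)) \<le> K" .
          have inj': "inj_on (\<lambda>\<gamma>. nearest \<gamma> - nearest z) S" using injS by (auto simp: inj_on_def)
          have "(\<Sum>\<gamma>\<in>S. cell_weight (nearest \<gamma> - nearest z)) = (\<Sum>\<mu>\<in>(\<lambda>\<gamma>. nearest \<gamma> - nearest z) ` S. cell_weight \<mu>)"
            by (simp add: sum.reindex[OF inj'])
          also have "\<dots> \<le> K" using ST(3) by (intro K(2)) (auto simp: S_def Q1_def intro!: gauss_int_diff nearest_in_gauss_int)
          finally show "(\<Sum>\<gamma>\<in>S. cell_weight (nearest \<gamma> - nearest z)) \<le> K" .
        qed (use Y0 in simp_all)
        finally have "(\<Sum>\<gamma>\<in>S. b \<gamma>) \<le> 200 * K * Y" by (simp add: mult_ac)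
        moreover have "(\<Sum>\<gamma>\<in>Q1. b \<gamma>) = (\<Sum>\<gamma>\<in>T. b \<gamma>) + (\<Sum>\<gamma>\<in>S. b \<gamma>)"
          unfolding ST(1) by (rule sum.union_disjoint) (use ST(2-4) in auto)
        ultimately show ?thesis using T by (simp add: add_mono)
      qed
      have p0: "cmod (\<Prod>\<gamma>\<in>Q0. 1 - z / \<gamma>) \<le> 1 + cmod z / q"
      proof (cases "Q0 = {}")
        case False
        then obtain \<gamma>0 where \<gamma>0: "\<gamma>0 \<in> Q0" by auto
        have "Q0 = {\<gamma>0}" using \<gamma>0 Q(2) by (auto simp: Q0_def inj_on_def)
        moreover have "cmod (1 - z / \<gamma>0) \<le> 1 + cmod z / q"
        proof -
          have "cmod (1 - z / \<gamma>0) \<le> 1 + cmod z / cmod \<gamma>0"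
            using norm_triangle_ineq4[of 1 "z / \<gamma>0"] by (simp add: norm_divide)
          also have "cmod z / cmod \<gamma>0 \<le> cmod z / q"
            using Q(3)[of \<gamma>0] \<gamma>0 q by (intro divide_left_mono mult_pos_pos) (auto simp: Q0_def)
          finally show ?thesis by simp
        qed
        ultimately show ?thesis by simp
      qed (use q in simp)
      have "cmod (g z) * cmod z = cmod (h z) * cmod z * cmod (\<Prod>\<gamma>\<in>Q0. 1 - z / \<gamma>) * (\<Prod>\<gamma>\<in>Q1. cmod (m \<gamma> z))"
        by (simp add: g_def norm_mult prod_norm[symmetric])
      also have "\<dots> \<le> cmod (h z) * cmod z * cmod (\<Prod>\<gamma>\<in>Q0. 1 - z / \<gamma>) * (\<Prod>\<gamma>\<in>Q1. cmod (z - nearest \<gamma>) * exp (b \<gamma>))"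
        by (intro mult_left_mono prod_mono) (auto simp: mb)
      also have "\<dots> = cmod (\<sigma> z) * cmod (\<Prod>\<gamma>\<in>Q0. 1 - z / \<gamma>) * exp (\<Sum>\<gamma>\<in>Q1. b \<gamma>)"
        unfolding \<sigma>eq using fQ by (simp add: norm_mult prod_norm[symmetric] prod.distrib exp_sum)
      also have "\<dots> \<le> exp (pi / 2 * (cmod z)\<^sup>2 + 14 * cmod z + 30) * (1 + cmod z / q) * exp ((5 + 3 * cmod z) + 200 * K * Y)"
        using sumb unfolding \<sigma>_def by (intro mult_mono lattice_sine_bound p0) (use q in auto)
            also have "\<dots> \<le> exp (pi / 2 * (cmod z)\<^sup>2 + 14 * cmod z + 30) * (exp (1 + 1 / q) * cmod z) * exp ((5 + 3 * cmod z) + 200 * K * Y)"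
      proof -
        have "1 + cmod z / q \<le> (2 + 1 / q) * cmod z" using z2 q by (simp add: algebra_simps)
        also have "\<dots> \<le> exp (1 + 1 / q) * cmod z"
          using exp_ge_add_one_self[of "1 + 1 / q"] by (intro mult_right_mono) auto
        finally show ?thesis by (intro mult_right_mono mult_left_mono) auto
      qed
      also have "\<dots> = exp (pi / 2 * (cmod z)\<^sup>2 + (14 * cmod z + 30 + (1 + 1 / q) + ((5 + 3 * cmod z) + 200 * K * Y))) * cmod z"
      proof -
        have e4: "exp a * (exp b * c) * exp d = exp (a + (b + d)) * c" for a b c d :: real by (simp add: exp_add)
        show ?thesis unfolding e4 by (simp only: add.assoc)
      qed
      finally have "cmod (g z) \<le> exp (pi / 2 * (cmod z)\<^sup>2 + (14 * cmod z + 30 + (1 + 1 / q) + ((5 + 3 * cmod z) + 200 * K * Y)))"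
        by (rule mult_right_le_imp_le) (rule z0)
      also have "\<dots> \<le> exp (pi / 2 * (cmod z)\<^sup>2 + D * Y)"
      proof -
        have "1 \<le> Y" by (rule order_trans[OF _ Y]) simp
        then have h1: "1 / q * 1 \<le> 1 / q * Y" using q by (intro mult_left_mono) auto
        have "14 * cmod z + 30 + 1 + (5 + 3 * cmod z) \<le> 60 * (1 + cmod z)" by simp
        also have "\<dots> \<le> 60 * Y" using Y by simp
        finally have h2: "14 * cmod z + 30 + 1 + (5 + 3 * cmod z) \<le> 60 * Y" .
        have "14 * cmod z + 30 + (1 + 1 / q) + ((5 + 3 * cmod z) + 200 * K * Y) =
            (14 * cmod z + 30 + 1 + (5 + 3 * cmod z)) + 1 / q * 1 + 200 * K * Y" by simp
        also have "\<dots> \<le> 60 * Y + 1 / q * Y + 200 * K * Y" by (intro add_mono h1 h2 order_refl)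
        also have "\<dots> = D * Y" by (simp add: D_def distrib_right)
        finally show ?thesis by simp
      qed
      finally show ?thesis by (simp add: Y_def)
    qed
    show ?thesis
    proof (intro exI[of _ g] conjI ballI allI)
      fix z show "cmod (g z) \<le> exp (pi / 2 * (1 + cmod z)\<^sup>2 + D * ((2 + cmod z) * sqrt (2 + cmod z)))"
        by (rule bound_from_off_lattice[OF g D bound])
    qed (use g g0 gz in auto)
  qed
  show ?thesis
    by (intro exI[of _ D] conjI allI impI D main) auto
qed

section \<open>Many zeros in each cell\<close>

lemma colour_fibres:
  assumes "finite Q" "\<And>y. card {x\<in>Q. f x = y} \<le> N"
  obtains c :: "'a \<Rightarrow> nat" where "\<And>x. x \<in> Q \<Longrightarrow> c x < N"
    "\<And>x y. x \<in> Q \<Longrightarrow> y \<in> Q \<Longrightarrow> f x = f y \<Longrightarrow> c x = c y \<Longrightarrow> x = y"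
proof -
  have "\<forall>y. \<exists>h. bij_betw h {x\<in>Q. f x = y} {0..<card {x\<in>Q. f x = y}}"
    using assms(1) by (intro allI ex_bij_betw_finite_nat) simp
  then obtain h where h: "\<And>y. bij_betw (h y) {x\<in>Q. f x = y} {0..<card {x\<in>Q. f x = y}}"
    by (rule choice[THEN exE]) blast
  show thesis
  proof (rule that[of "\<lambda>x. h (f x) x"])
    fix x assume "x \<in> Q"
    then have "h (f x) x \<in> {0..<card {u\<in>Q. f u = f x}}" using bij_betwE[OF h[of "f x"]] by blast
    then show "h (f x) x < N" using assms(2)[of "f x"] by simp
  next
    fix x y assume xy: "x \<in> Q" "y \<in> Q" "f x = f y" "h (f x) x = h (f y) y"
    have "inj_on (h (f x)) {u\<in>Q. f u = f x}" using h by (rule bij_betw_imp_inj_on)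
    then show "x = y" by (rule inj_onD) (use xy in auto)
  qed
qed

text \<open>The product over \<open>N\<close> classes with at most one point in each cell, rescaled by \<open>s\<close>; the excess growth is absorbed
  by \<open>\<epsilon>\<close>.\<close>
lemma entire_with_zeros:
  assumes s: "s > 0" and q: "q > 0" and \<epsilon>: "\<epsilon> > 0"
  shows "\<exists>C>0. \<forall>Q. finite Q \<longrightarrow> (\<forall>\<gamma>\<in>Q. q \<le> cmod \<gamma>) \<longrightarrow> (\<forall>\<mu>. card {\<gamma>\<in>Q. nearest (\<gamma> / of_real s) = \<mu>} \<le> N) \<longrightarrow>
    (\<exists>g. g holomorphic_on UNIV \<and> g 0 = 1 \<and> (\<forall>\<gamma>\<in>Q. g \<gamma> = 0) \<and>
       (\<forall>z. cmod (g z) \<le> C * exp ((pi * real N / (2 * s\<^sup>2) + \<epsilon>) * (cmod z)\<^sup>2)))"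
proof -
  have qs: "q / s > 0" using q s by simp
  obtain D where D: "D \<ge> 0" and DQ: "\<And>Q. finite Q \<Longrightarrow> inj_on nearest Q \<Longrightarrow> (\<forall>\<gamma>\<in>Q. q / s \<le> cmod \<gamma>) \<Longrightarrow>
     (\<exists>g. g holomorphic_on UNIV \<and> g 0 = of_real pi \<and> (\<forall>\<gamma>\<in>Q. g \<gamma> = 0) \<and>
       (\<forall>z. cmod (g z) \<le> exp (pi / 2 * (1 + cmod z)\<^sup>2 + D * ((2 + cmod z) * sqrt (2 + cmod z)))))"
    using entire_with_one_zero_per_cell[OF qs] by blast
  define \<delta> where "\<delta> = \<epsilon> * s\<^sup>2 / (real N + 1)"
  have \<delta>: "\<delta> > 0" using \<epsilon> s by (simp add: \<delta>_def add_pos_nonneg)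
  have "D + pi \<ge> 0" using D by simp
  from three_halves_power_bound[OF this \<delta>]
  obtain B where B: "\<And>r. r \<ge> 0 \<Longrightarrow> (D + pi) * ((2 + r) * sqrt (2 + r)) \<le> \<delta> * r\<^sup>2 + B" by blast
  have growth: "pi / 2 * (1 + r)\<^sup>2 + D * ((2 + r) * sqrt (2 + r)) \<le> (pi / 2 + \<delta>) * r\<^sup>2 + B" if r: "r \<ge> 0" for r
  proof -
    define Y where "Y = (2 + r) * sqrt (2 + r)"
    have "(2 + r) * 1 \<le> Y" unfolding Y_def using r by (intro mult_left_mono) auto
    then have Y: "pi * (2 + r) \<le> pi * Y" by simp
    have "pi / 2 * (1 + r)\<^sup>2 = pi / 2 * r\<^sup>2 + pi * (1/2 + r)"
      by (simp add: power2_eq_square field_simps)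
    also have "\<dots> \<le> pi / 2 * r\<^sup>2 + pi * (2 + r)" by (intro add_left_mono mult_left_mono) auto
    also have "\<dots> \<le> pi / 2 * r\<^sup>2 + pi * Y" using Y by (rule add_left_mono)
    finally have "pi / 2 * (1 + r)\<^sup>2 + D * Y \<le> (pi / 2 * r\<^sup>2 + pi * Y) + D * Y" by (rule add_right_mono)
    also have "\<dots> = pi / 2 * r\<^sup>2 + (D + pi) * Y" by (simp add: algebra_simps)
    also have "\<dots> \<le> pi / 2 * r\<^sup>2 + (\<delta> * r\<^sup>2 + B)" unfolding Y_def by (intro add_left_mono B r)
    also have "\<dots> = (pi / 2 + \<delta>) * r\<^sup>2 + B" by (simp add: algebra_simps)
    finally show ?thesis by (simp add: Y_def)
  qed
  show ?thesis
  proof (intro exI[of _ "exp (real N * B)"] conjI allI impI)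
    fix Q :: "complex set"
    assume Q: "finite Q" "\<forall>\<gamma>\<in>Q. q \<le> cmod \<gamma>" "\<forall>\<mu>. card {\<gamma>\<in>Q. nearest (\<gamma> / of_real s) = \<mu>} \<le> N"
    obtain c :: "complex \<Rightarrow> nat" where c: "\<And>x. x \<in> Q \<Longrightarrow> c x < N"
      "\<And>x y. x \<in> Q \<Longrightarrow> y \<in> Q \<Longrightarrow> nearest (x / of_real s) = nearest (y / of_real s) \<Longrightarrow> c x = c y \<Longrightarrow> x = y"
      using colour_fibres[of Q "\<lambda>\<gamma>. nearest (\<gamma> / of_real s)" N] Q(1,3) by blast
    have "\<forall>k. \<exists>g. g holomorphic_on UNIV \<and> g 0 = of_real pi \<and> (\<forall>\<gamma>\<in>(\<lambda>\<gamma>. \<gamma> / of_real s) ` {\<gamma>\<in>Q. c \<gamma> = k}. g \<gamma> = 0) \<and>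
       (\<forall>z. cmod (g z) \<le> exp (pi / 2 * (1 + cmod z)\<^sup>2 + D * ((2 + cmod z) * sqrt (2 + cmod z))))"
    proof (intro allI DQ)
      fix k
      show "finite ((\<lambda>\<gamma>. \<gamma> / of_real s) ` {\<gamma>\<in>Q. c \<gamma> = k})" using Q(1) by simp
      show "inj_on nearest ((\<lambda>\<gamma>. \<gamma> / of_real s) ` {\<gamma>\<in>Q. c \<gamma> = k})"
        using c(2) by (auto simp: inj_on_def)
      show "\<forall>\<gamma>\<in>(\<lambda>\<gamma>. \<gamma> / of_real s) ` {\<gamma>\<in>Q. c \<gamma> = k}. q / s \<le> cmod \<gamma>"
        using Q(2) s by (auto simp: norm_divide divide_right_mono)
    qed
    then obtain g where g: "\<And>k. g k holomorphic_on UNIV" "\<And>k. g k 0 = of_real pi"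
      "\<And>k \<gamma>. \<gamma> \<in> Q \<Longrightarrow> c \<gamma> = k \<Longrightarrow> g k (\<gamma> / of_real s) = 0"
      "\<And>k z. cmod (g k z) \<le> exp (pi / 2 * (1 + cmod z)\<^sup>2 + D * ((2 + cmod z) * sqrt (2 + cmod z)))"
      by (rule choice[THEN exE]) fastforce
    define G where "G = (\<lambda>z. \<Prod>k<N. g k (z / of_real s) / of_real pi)"
    show "\<exists>g. g holomorphic_on UNIV \<and> g 0 = 1 \<and> (\<forall>\<gamma>\<in>Q. g \<gamma> = 0) \<and>
       (\<forall>z. cmod (g z) \<le> exp (real N * B) * exp ((pi * real N / (2 * s\<^sup>2) + \<epsilon>) * (cmod z)\<^sup>2))"
    proof (intro exI[of _ G] conjI ballI allI)
      show "G holomorphic_on UNIV" unfolding G_def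
        using s by (intro holomorphic_intros entire_compose[OF g(1)]) auto
      show "G 0 = 1" by (simp add: G_def g(2))
      show "G \<gamma> = 0" if "\<gamma> \<in> Q" for \<gamma>
      proof -
        have "g (c \<gamma>) (\<gamma> / of_real s) / of_real pi = 0" using g(3)[OF that refl] by simp
        then show ?thesis unfolding G_def using c(1)[OF that] by (intro prod_zero) auto
      qed
      fix z
      define r where "r = cmod z / s"
      have r: "r \<ge> 0" using s by (simp add: r_def)
      have one: "cmod (g k (z / of_real s) / of_real pi) \<le> exp ((pi / 2 + \<delta>) * r\<^sup>2 + B)" for k
      proof -
        have rz: "cmod (z / of_real s) = r" using s by (simp add: r_def norm_divide)
        have "cmod (g k (z / of_real s) / of_real pi) = cmod (g k (z / of_real s)) / pi" by (simp add: norm_divide)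
        also have "\<dots> \<le> cmod (g k (z / of_real s)) / 1" using pi_gt3 by (intro divide_left_mono) auto
        also have "\<dots> \<le> exp (pi / 2 * (1 + r)\<^sup>2 + D * ((2 + r) * sqrt (2 + r)))"
          using g(4)[of k "z / of_real s"] unfolding rz by simp
        also have "\<dots> \<le> exp ((pi / 2 + \<delta>) * r\<^sup>2 + B)" using growth[OF r] by simp
        finally show ?thesis .
      qed
      have "cmod (G z) = (\<Prod>k<N. cmod (g k (z / of_real s) / of_real pi))" unfolding G_def by (rule prod_norm[symmetric])
      also have "\<dots> \<le> (\<Prod>k<N. exp ((pi / 2 + \<delta>) * r\<^sup>2 + B))" by (intro prod_mono conjI one) auto
      also have "\<dots> = exp (real N * ((pi / 2 + \<delta>) * r\<^sup>2 + B))" by (simp flip: exp_of_nat_mult)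
      also have "\<dots> \<le> exp (real N * B + (pi * real N / (2 * s\<^sup>2) + \<epsilon>) * (cmod z)\<^sup>2)"
      proof -
        have "real N * \<delta> * r\<^sup>2 = (real N / (real N + 1)) * (\<epsilon> * (cmod z)\<^sup>2)"
          using s by (simp add: \<delta>_def r_def power_divide)
        also have "\<dots> \<le> 1 * (\<epsilon> * (cmod z)\<^sup>2)" using \<epsilon> by (intro mult_right_mono) auto
        finally have 1: "real N * \<delta> * r\<^sup>2 \<le> \<epsilon> * (cmod z)\<^sup>2" by simp
        have 2: "real N * (pi / 2) * r\<^sup>2 = pi * real N / (2 * s\<^sup>2) * (cmod z)\<^sup>2"
          by (simp add: r_def power_divide)
        have "real N * ((pi / 2 + \<delta>) * r\<^sup>2 + B) = real N * B + (real N * (pi / 2) * r\<^sup>2 + real N * \<delta> * r\<^sup>2)"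
          by (simp add: algebra_simps)
        also have "\<dots> \<le> real N * B + (pi * real N / (2 * s\<^sup>2) * (cmod z)\<^sup>2 + \<epsilon> * (cmod z)\<^sup>2)"
          unfolding 2 by (intro add_left_mono 1)
        finally show ?thesis by (simp only: exp_le_cancel_iff distrib_right)
      qed
      finally show "cmod (G z) \<le> exp (real N * B) * exp ((pi * real N / (2 * s\<^sup>2) + \<epsilon>) * (cmod z)\<^sup>2)"
        by (simp only: exp_add)
    qed
  qed simp
qed

text \<open>Each term is at most a constant times the integral of \<open>exp (- c |x - z|\<^sup>2 / 2)\<close> over the ball of radius
  \<open>e / 2\<close> about \<open>w\<close>, and these balls are disjoint.\<close>
lemma separated_gaussian_sum:
  assumes e: "e > 0" and c: "c > 0"
  obtains K where "K \<ge> 0" "\<And>P z. finite P \<Longrightarrow> (\<And>x y. x \<in> P \<Longrightarrow> y \<in> P \<Longrightarrow> dist x y < e \<Longrightarrow> x = y) \<Longrightarrow>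
     (\<Sum>w\<in>P. exp (- c * (cmod (z - w))\<^sup>2)) \<le> K"
proof -
  define b where "b = pi * (e / 2)\<^sup>2"
  have b: "b > 0" using e by (simp add: b_def)
  define A where "A = exp (c * e\<^sup>2 / 4)"
  define K where "K = A * (2 * pi / c) / b"
  have K: "K \<ge> 0" using b c by (simp add: K_def A_def)
  have "(\<Sum>w\<in>P. exp (- c * (cmod (z - w))\<^sup>2)) \<le> K"
    if P: "finite P" and sep: "\<And>x y. x \<in> P \<Longrightarrow> y \<in> P \<Longrightarrow> dist x y < e \<Longrightarrow> x = y" for P z
  proof -
    define F where "F = (\<lambda>x. exp (- (c / 2) * (cmod (x - z))\<^sup>2))"
    have [measurable]: "F \<in> borel_measurable borel" unfolding F_def by measurable
    have [measurable]: "ball w (e / 2) \<in> sets borel" for w :: complex by simp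
    have one: "ennreal (b * exp (- c * (cmod (z - w))\<^sup>2)) \<le> (\<integral>\<^sup>+x. ennreal (A * F x) * indicator (ball w (e / 2)) x \<partial>lborel)" for w
    proof -
      have "ennreal (b * exp (- c * (cmod (z - w))\<^sup>2)) = (\<integral>\<^sup>+x. ennreal (exp (- c * (cmod (z - w))\<^sup>2)) * indicator (ball w (e / 2)) x \<partial>lborel)"
        using e by (subst nn_integral_cmult_indicator) (simp_all add: emeasure_ball unit_ball_vol_2 b_def mult.commute flip: ennreal_mult')
      also have "\<dots> \<le> (\<integral>\<^sup>+x. ennreal (A * F x) * indicator (ball w (e / 2)) x \<partial>lborel)"
      proof (rule nn_integral_mono)
        fix x
        have "exp (- c * (cmod (z - w))\<^sup>2) \<le> A * F x" if x: "x \<in> ball w (e / 2)"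
        proof -
          have "cmod (x - z) \<le> cmod (x - w) + cmod (z - w)"
            using norm_triangle_ineq4[of "x - w" "z - w"] by simp
          also have "\<dots> \<le> e / 2 + cmod (z - w)" using x by (simp add: dist_norm norm_minus_commute)
          finally have "(cmod (x - z))\<^sup>2 \<le> (e / 2 + cmod (z - w))\<^sup>2" by (rule power_mono) simp
          also have "\<dots> \<le> e\<^sup>2 / 2 + 2 * (cmod (z - w))\<^sup>2"
            using zero_le_power2[of "e / 2 - cmod (z - w)"] by (simp add: power2_eq_square field_simps)
          finally have "c / 2 * (cmod (x - z))\<^sup>2 \<le> c / 2 * (e\<^sup>2 / 2 + 2 * (cmod (z - w))\<^sup>2)"
            using c by (intro mult_left_mono) auto
          also have "\<dots> = c * e\<^sup>2 / 4 + c * (cmod (z - w))\<^sup>2" by (simp add: field_simps)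
          finally have "- c * (cmod (z - w))\<^sup>2 \<le> c * e\<^sup>2 / 4 + - (c / 2) * (cmod (x - z))\<^sup>2" by simp
          then have "exp (- c * (cmod (z - w))\<^sup>2) \<le> exp (c * e\<^sup>2 / 4 + - (c / 2) * (cmod (x - z))\<^sup>2)" by simp
          then show ?thesis unfolding exp_add A_def F_def .
        qed
        then show "ennreal (exp (- c * (cmod (z - w))\<^sup>2)) * indicator (ball w (e / 2)) x \<le> ennreal (A * F x) * indicator (ball w (e / 2)) x"
          by (cases "x \<in> ball w (e / 2)") (simp_all add: ennreal_leI)
      qed
      finally show ?thesis .
    qed
    have "ennreal (b * (\<Sum>w\<in>P. exp (- c * (cmod (z - w))\<^sup>2))) = (\<Sum>w\<in>P. ennreal (b * exp (- c * (cmod (z - w))\<^sup>2)))"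
      using b by (simp add: sum_distrib_left sum_nonneg)
    also have "\<dots> \<le> (\<Sum>w\<in>P. \<integral>\<^sup>+x. ennreal (A * F x) * indicator (ball w (e / 2)) x \<partial>lborel)"
      by (intro sum_mono one)
    also have "\<dots> = (\<integral>\<^sup>+x. (\<Sum>w\<in>P. ennreal (A * F x) * indicator (ball w (e / 2)) x) \<partial>lborel)"
      by (rule nn_integral_sum[symmetric]) measurable
    also have "\<dots> \<le> (\<integral>\<^sup>+x. ennreal (A * F x) \<partial>lborel)"
    proof (rule nn_integral_mono)
      fix x
      show "(\<Sum>w\<in>P. ennreal (A * F x) * indicator (ball w (e / 2)) x) \<le> ennreal (A * F x)"
      proof (cases "\<exists>w\<in>P. x \<in> ball w (e / 2)")
        case True
        then obtain w where w: "w \<in> P" "x \<in> ball w (e / 2)" by blast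
        have "x \<notin> ball u (e / 2)" if u: "u \<in> P - {w}" for u
        proof
          assume "x \<in> ball u (e / 2)"
          then have "dist u w < e" using w(2) dist_triangle_half_l[of u x e w] by (simp add: dist_commute)
          then show False using sep[of u w] u w(1) by blast
        qed
        then have "(\<Sum>w\<in>P - {w}. ennreal (A * F x) * indicator (ball w (e / 2)) x) = 0" by (intro sum.neutral) auto
        then show ?thesis using w by (simp add: sum.remove[OF P w(1)])
      qed (auto intro!: sum_nonpos simp: indicator_def)
    qed
    also have "\<dots> = ennreal A * (\<integral>\<^sup>+x. ennreal (F x) \<partial>lborel)"
      by (subst nn_integral_cmult[symmetric]) (auto simp: A_def ennreal_mult' F_def)
    also have "(\<integral>\<^sup>+x. ennreal (F x) \<partial>lborel) = ennreal (pi / (c / 2))"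
      unfolding F_def by (rule nn_integral_gauss) (use c in simp)
    also have "ennreal A * ennreal (pi / (c / 2)) = ennreal (A * (pi / (c / 2)))"
      by (rule ennreal_mult'[symmetric]) (simp add: A_def)
    also have "pi / (c / 2) = 2 * pi / c" by simp
    finally have "b * (\<Sum>w\<in>P. exp (- c * (cmod (z - w))\<^sup>2)) \<le> A * (2 * pi / c)"
      using c by (subst (asm) ennreal_le_iff) (auto simp: A_def)
    then show ?thesis unfolding K_def pos_le_divide_eq[OF b] by (simp only: mult.commute)
  qed
  then show thesis using that K by blast
qed

section \<open>Interpolation from the density\<close>

text \<open>Average the number of points of a cell \<open>A\<close> that lie in \<open>u + r I\<close> over all \<open>u\<close>. Each point is counted with weight
  \<open>r\<^sup>2\<close>, the area of \<open>r I\<close>; on the other hand at most \<open>\<beta> r\<^sup>2\<close> points are counted for each \<open>u\<close>, and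
  only for \<open>u\<close> in a square \<open>W\<close> of side \<open>s + 2 r d\<close>. For large \<open>s\<close> the two squares have nearly the same area.\<close>
lemma density_imp_cell_count:
  assumes \<alpha>: "\<alpha> > 0" and I: "compact I" "emeasure lborel I = 1"
    and ud: "uniform_discrete \<Gamma>" and dens: "upper_uniform_density I \<Gamma> < ereal (\<alpha> / pi)"
  obtains s N where "s > 0" "pi * real N / s\<^sup>2 < \<alpha>"
    "\<And>w P \<mu>. finite P \<Longrightarrow> P \<subseteq> \<Gamma> \<Longrightarrow> card {\<gamma>\<in>P. nearest ((\<gamma> - w) / of_real s) = \<mu>} \<le> N"
proof -
  obtain e where e: "e > 0" "\<And>x y. x \<in> \<Gamma> \<Longrightarrow> y \<in> \<Gamma> \<Longrightarrow> dist x y < e \<Longrightarrow> x = y"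
    using ud unfolding uniform_discrete_def by blast
  obtain K where K: "K \<ge> 0" "\<And>P z. finite P \<Longrightarrow> (\<And>x y. x \<in> P \<Longrightarrow> y \<in> P \<Longrightarrow> dist x y < e \<Longrightarrow> x = y) \<Longrightarrow>
     (\<Sum>w\<in>P. exp (- 1 * (cmod (z - w))\<^sup>2)) \<le> K"
    using separated_gaussian_sum[OF e(1) zero_less_one] by blast
  obtain d where d: "d > 0" "\<And>z. z \<in> I \<Longrightarrow> cmod z \<le> d"
    using compact_imp_bounded[OF I(1)] by (auto simp: bounded_pos)
  have Ib: "I \<in> sets borel" using I(1) by (rule borel_compact)
  obtain \<beta> where \<beta>: "upper_uniform_density I \<Gamma> < ereal \<beta>" "ereal \<beta> < ereal (\<alpha> / pi)"
    using ereal_dense2[OF dens] by blast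
  have "\<forall>\<^sub>F r in at_top. ereal (real (max_points I \<Gamma> r) / r\<^sup>2) < ereal \<beta>"
    using \<beta>(1) unfolding upper_uniform_density_def by (rule Limsup_lessD)
  then have "\<forall>\<^sub>F r in at_top. ereal (real (max_points I \<Gamma> r) / r\<^sup>2) < ereal \<beta> \<and> 0 < r"
    using eventually_gt_at_top[of "0::real"] by eventually_elim blast
  then obtain r where "ereal (real (max_points I \<Gamma> r) / r\<^sup>2) < ereal \<beta> \<and> 0 < r"
    using eventually_happens'[OF trivial_limit_at_top_linorder] by blast
  then have r: "real (max_points I \<Gamma> r) / r\<^sup>2 < \<beta>" "r > 0" by simp_all
  have \<beta>0: "\<beta> > 0" by (rule le_less_trans[OF _ r(1)]) simp
  have \<beta>1: "pi * \<beta> < \<alpha>" using \<beta>(2) by (simp add: field_simps)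
  define S where "S = (\<lambda>u. \<Gamma> \<inter> (\<lambda>z. u + of_real r * z) ` I)"
  obtain B where B: "\<And>u. finite (S u)" "\<And>u. card (S u) \<le> B"
  proof -
    define k where "k = exp (- 1 * (r * d)\<^sup>2)"
    have k: "k > 0" by (simp add: k_def)
    obtain B :: nat where B: "K / k \<le> real B" using real_arch_simple by blast
    have fin: "card P \<le> B" if P: "finite P" "P \<subseteq> S u" for P u
    proof -
      have "real (card P) * k = (\<Sum>w\<in>P. k)" by simp
      also have "\<dots> \<le> (\<Sum>w\<in>P. exp (- 1 * (cmod (u - w))\<^sup>2))"
      proof (rule sum_mono)
        fix w assume "w \<in> P"
        then obtain z where z: "z \<in> I" "w = u + of_real r * z" using P by (auto simp: S_def)
        then have "cmod (u - w) = r * cmod z" using r(2) by (simp add: norm_mult)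
        also have "\<dots> \<le> r * d" using z d r by (intro mult_left_mono) auto
        finally have "(cmod (u - w))\<^sup>2 \<le> (r * d)\<^sup>2" by (rule power_mono) simp
        then show "k \<le> exp (- 1 * (cmod (u - w))\<^sup>2)" by (simp add: k_def)
      qed
      also have "\<dots> \<le> K" using P e(2) by (intro K(2)) (auto simp: S_def)
      finally have "real (card P) \<le> K / k" using k by (simp add: pos_le_divide_eq)
      then have "real (card P) \<le> real B" using B by (rule order_trans)
      then show ?thesis by simp
    qed
    have fS: "finite (S u)" for u
    proof (rule ccontr)
      assume "infinite (S u)"
      then obtain P where "finite P" "card P = Suc B" "P \<subseteq> S u" using infinite_arbitrarily_large by blast
      with fin[of P u] show False by simp
    qed
    then show thesis using that fin by blast
  qed
  have Scard: "real (card (S u)) \<le> \<beta> * r\<^sup>2" for u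
  proof -
    have "range (\<lambda>u. card (S u)) \<subseteq> {..B}" using B(2) by auto
    then have "finite (range (\<lambda>u. card (S u)))" by (rule finite_subset) simp
    then have "card (S u) \<le> max_points I \<Gamma> r"
      unfolding max_points_def S_def by (intro Max_ge) auto
    then have "real (card (S u)) \<le> real (max_points I \<Gamma> r)" by simp
    also have "\<dots> \<le> \<beta> * r\<^sup>2" using r by (simp add: divide_less_eq less_imp_le)
    finally show ?thesis .
  qed
  have "((\<lambda>s. pi * (\<beta> * (s + 2 * (r * d))\<^sup>2) / s\<^sup>2) \<longlongrightarrow> pi * \<beta>) at_top" by real_asymp
  then have "\<forall>\<^sub>F s in at_top. pi * (\<beta> * (s + 2 * (r * d))\<^sup>2) / s\<^sup>2 < \<alpha>" using \<beta>1 by (rule order_tendstoD(2))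
  then have "\<forall>\<^sub>F s in at_top. pi * (\<beta> * (s + 2 * (r * d))\<^sup>2) / s\<^sup>2 < \<alpha> \<and> s > 0"
    using eventually_gt_at_top[of "0::real"] by eventually_elim blast
  then obtain s where s: "pi * (\<beta> * (s + 2 * (r * d))\<^sup>2) / s\<^sup>2 < \<alpha>" "s > 0"
    using eventually_happens'[OF trivial_limit_at_top_linorder] by blast
  define b where "b = \<beta> * (s + 2 * (r * d))\<^sup>2"
  have b0: "b \<ge> 0" using \<beta>0 by (simp add: b_def)
  define N where "N = nat \<lfloor>b\<rfloor>"
  have N: "real N \<le> b" using b0 by (simp add: N_def)
  show thesis
  proof (rule that[OF s(2), of N])
    have "pi * real N / s\<^sup>2 \<le> pi * b / s\<^sup>2" using N by (intro divide_right_mono mult_left_mono) auto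
    also have "\<dots> < \<alpha>" using s(1) by (simp add: b_def)
    finally show "pi * real N / s\<^sup>2 < \<alpha>" .
    fix w \<mu> and P :: "complex set" assume P: "finite P" "P \<subseteq> \<Gamma>"
    define A where "A = {\<gamma>\<in>P. nearest ((\<gamma> - w) / of_real s) = \<mu>}"
    have fA: "finite A" "A \<subseteq> \<Gamma>" using P by (auto simp: A_def)
    define c where "c = w + of_real s * \<mu>"
    have Ac: "\<bar>Re \<gamma> - Re c\<bar> \<le> s / 2 \<and> \<bar>Im \<gamma> - Im c\<bar> \<le> s / 2" if "\<gamma> \<in> A" for \<gamma>
    proof -
      define u where "u = (\<gamma> - w) / of_real s"
      have \<mu>: "\<mu> = nearest u" using that by (simp add: A_def u_def)
      have "\<gamma> = w + of_real s * u" using s(2) by (simp add: u_def)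
      then have "\<gamma> - c = of_real s * (u - \<mu>)" by (simp add: c_def algebra_simps)
      then have "Re (\<gamma> - c) = s * (Re u - Re \<mu>)" "Im (\<gamma> - c) = s * (Im u - Im \<mu>)" by simp_all
      then have "\<bar>Re (\<gamma> - c)\<bar> = s * \<bar>Re u - Re \<mu>\<bar>" "\<bar>Im (\<gamma> - c)\<bar> = s * \<bar>Im u - Im \<mu>\<bar>"
        using s(2) by (simp_all add: abs_mult)
      moreover have "\<bar>Re u - Re \<mu>\<bar> \<le> 1/2" "\<bar>Im u - Im \<mu>\<bar> \<le> 1/2"
        using of_int_round_abs_le[of "Re u"] of_int_round_abs_le[of "Im u"]
        unfolding \<mu> nearest_def by (simp_all add: abs_minus_commute)
      moreover have "s * t \<le> s / 2" if "t \<le> 1/2" for t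
        using mult_left_mono[OF that, of s] s(2) by simp
      ultimately show ?thesis by simp
    qed
    define h where "h = s / 2 + r * d"
    have h: "h > 0" using s r d by (simp add: h_def add_pos_pos)
    define W where "W = cbox (c - Complex h h) (c + Complex h h)"
    have [measurable]: "W \<in> sets borel" by (simp add: W_def)
    have W: "emeasure lborel W = ennreal ((s + 2 * (r * d))\<^sup>2)"
    proof -
      have "emeasure lborel W = ennreal ((2 * h) * (2 * h))"
        unfolding W_def using h by (subst emeasure_lborel_cbox_eq) (auto simp: Basis_complex_def)
      also have "(2 * h) * (2 * h) = (s + 2 * (r * d))\<^sup>2" by (simp add: h_def power2_eq_square algebra_simps)
      finally show ?thesis .
    qed
    have img: "\<gamma> \<in> (\<lambda>z. u + of_real r * z) ` I \<longleftrightarrow> u \<in> (\<lambda>z. \<gamma> + of_real (- r) * z) ` I" for u \<gamma>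
      by (auto simp: image_iff algebra_simps intro!: bexI)
    have r0: "- r \<noteq> 0" using r(2) by simp
    have probe_meas[measurable]: "(\<lambda>z. \<gamma> + of_real (- r) * z) ` I \<in> sets borel" for \<gamma>
      by (rule emeasure_affine_image(1)[OF r0 Ib])
    have probe: "emeasure lborel ((\<lambda>z. \<gamma> + of_real (- r) * z) ` I) = ennreal (r\<^sup>2)" for \<gamma>
      using emeasure_affine_image(2)[OF r0 Ib, of \<gamma>] I(2) by simp
    have "ennreal (real (card A) * r\<^sup>2) = (\<Sum>\<gamma>\<in>A. ennreal (r\<^sup>2))"
      by (simp add: ennreal_of_nat_eq_real_of_nat ennreal_mult')
    also have "\<dots> = (\<Sum>\<gamma>\<in>A. \<integral>\<^sup>+u. indicator ((\<lambda>z. \<gamma> + of_real (- r) * z) ` I) u \<partial>lborel)"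
    proof (intro sum.cong refl)
      fix \<gamma>
      have "(\<lambda>z. \<gamma> + of_real (- r) * z) ` I \<in> sets lborel" using probe_meas by simp
      from nn_integral_indicator[OF this] probe
      show "ennreal (r\<^sup>2) = (\<integral>\<^sup>+u. indicator ((\<lambda>z. \<gamma> + of_real (- r) * z) ` I) u \<partial>lborel)" by simp
    qed
    also have "\<dots> = (\<integral>\<^sup>+u. (\<Sum>\<gamma>\<in>A. indicator ((\<lambda>z. \<gamma> + of_real (- r) * z) ` I) u) \<partial>lborel)"
      by (rule nn_integral_sum[symmetric]) measurable
    also have "\<dots> \<le> (\<integral>\<^sup>+u. ennreal (\<beta> * r\<^sup>2) * indicator W u \<partial>lborel)"
    proof (rule nn_integral_mono)
      fix u
      define H where "H = A \<inter> (\<lambda>z. u + of_real r * z) ` I"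
      have "(\<Sum>\<gamma>\<in>A. indicator ((\<lambda>z. \<gamma> + of_real (- r) * z) ` I) u :: ennreal) = (\<Sum>\<gamma>\<in>A. indicator H \<gamma>)"
        by (intro sum.cong) (simp_all add: H_def indicator_def img)
      also have "\<dots> = of_nat (card H)"
        using fA by (simp add: indicator_def sum.If_cases H_def Int_absorb1)
      finally have eq: "(\<Sum>\<gamma>\<in>A. indicator ((\<lambda>z. \<gamma> + of_real (- r) * z) ` I) u :: ennreal) = of_nat (card H)" .
      show "(\<Sum>\<gamma>\<in>A. indicator ((\<lambda>z. \<gamma> + of_real (- r) * z) ` I) u) \<le> ennreal (\<beta> * r\<^sup>2) * indicator W u"
      proof (cases "H = {}")
        case False
        then obtain \<gamma> z where z: "\<gamma> \<in> A" "z \<in> I" "\<gamma> = u + of_real r * z" by (auto simp: H_def)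
        have "\<bar>Re z\<bar> \<le> d" "\<bar>Im z\<bar> \<le> d" using d(2)[OF z(2)] abs_Re_le_cmod[of z] abs_Im_le_cmod[of z] by linarith+
        then have rz: "\<bar>r * Re z\<bar> \<le> r * d" "\<bar>r * Im z\<bar> \<le> r * d" using r(2) by (simp_all add: abs_mult)
        have re: "Re \<gamma> = Re u + r * Re z" and im: "Im \<gamma> = Im u + r * Im z" using z(3) by simp_all
        have tri: "\<bar>x - y\<bar> \<le> p + q" if "\<bar>x + t - y\<bar> \<le> p" "\<bar>t\<bar> \<le> q" for x y t p q :: real
          using abs_triangle_ineq4[of "x + t - y" t] that by simp
        have "\<bar>Re u - Re c\<bar> \<le> h" unfolding h_def
          by (rule tri[OF _ rz(1)]) (use Ac[OF z(1)] re in simp)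
        moreover have "\<bar>Im u - Im c\<bar> \<le> h" unfolding h_def
          by (rule tri[OF _ rz(2)]) (use Ac[OF z(1)] im in simp)
        ultimately have "\<bar>Re u - Re c\<bar> \<le> h" "\<bar>Im u - Im c\<bar> \<le> h" by blast+
        then have "u \<in> W" by (auto simp: W_def in_cbox_complex_iff abs_le_iff)
        moreover have "real (card H) \<le> \<beta> * r\<^sup>2"
        proof -
          have "H \<subseteq> S u" using fA by (auto simp: H_def S_def)
          then have "card H \<le> card (S u)" using B(1) by (intro card_mono)
          then have "real (card H) \<le> real (card (S u))" by simp
          also note Scard
          finally show ?thesis .
        qed
        ultimately show ?thesis unfolding eq by (simp add: ennreal_of_nat_eq_real_of_nat ennreal_leI)
      next
        case True
        then show ?thesis unfolding eq by simp
      qed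
    qed
    also have "\<dots> = ennreal (\<beta> * r\<^sup>2) * ennreal ((s + 2 * (r * d))\<^sup>2)"
      by (simp add: nn_integral_cmult_indicator W)
    also have "\<dots> = ennreal (b * r\<^sup>2)"
      by (simp add: b_def mult_ac flip: ennreal_mult'')
    finally have "real (card A) * r\<^sup>2 \<le> b * r\<^sup>2" using b0 by (subst (asm) ennreal_le_iff) auto
    then have "real (card A) \<le> b" using r(2) by simp
    then show "card {\<gamma>\<in>P. nearest ((\<gamma> - w) / of_real s) = \<mu>} \<le> N"
      unfolding A_def[symmetric] N_def by (rule le_nat_floor)
  qed
qed

text \<open>The solution is a sum of functions with Gaussian decay about the points. Cauchy's inequality and the boundedness
  of the sums of Gaussians over \<open>\<Gamma>\<close> make its energy comparable to the sum of the squared data.\<close>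
lemma finite_interpolation:
  assumes \<alpha>: "\<alpha> > 0" and ud: "uniform_discrete \<Gamma>" and s: "s > 0" "pi * real N / s\<^sup>2 < \<alpha>"
    and cells: "\<And>w P \<mu>. finite P \<Longrightarrow> P \<subseteq> \<Gamma> \<Longrightarrow> card {\<gamma>\<in>P. nearest ((\<gamma> - w) / of_real s) = \<mu>} \<le> N"
  obtains M where "M \<ge> 0" "\<And>P a. finite P \<Longrightarrow> P \<subseteq> \<Gamma> \<Longrightarrow>
     \<exists>f. f holomorphic_on UNIV \<and> (\<forall>\<gamma>\<in>P. of_real (exp (- \<alpha> * (cmod \<gamma>)\<^sup>2 / 2)) * f \<gamma> = a \<gamma>) \<and>
       fock_energy \<alpha> f \<le> ennreal (M * (\<Sum>\<gamma>\<in>P. (cmod (a \<gamma>))\<^sup>2))"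
proof -
  obtain e where e: "e > 0" "\<And>x y. x \<in> \<Gamma> \<Longrightarrow> y \<in> \<Gamma> \<Longrightarrow> dist x y < e \<Longrightarrow> x = y"
    using ud unfolding uniform_discrete_def by blast
  \<comment> \<open>The exponent \<open>\<alpha> / 2\<close> exceeds \<open>\<pi> N / (2 s\<^sup>2)\<close> by \<open>2 \<epsilon>\<close>: one \<open>\<epsilon>\<close> pays for the excess growth, the other is the Gaussian decay.\<close>
  define \<epsilon> where "\<epsilon> = (\<alpha> - pi * real N / s\<^sup>2) / 4"
  have \<epsilon>: "\<epsilon> > 0" using s by (simp add: \<epsilon>_def)
  have expo: "pi * real N / (2 * s\<^sup>2) + \<epsilon> = \<alpha> / 2 - \<epsilon>" by (simp add: \<epsilon>_def field_simps)
  obtain C where C: "C > 0" and CQ: "\<And>Q. finite Q \<Longrightarrow> (\<forall>\<gamma>\<in>Q. e \<le> cmod \<gamma>) \<Longrightarrow> (\<forall>\<mu>. card {\<gamma>\<in>Q. nearest (\<gamma> / of_real s) = \<mu>} \<le> N) \<Longrightarrow>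
    (\<exists>g. g holomorphic_on UNIV \<and> g 0 = 1 \<and> (\<forall>\<gamma>\<in>Q. g \<gamma> = 0) \<and>
       (\<forall>z. cmod (g z) \<le> C * exp ((\<alpha> / 2 - \<epsilon>) * (cmod z)\<^sup>2)))"
    using entire_with_zeros[OF s(1) e(1) \<epsilon>, of N] unfolding expo by blast
  obtain K where K: "K \<ge> 0" "\<And>P z. finite P \<Longrightarrow> (\<And>x y. x \<in> P \<Longrightarrow> y \<in> P \<Longrightarrow> dist x y < e \<Longrightarrow> x = y) \<Longrightarrow>
     (\<Sum>w\<in>P. exp (- \<epsilon> * (cmod (z - w))\<^sup>2)) \<le> K"
    using separated_gaussian_sum[OF e(1) \<epsilon>] by blast
  define M where "M = C\<^sup>2 * K * (pi / \<epsilon>)"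
  have M: "M \<ge> 0" using K \<epsilon> by (simp add: M_def)
  have "\<exists>f. f holomorphic_on UNIV \<and> (\<forall>\<gamma>\<in>P. of_real (exp (- \<alpha> * (cmod \<gamma>)\<^sup>2 / 2)) * f \<gamma> = a \<gamma>) \<and>
       fock_energy \<alpha> f \<le> ennreal (M * (\<Sum>\<gamma>\<in>P. (cmod (a \<gamma>))\<^sup>2))"
    if P: "finite P" "P \<subseteq> \<Gamma>" for P and a :: "complex \<Rightarrow> complex"
  proof -
    have basis: "\<exists>g. g holomorphic_on UNIV \<and> (\<forall>\<gamma>\<in>P. of_real (exp (- \<alpha> * (cmod \<gamma>)\<^sup>2 / 2)) * g \<gamma> = (if \<gamma> = w then 1 else 0)) \<and>
        (\<forall>z. cmod (g z) * exp (- \<alpha> * (cmod z)\<^sup>2 / 2) \<le> C * exp (- \<epsilon> * (cmod (z - w))\<^sup>2))" if w: "w \<in> P" for w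
    proof -
      define Q where "Q = (\<lambda>\<gamma>. \<gamma> - w) ` (P - {w})"
      have "\<exists>g. g holomorphic_on UNIV \<and> g 0 = 1 \<and> (\<forall>\<gamma>\<in>Q. g \<gamma> = 0) \<and>
         (\<forall>z. cmod (g z) \<le> C * exp ((\<alpha> / 2 - \<epsilon>) * (cmod z)\<^sup>2))"
      proof (rule CQ)
        show "finite Q" using P by (simp add: Q_def)
        show "\<forall>\<gamma>\<in>Q. e \<le> cmod \<gamma>"
        proof
          fix q assume "q \<in> Q"
          then obtain \<gamma> where \<gamma>: "\<gamma> \<in> P" "\<gamma> \<noteq> w" "q = \<gamma> - w" by (auto simp: Q_def)
          then have "\<not> dist \<gamma> w < e" using e(2)[of \<gamma> w] P w by blast
          then show "e \<le> cmod q" by (simp add: \<gamma>(3) dist_norm)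
        qed
        show "\<forall>\<mu>. card {\<gamma>\<in>Q. nearest (\<gamma> / of_real s) = \<mu>} \<le> N"
        proof
          fix \<mu>
          have "{\<gamma>\<in>Q. nearest (\<gamma> / of_real s) = \<mu>} = (\<lambda>\<gamma>. \<gamma> - w) ` {\<gamma>\<in>P - {w}. nearest ((\<gamma> - w) / of_real s) = \<mu>}"
            by (auto simp: Q_def)
          then have "card {\<gamma>\<in>Q. nearest (\<gamma> / of_real s) = \<mu>} \<le> card {\<gamma>\<in>P - {w}. nearest ((\<gamma> - w) / of_real s) = \<mu>}"
            using P by (simp add: card_image_le)
          also have "\<dots> \<le> N" by (rule cells) (use P in auto)
          finally show "card {\<gamma>\<in>Q. nearest (\<gamma> / of_real s) = \<mu>} \<le> N" .
        qed
      qed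
      then obtain g where g: "g holomorphic_on UNIV" "g 0 = 1" "\<And>\<gamma>. \<gamma> \<in> Q \<Longrightarrow> g \<gamma> = 0"
         "\<And>z. cmod (g z) \<le> C * exp ((\<alpha> / 2 - \<epsilon>) * (cmod z)\<^sup>2)" by blast
      define f where "f = fock_shift \<alpha> (- w) g"
      have f: "f holomorphic_on UNIV" unfolding f_def using g(1) by (rule holomorphic_fock_shift)
      have fw: "of_real (exp (- \<alpha> * (cmod w)\<^sup>2 / 2)) * f w = 1"
      proof -
        have "- complex_of_real \<alpha> * (w * cnj (- w)) - complex_of_real (\<alpha> * (cmod (- w))\<^sup>2 / 2) = complex_of_real (\<alpha> * (cmod w)\<^sup>2 / 2)"
          using complex_norm_square[of w] by (simp add: field_simps)
        then have "f w = exp (complex_of_real (\<alpha> * (cmod w)\<^sup>2 / 2))"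
          by (simp only: f_def fock_shift_def) (simp add: g(2))
        then show ?thesis by (simp only: exp_of_real of_real_mult[symmetric] exp_add[symmetric]) simp
      qed
      have fz: "f \<gamma> = 0" if "\<gamma> \<in> P" "\<gamma> \<noteq> w" for \<gamma>
      proof -
        have "\<gamma> - w \<in> Q" using that by (auto simp: Q_def)
        then show ?thesis using g(3)[of "\<gamma> - w"] by (simp add: f_def fock_shift_def)
      qed
      have "cmod (f z) * exp (- \<alpha> * (cmod z)\<^sup>2 / 2) \<le> C * exp (- \<epsilon> * (cmod (z - w))\<^sup>2)" for z
      proof -
        have "cmod (f z) * exp (- \<alpha> * (cmod z)\<^sup>2 / 2) = cmod (g (- w + z)) * exp (- \<alpha> * (cmod (- w + z))\<^sup>2 / 2)"
          unfolding f_def by (rule cmod_fock_shift)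
        also have "\<dots> \<le> C * exp ((\<alpha> / 2 - \<epsilon>) * (cmod (- w + z))\<^sup>2) * exp (- \<alpha> * (cmod (- w + z))\<^sup>2 / 2)"
          by (intro mult_right_mono g(4)) simp
        also have "\<dots> = C * exp (- \<epsilon> * (cmod (z - w))\<^sup>2)"
          by (simp add: mult.assoc algebra_simps flip: exp_add)
        finally show ?thesis .
      qed
      then show ?thesis using f fw fz by (intro exI[of _ f]) auto
    qed
    then have "\<forall>w. \<exists>g. w \<in> P \<longrightarrow> (g holomorphic_on UNIV \<and> (\<forall>\<gamma>\<in>P. of_real (exp (- \<alpha> * (cmod \<gamma>)\<^sup>2 / 2)) * g \<gamma> = (if \<gamma> = w then 1 else 0)) \<and>
        (\<forall>z. cmod (g z) * exp (- \<alpha> * (cmod z)\<^sup>2 / 2) \<le> C * exp (- \<epsilon> * (cmod (z - w))\<^sup>2)))" by blast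
    then obtain g where g': "\<forall>w. w \<in> P \<longrightarrow> (g w holomorphic_on UNIV \<and> (\<forall>\<gamma>\<in>P. of_real (exp (- \<alpha> * (cmod \<gamma>)\<^sup>2 / 2)) * g w \<gamma> = (if \<gamma> = w then 1 else 0)) \<and>
        (\<forall>z. cmod (g w z) * exp (- \<alpha> * (cmod z)\<^sup>2 / 2) \<le> C * exp (- \<epsilon> * (cmod (z - w))\<^sup>2)))"
      by (rule choice[THEN exE])
    have g: "g w holomorphic_on UNIV"
      "\<And>\<gamma>. \<gamma> \<in> P \<Longrightarrow> of_real (exp (- \<alpha> * (cmod \<gamma>)\<^sup>2 / 2)) * g w \<gamma> = (if \<gamma> = w then 1 else 0)"
      "\<And>z. cmod (g w z) * exp (- \<alpha> * (cmod z)\<^sup>2 / 2) \<le> C * exp (- \<epsilon> * (cmod (z - w))\<^sup>2)" if "w \<in> P" for w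
      using g'[rule_format, OF that] by blast+
    define f where "f = (\<lambda>z. \<Sum>w\<in>P. a w * g w z)"
    define E where "E = (\<lambda>w z. exp (- \<epsilon> * (cmod (z - w))\<^sup>2))"
    have [measurable]: "E w \<in> borel_measurable borel" for w unfolding E_def by measurable
    have f: "f holomorphic_on UNIV" unfolding f_def by (intro holomorphic_intros g)
    have fa: "of_real (exp (- \<alpha> * (cmod \<gamma>)\<^sup>2 / 2)) * f \<gamma> = a \<gamma>" if \<gamma>: "\<gamma> \<in> P" for \<gamma>
    proof -
      have "of_real (exp (- \<alpha> * (cmod \<gamma>)\<^sup>2 / 2)) * f \<gamma> = (\<Sum>w\<in>P. a w * (of_real (exp (- \<alpha> * (cmod \<gamma>)\<^sup>2 / 2)) * g w \<gamma>))"
        unfolding f_def sum_distrib_left by (simp only: mult.left_commute)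
      also have "\<dots> = (\<Sum>w\<in>P. if \<gamma> = w then a w else 0)"
      proof (intro sum.cong refl)
        fix w assume w: "w \<in> P"
        show "a w * (of_real (exp (- \<alpha> * (cmod \<gamma>)\<^sup>2 / 2)) * g w \<gamma>) = (if \<gamma> = w then a w else 0)"
          unfolding g(2)[OF w \<gamma>] by simp
      qed
      also have "\<dots> = a \<gamma>" using P(1) \<gamma> by simp
      finally show ?thesis .
    qed
    have pt: "(cmod (f z))\<^sup>2 * exp (- \<alpha> * (cmod z)\<^sup>2) \<le> (\<Sum>w\<in>P. C\<^sup>2 * K * (cmod (a w))\<^sup>2 * E w z)" for z
    proof -
      define t where "t = exp (- \<alpha> * (cmod z)\<^sup>2 / 2)"
      define R where "R = (\<lambda>w. exp (- \<epsilon> * (cmod (z - w))\<^sup>2 / 2))"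
      have RR: "R w * R w = E w z" "(R w)\<^sup>2 = E w z" for w
        by (simp_all add: R_def E_def power2_eq_square flip: exp_add)
      have "cmod (f z) * t \<le> (\<Sum>w\<in>P. cmod (a w * g w z)) * t"
        unfolding f_def by (intro mult_right_mono norm_sum) (simp add: t_def)
      also have "\<dots> = (\<Sum>w\<in>P. cmod (a w) * (cmod (g w z) * t))" by (simp add: sum_distrib_right norm_mult mult.assoc)
      also have "\<dots> \<le> (\<Sum>w\<in>P. cmod (a w) * (C * E w z))"
        unfolding t_def E_def by (intro sum_mono mult_left_mono g) auto
      also have "\<dots> = (\<Sum>w\<in>P. (C * cmod (a w) * R w) * R w)"
        by (intro sum.cong refl) (simp add: mult.assoc RR(1) mult_ac)
      finally have "(cmod (f z) * t)\<^sup>2 \<le> (\<Sum>w\<in>P. (C * cmod (a w) * R w) * R w)\<^sup>2"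
        by (rule power_mono) (simp add: t_def)
      also have "\<dots> \<le> (\<Sum>w\<in>P. (C * cmod (a w) * R w)\<^sup>2) * (\<Sum>w\<in>P. (R w)\<^sup>2)" by (rule Cauchy_Schwarz_ineq_sum)
      also have "\<dots> \<le> (\<Sum>w\<in>P. (C * cmod (a w) * R w)\<^sup>2) * K"
        unfolding RR(2) E_def using e(2) P by (intro mult_left_mono K(2) sum_nonneg) auto
      also have "\<dots> = (\<Sum>w\<in>P. C\<^sup>2 * K * (cmod (a w))\<^sup>2 * E w z)"
        unfolding sum_distrib_right by (intro sum.cong refl) (simp add: power_mult_distrib RR(2) mult_ac)
      finally show ?thesis by (simp add: t_def power_mult_distrib flip: exp_of_nat_mult)
    qed
    have "fock_energy \<alpha> f \<le> (\<integral>\<^sup>+z. (\<Sum>w\<in>P. ennreal (C\<^sup>2 * K * (cmod (a w))\<^sup>2) * ennreal (E w z)) \<partial>lborel)"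
      unfolding fock_energy_def
    proof (rule nn_integral_mono)
      fix z
      have "(\<Sum>w\<in>P. ennreal (C\<^sup>2 * K * (cmod (a w))\<^sup>2) * ennreal (E w z)) = ennreal (\<Sum>w\<in>P. C\<^sup>2 * K * (cmod (a w))\<^sup>2 * E w z)"
        using K(1) by (simp add: E_def sum_nonneg flip: ennreal_mult'')
      then show "ennreal ((cmod (f z))\<^sup>2 * exp (- \<alpha> * (cmod z)\<^sup>2)) \<le> (\<Sum>w\<in>P. ennreal (C\<^sup>2 * K * (cmod (a w))\<^sup>2) * ennreal (E w z))"
        using ennreal_leI[OF pt[of z]] by simp
    qed
    also have "\<dots> = (\<Sum>w\<in>P. \<integral>\<^sup>+z. ennreal (C\<^sup>2 * K * (cmod (a w))\<^sup>2) * ennreal (E w z) \<partial>lborel)"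
      by (rule nn_integral_sum) measurable
    also have "\<dots> = (\<Sum>w\<in>P. ennreal (C\<^sup>2 * K * (cmod (a w))\<^sup>2) * ennreal (pi / \<epsilon>))"
      by (intro sum.cong refl, subst nn_integral_cmult) (simp_all add: E_def nn_integral_gauss[OF \<epsilon>, simplified])
    also have "\<dots> = ennreal (\<Sum>w\<in>P. C\<^sup>2 * K * (cmod (a w))\<^sup>2 * (pi / \<epsilon>))"
    proof -
      have "ennreal (C\<^sup>2 * K * (cmod (a w))\<^sup>2) * ennreal (pi / \<epsilon>) = ennreal (C\<^sup>2 * K * (cmod (a w))\<^sup>2 * (pi / \<epsilon>))" for w
        using \<epsilon> by (intro ennreal_mult''[symmetric]) simp
      then show ?thesis using K(1) \<epsilon> by (simp only:) (intro sum_ennreal, simp)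
    qed
    also have "(\<Sum>w\<in>P. C\<^sup>2 * K * (cmod (a w))\<^sup>2 * (pi / \<epsilon>)) = M * (\<Sum>w\<in>P. (cmod (a w))\<^sup>2)"
      unfolding sum_distrib_left by (intro sum.cong refl) (simp add: M_def mult_ac)
    finally show ?thesis using f fa by (intro exI[of _ f]) auto
  qed
  then show thesis using that M by blast
qed

text \<open>Solve the problems for the points in growing discs with a uniform energy bound and take a limit.\<close>
lemma density_imp_interpolation:
  assumes \<alpha>: "\<alpha> > 0" and I: "compact I" "emeasure lborel I = 1"
    and ud: "uniform_discrete \<Gamma>" and dens: "upper_uniform_density I \<Gamma> < ereal (\<alpha> / pi)"
  shows "interpolation_set \<alpha> \<Gamma>"
  unfolding interpolation_set_def
proof (intro allI impI)
  fix a :: "complex \<Rightarrow> complex" assume a: "(\<lambda>z. (cmod (a z))\<^sup>2) summable_on \<Gamma>"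
  obtain s N where s: "s > 0" "pi * real N / s\<^sup>2 < \<alpha>"
    "\<And>w P \<mu>. finite P \<Longrightarrow> P \<subseteq> \<Gamma> \<Longrightarrow> card {\<gamma>\<in>P. nearest ((\<gamma> - w) / of_real s) = \<mu>} \<le> N"
    using density_imp_cell_count[OF \<alpha> I ud dens] by blast
  obtain M where M: "M \<ge> 0" "\<And>P a. finite P \<Longrightarrow> P \<subseteq> \<Gamma> \<Longrightarrow>
     \<exists>f. f holomorphic_on UNIV \<and> (\<forall>\<gamma>\<in>P. of_real (exp (- \<alpha> * (cmod \<gamma>)\<^sup>2 / 2)) * f \<gamma> = a \<gamma>) \<and>
       fock_energy \<alpha> f \<le> ennreal (M * (\<Sum>\<gamma>\<in>P. (cmod (a \<gamma>))\<^sup>2))"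
    using finite_interpolation[OF \<alpha> ud s] by blast
  define A where "A = infsum (\<lambda>z. (cmod (a z))\<^sup>2) \<Gamma>"
  have finG: "finite (\<Gamma> \<inter> cball 0 (real n))" for n
  proof -
    have "uniform_discrete (\<Gamma> \<inter> cball 0 (real n))" using ud unfolding uniform_discrete_def by blast
    then show ?thesis using uniform_discrete_finite_iff[of "\<Gamma> \<inter> cball 0 (real n)"]
      by (simp add: bounded_Int)
  qed
  have "\<forall>n. \<exists>f. f holomorphic_on UNIV \<and> (\<forall>\<gamma>\<in>\<Gamma> \<inter> cball 0 (real n). of_real (exp (- \<alpha> * (cmod \<gamma>)\<^sup>2 / 2)) * f \<gamma> = a \<gamma>) \<and>
       fock_energy \<alpha> f \<le> ennreal (M * (\<Sum>\<gamma>\<in>\<Gamma> \<inter> cball 0 (real n). (cmod (a \<gamma>))\<^sup>2))"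
    by (intro allI M(2) finG) simp
  then obtain f where f': "\<forall>n. f n holomorphic_on UNIV \<and> (\<forall>\<gamma>\<in>\<Gamma> \<inter> cball 0 (real n). of_real (exp (- \<alpha> * (cmod \<gamma>)\<^sup>2 / 2)) * f n \<gamma> = a \<gamma>) \<and>
       fock_energy \<alpha> (f n) \<le> ennreal (M * (\<Sum>\<gamma>\<in>\<Gamma> \<inter> cball 0 (real n). (cmod (a \<gamma>))\<^sup>2))"
    by (rule choice[THEN exE])
  have f: "f n holomorphic_on UNIV" for n using f' by blast
  have fv: "of_real (exp (- \<alpha> * (cmod \<gamma>)\<^sup>2 / 2)) * f n \<gamma> = a \<gamma>" if "\<gamma> \<in> \<Gamma>" "cmod \<gamma> \<le> real n" for n \<gamma>
  proof -
    have "\<gamma> \<in> \<Gamma> \<inter> cball 0 (real n)" using that by simp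
    then show ?thesis using f' by blast
  qed
  have fe: "fock_energy \<alpha> (f n) \<le> ennreal (M * A)" for n
  proof -
    have "(\<Sum>\<gamma>\<in>\<Gamma> \<inter> cball 0 (real n). (cmod (a \<gamma>))\<^sup>2) \<le> A"
      unfolding A_def by (rule finite_sum_le_infsum[OF a finG]) auto
    then have "ennreal (M * (\<Sum>\<gamma>\<in>\<Gamma> \<inter> cball 0 (real n). (cmod (a \<gamma>))\<^sup>2)) \<le> ennreal (M * A)"
      using M(1) by (intro ennreal_leI mult_left_mono)
    then show ?thesis using f' order_trans by blast
  qed
  obtain g k where g: "g holomorphic_on UNIV" "strict_mono (k :: nat \<Rightarrow> nat)"
    "\<And>z. (\<lambda>n. f (k n) z) \<longlonglongrightarrow> g z" "fock_energy \<alpha> g \<le> ennreal (M * A)"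
    by (rule fock_limit[of \<alpha> f "M * A", OF \<alpha> f fe]) (rule that)
  show "\<exists>f\<in>fock_space \<alpha>. \<forall>z\<in>\<Gamma>. complex_of_real (exp (- \<alpha> * (cmod z)\<^sup>2 / 2)) * f z = a z"
  proof (intro bexI ballI)
    show "g \<in> fock_space \<alpha>" unfolding fock_space_iff[OF \<alpha>]
      using g(1) le_less_trans[OF g(4) ennreal_less_top] by simp
    fix z assume z: "z \<in> \<Gamma>"
    obtain m :: nat where m: "cmod z \<le> real m" using real_arch_simple by blast
    have "\<forall>\<^sub>F n in sequentially. of_real (exp (- \<alpha> * (cmod z)\<^sup>2 / 2)) * f (k n) z = a z"
      using eventually_ge_at_top[of m]
    proof eventually_elim
      fix n assume "n \<ge> m"
      then have "m \<le> k n" using seq_suble[OF g(2), of n] by (rule order_trans)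
      then have "cmod z \<le> real (k n)" using m by simp
      then show "of_real (exp (- \<alpha> * (cmod z)\<^sup>2 / 2)) * f (k n) z = a z" by (rule fv[OF z])
    qed
    then have "(\<lambda>n. of_real (exp (- \<alpha> * (cmod z)\<^sup>2 / 2)) * f (k n) z) \<longlonglongrightarrow> a z" by (rule tendsto_eventually)
    moreover have "(\<lambda>n. of_real (exp (- \<alpha> * (cmod z)\<^sup>2 / 2)) * f (k n) z) \<longlonglongrightarrow> of_real (exp (- \<alpha> * (cmod z)\<^sup>2 / 2)) * g z"
      by (intro tendsto_intros g)
    ultimately show "complex_of_real (exp (- \<alpha> * (cmod z)\<^sup>2 / 2)) * g z = a z" by (rule LIMSEQ_unique[rotated])
  qed
qed

theorem theorem1p2:
  fixes \<alpha> :: real and I \<Gamma> :: "complex set"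
  assumes "\<alpha> > 0"
    and "compact I" and "emeasure lborel I = 1" and "emeasure lborel (frontier I) = 0"
    and "discrete \<Gamma>"
  shows "interpolation_set \<alpha> \<Gamma> \<longleftrightarrow>
    uniform_discrete \<Gamma> \<and> upper_uniform_density I \<Gamma> < ereal (\<alpha> / pi)"
  using assms interpolation_imp_uniform_discrete interpolation_imp_density density_imp_interpolation by blast

end
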